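(* Let $\varepsilon$ be a linear character of $\mathcal H_0$. As operators on $\mathrm{Frac}(R)$, $$\sum_{w\in W}\mathfrak T_w=\left[\prod_{\alpha\in\Phi^+_{-1}(\varepsilon)}(1-q\pi^{\alpha^\vee})\right]\Omega\left[\prod_{\alpha\in\Phi^+_q(\varepsilon)}(1-q\pi^{\alpha^\vee})\right],$$ where $$\Omega=\pi^{-\rho^\vee}\prod_{\alpha\in\Phi^+}(\pi^{-\alpha^\vee}-1)^{-1}\sum_{w\in W}(-1)^{\ell(w)}\,w\,\pi^{-\rho^\vee}.$$
   Context: Let $G$ be a split connected reductive group over a $p$-adic field with residue field of cardinality $q$, with split maximal torus $T$, Borel $B\supset T$, positive roots $\Phi^+$, simple roots $\alpha_i$ with simple reflections $s_i$, finite Weyl group $W$ with length $\ell$. $P^\vee$ is the cocharacter lattice of $T$, $R=\mathbb C[P^\vee]$ with basis $\{\pi^\mu:\mu\in P^\vee\}$, $\mathrm{Frac}(R)$ its fraction field, on which $W$ acts by $w(\pi^\mu)=\pi^{w(\mu)}$ (write $f^{s_i}=s_i(f)$). An element of $\mathrm{Frac}(R)$ appearing in an operator expression denotes multiplication by it, and products of operators are compositions. $\mathcal H_0$ is the finite Hecke algebra of $W$: basis $T_w$, generators $T_{s_i}$ satisfying the braid relations and $(T_{s_i}-q)(T_{s_i}+1)=0$. A linear character $\varepsilon$ takes the value $-1$ or $q$ on each $T_{s_i}$. For $c\in\{-1,q\}$, $\Phi^+_c(\varepsilon)$ is the set of positive roots of the same length as (for irreducible root systems equivalently, and in general by definition,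 $W$-conjugate to) a simple root $\alpha_i$ with $\varepsilon(T_{s_i})=c$. $\rho^\vee=\frac12\sum_{\alpha\in\Phi^+}\alpha^\vee$, $\rho_\varepsilon^\vee=\frac12\sum_{\alpha\in\Phi^+_{-1}(\varepsilon)}\alpha^\vee$, with $\rho_\varepsilon^\vee\in P^\vee$ assumed (automatic if $P^\vee$ is the full coweight lattice). If $\rho^\vee\notin P^\vee$, $\Omega$ is computed in the fraction field of $\mathbb C[\frac12P^\vee]$; it preserves $\mathrm{Frac}(R)$. $T_{s_i}$ acts on $\mathrm{Frac}(R)$ by $T_{s_i}f=\left[\varepsilon(T_{s_i})+\frac{1-q}{1-\pi^{-\alpha_i^\vee}}\right]f^{s_i}+\frac{q-1}{1-\pi^{-\alpha_i^\vee}}f$ (the left action in the module induced from $\varepsilon$ to the affine Hecke algebra). Define $\mathfrak T_i=\pi^{\rho_\varepsilon^\vee}T_{s_i}\pi^{-\rho_\varepsilon^\vee}$, and $\mathfrak T_w=\mathfrak T_{i_1}\cdots\mathfrak T_{i_k}$ for a reduced decomposition $w=s_{i_1}\cdots s_{i_k}$ (independent of the decomposition). Empty products are $1$. *)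

theory Defs
  imports
    Complex_Main
    "HOL-Number_Theory.Prime_Powers"
    "HOL-Library.Poly_Mapping"
    "HOL-Computational_Algebra.Fraction_Field"
begin

hide_const (open) Rat.Fract

section \<open>Lattices\<close>

class fin_free_ab_group = ab_group_add +
  assumes ex_coordinates:
    "\<exists>(n::nat) (c :: 'a \<Rightarrow> nat \<Rightarrow> int).
       bij_betw c UNIV {v. \<forall>i\<ge>n. v i = 0} \<and> (\<forall>x y i. c (x + y) i = c x i + c y i)"

definition zscale :: "int \<Rightarrow> 'a::ab_group_add \<Rightarrow> 'a" where
  "zscale k x = (if 0 \<le> k then ((+) x ^^ nat k) 0 else - (((+) x ^^ nat (- k)) 0))"

text \<open>The lattice \<open>\<onehalf>P\<close>: the element \<open>half \<mu>\<close> stands for \<open>\<mu>/2\<close>, so that the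
  inclusion of \<open>P\<close> is \<open>\<mu> \<mapsto> half (\<mu> + \<mu>)\<close>.\<close>

typedef 'a half = "UNIV :: 'a set"
  morphisms twice half ..

setup_lifting type_definition_half

instantiation half :: (ab_group_add) ab_group_add
begin
lift_definition zero_half :: "'a half" is 0 .
lift_definition plus_half :: "'a half \<Rightarrow> 'a half \<Rightarrow> 'a half" is "(+)" .
lift_definition minus_half :: "'a half \<Rightarrow> 'a half \<Rightarrow> 'a half" is "(-)" .
lift_definition uminus_half :: "'a half \<Rightarrow> 'a half" is uminus .
instance by standard (transfer; simp add: algebra_simps)+
end

instance half :: (fin_free_ab_group) fin_free_ab_group
proof
  obtain n and c :: "'a \<Rightarrow> nat \<Rightarrow> int" where
    c: "bij_betw c UNIV {v. \<forall>i\<ge>n. v i = 0}" "\<And>x y i. c (x + y) i = c x i + c y i"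
    using ex_coordinates by blast
  have "bij_betw (twice :: 'a half \<Rightarrow> 'a) UNIV UNIV"
    by (rule bij_betw_byWitness[where f' = half]) (auto simp: twice_inverse half_inverse)
  then have "bij_betw (c \<circ> twice) UNIV {v. \<forall>i\<ge>n. v i = 0}"
    using c(1) by (rule bij_betw_trans)
  moreover have "\<forall>x y i. (c \<circ> twice) (x + y) i = (c \<circ> twice) x i + (c \<circ> twice) y i"
    by (simp add: c(2) plus_half.rep_eq)
  ultimately show "\<exists>(n::nat) (c :: 'a half \<Rightarrow> nat \<Rightarrow> int).
       bij_betw c UNIV {v. \<forall>i\<ge>n. v i = 0} \<and> (\<forall>x y i. c (x + y) i = c x i + c y i)"
    by blast
qed

definition half_incl :: "'a::ab_group_add \<Rightarrow> 'a half" where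
  "half_incl \<mu> = half (\<mu> + \<mu>)"

definition half_map :: "('a \<Rightarrow> 'a) \<Rightarrow> 'a half \<Rightarrow> 'a half" where
  "half_map w x = half (w (twice x))"


section \<open>Group algebras and their fraction fields\<close>

definition push_pm :: "('a \<Rightarrow> 'b) \<Rightarrow> ('a \<Rightarrow>\<^sub>0 complex) \<Rightarrow> ('b \<Rightarrow>\<^sub>0 complex)" where
  "push_pm \<phi> f = (\<Sum>\<mu>\<in>Poly_Mapping.keys f. Poly_Mapping.single (\<phi> \<mu>) (Poly_Mapping.lookup f \<mu>))"

lemma push_pm_superset:
  assumes "finite A" "Poly_Mapping.keys f \<subseteq> A"
  shows "push_pm \<phi> f = (\<Sum>\<mu>\<in>A. Poly_Mapping.single (\<phi> \<mu>) (Poly_Mapping.lookup f \<mu>))"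
  unfolding push_pm_def using assms
  by (intro sum.mono_neutral_left) (auto simp: in_keys_iff)

lemma push_pm_single [simp]: "push_pm \<phi> (Poly_Mapping.single \<mu> c) = Poly_Mapping.single (\<phi> \<mu>) c"
  by (subst push_pm_superset[of "{\<mu>}"]) auto

lemma push_pm_zero [simp]: "push_pm \<phi> 0 = 0"
  by (simp add: push_pm_def)

lemma push_pm_add: "push_pm \<phi> (f + g) = push_pm \<phi> f + push_pm \<phi> g"
proof -
  let ?A = "Poly_Mapping.keys f \<union> Poly_Mapping.keys g"
  have "Poly_Mapping.keys (f + g) \<subseteq> ?A" by (rule Poly_Mapping.keys_add)
  then show ?thesis
    by (simp add: push_pm_superset[of ?A] lookup_add single_add sum.distrib)
qed

lemma push_pm_sum: "push_pm \<phi> (sum F A) = (\<Sum>x\<in>A. push_pm \<phi> (F x))"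
  by (induction A rule: infinite_finite_induct) (auto simp: push_pm_add)

lemma pm_sum_single: "f = (\<Sum>\<mu>\<in>Poly_Mapping.keys f. Poly_Mapping.single \<mu> (Poly_Mapping.lookup f \<mu>))"
  for f :: "'a \<Rightarrow>\<^sub>0 complex"
  by (rule poly_mapping_eqI)
    (simp add: lookup_sum lookup_single when_def in_keys_iff)

lemma push_pm_mult:
  fixes \<phi> :: "'a::comm_monoid_add \<Rightarrow> 'b::comm_monoid_add"
  assumes "\<And>x y. \<phi> (x + y) = \<phi> x + \<phi> y"
  shows "push_pm \<phi> (f * g) = push_pm \<phi> f * push_pm \<phi> g"
proof -
  have "f * g = (\<Sum>\<mu>\<in>Poly_Mapping.keys f. \<Sum>\<nu>\<in>Poly_Mapping.keys g.
          Poly_Mapping.single \<mu> (Poly_Mapping.lookup f \<mu>) * Poly_Mapping.single \<nu> (Poly_Mapping.lookup g \<nu>))"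
    by (subst pm_sum_single[of f], subst pm_sum_single[of g]) (rule sum_product)
  then have "push_pm \<phi> (f * g) = (\<Sum>\<mu>\<in>Poly_Mapping.keys f. \<Sum>\<nu>\<in>Poly_Mapping.keys g.
          Poly_Mapping.single (\<phi> \<mu>) (Poly_Mapping.lookup f \<mu>) * Poly_Mapping.single (\<phi> \<nu>) (Poly_Mapping.lookup g \<nu>))"
    by (simp add: push_pm_sum mult_single assms)
  also have "\<dots> = push_pm \<phi> f * push_pm \<phi> g"
    by (simp add: push_pm_def sum_product)
  finally show ?thesis .
qed

lemma lookup_push_pm:
  assumes "inj \<phi>"
  shows "Poly_Mapping.lookup (push_pm \<phi> f) (\<phi> \<mu>) = Poly_Mapping.lookup f \<mu>"
proof -
  have "Poly_Mapping.lookup (push_pm \<phi> f) (\<phi> \<mu>) = (\<Sum>\<nu>\<in>Poly_Mapping.keys f. Poly_Mapping.lookup f \<nu> when \<nu> = \<mu>)"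
    using assms by (simp add: push_pm_def lookup_sum lookup_single inj_eq)
  also have "\<dots> = Poly_Mapping.lookup f \<mu>"
    by (simp add: when_def in_keys_iff)
  finally show ?thesis .
qed

lemma push_pm_eq_0_iff:
  assumes "inj \<phi>"
  shows "push_pm \<phi> f = 0 \<longleftrightarrow> f = 0"
proof
  assume "push_pm \<phi> f = 0"
  then have "Poly_Mapping.lookup f \<mu> = 0" for \<mu>
    using lookup_push_pm[OF assms, of f \<mu>] by simp
  then show "f = 0" by (intro poly_mapping_eqI) simp
qed simp

text \<open>A copy of \<open>'a \<Rightarrow>\<^sub>0 complex\<close>. The library makes the latter an integral domain only for linearly
  ordered exponents, whereas here no order on the lattice is part of the data.\<close>

typedef 'a group_algebra = "UNIV :: ('a \<Rightarrow>\<^sub>0 complex) set"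
  morphisms ga_coeffs Abs_ga ..

setup_lifting type_definition_group_algebra

instantiation group_algebra :: (ab_group_add) comm_ring_1
begin
lift_definition zero_group_algebra :: "'a group_algebra" is 0 .
lift_definition one_group_algebra :: "'a group_algebra" is 1 .
lift_definition plus_group_algebra ::
  "'a group_algebra \<Rightarrow> 'a group_algebra \<Rightarrow> 'a group_algebra" is "(+)" .
lift_definition minus_group_algebra ::
  "'a group_algebra \<Rightarrow> 'a group_algebra \<Rightarrow> 'a group_algebra" is "(-)" .
lift_definition uminus_group_algebra ::
  "'a group_algebra \<Rightarrow> 'a group_algebra" is uminus .
lift_definition times_group_algebra ::
  "'a group_algebra \<Rightarrow> 'a group_algebra \<Rightarrow> 'a group_algebra" is "(*)" .
instance by standard (transfer; simp add: algebra_simps)+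
end

instance group_algebra :: (fin_free_ab_group) idom
proof
  fix f g :: "'a group_algebra"
  assume fg: "f \<noteq> 0" "g \<noteq> 0"
  obtain n and c :: "'a \<Rightarrow> nat \<Rightarrow> int" where
    c: "bij_betw c UNIV {v. \<forall>i\<ge>n. v i = 0}" "\<And>x y i. c (x + y) i = c x i + c y i"
    using ex_coordinates by blast
  define \<phi> :: "'a \<Rightarrow> nat \<Rightarrow>\<^sub>0 int" where "\<phi> x = Abs_poly_mapping (c x)" for x
  have "finite {i. c x i \<noteq> 0}" for x
  proof (rule finite_subset)
    have "c x \<in> {v. \<forall>i\<ge>n. v i = 0}" using c(1) by (auto simp: bij_betw_def)
    then show "{i. c x i \<noteq> 0} \<subseteq> {..<n}" by (auto simp: not_le[symmetric])
  qed simp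
  then have lk: "Poly_Mapping.lookup (\<phi> x) = c x" for x
    by (simp add: \<phi>_def Abs_poly_mapping_inverse)
  have inj: "inj \<phi>"
  proof (rule injI)
    fix x y assume "\<phi> x = \<phi> y"
    then have "c x = c y" by (simp add: lk[symmetric])
    then show "x = y" using c(1) by (auto simp: bij_betw_def dest: injD)
  qed
  have add: "\<phi> (x + y) = \<phi> x + \<phi> y" for x y
    by (rule poly_mapping_eqI) (simp add: lk lookup_add c(2))
  have "push_pm \<phi> (ga_coeffs f) * push_pm \<phi> (ga_coeffs g) \<noteq> 0"
    using fg by (simp add: push_pm_eq_0_iff[OF inj] ga_coeffs_inject[symmetric] zero_group_algebra.rep_eq)
  then have "ga_coeffs f * ga_coeffs g \<noteq> 0"
    using push_pm_mult[of \<phi> "ga_coeffs f" "ga_coeffs g", OF add] by auto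
  then show "f * g \<noteq> 0"
    using times_group_algebra.rep_eq[of f g] by (auto simp: zero_group_algebra.rep_eq)
qed

lift_definition ga_single :: "'a \<Rightarrow> complex \<Rightarrow> 'a group_algebra" is Poly_Mapping.single .

lift_definition ga_push :: "('a \<Rightarrow> 'b) \<Rightarrow> 'a group_algebra \<Rightarrow> 'b group_algebra" is push_pm .

type_synonym 'a Frac_alg = "'a group_algebra fract"

definition expo :: "'a::fin_free_ab_group \<Rightarrow> 'a Frac_alg" (\<open>\<pi>\<^bsup>_\<^esup>\<close> [0] 1000) where
  "\<pi>\<^bsup>\<mu>\<^esup> = Fract (ga_single \<mu> 1) 1"

definition const_frac :: "complex \<Rightarrow> 'a::fin_free_ab_group Frac_alg" where
  "const_frac c = Fract (ga_single 0 c) 1"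

text \<open>The field homomorphism induced by an injective homomorphism of the underlying domains.\<close>

definition map_fract :: "('a::idom \<Rightarrow> 'b::idom) \<Rightarrow> 'a fract \<Rightarrow> 'b fract" where
  "map_fract h x = (THE y. \<exists>a b. b \<noteq> 0 \<and> x = Fract a b \<and> y = Fract (h a) (h b))"

definition frac_push :: "('a \<Rightarrow> 'b) \<Rightarrow> 'a::fin_free_ab_group Frac_alg \<Rightarrow> 'b::fin_free_ab_group Frac_alg" where
  "frac_push \<phi> = map_fract (ga_push \<phi>)"

lemma map_fract_Fract:
  assumes "\<And>x y. h (x * y) = h x * h y" "\<And>x. h x = 0 \<longleftrightarrow> x = 0"
    and "inj h" "b \<noteq> 0"
  shows "map_fract h (Fract a b) = Fract (h a) (h b)"
  unfolding map_fract_def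
proof (rule the_equality)
  show "\<exists>a' b'. b' \<noteq> 0 \<and> Fract a b = Fract a' b' \<and> Fract (h a) (h b) = Fract (h a') (h b')"
    using assms(4) by blast
next
  fix y assume "\<exists>a' b'. b' \<noteq> 0 \<and> Fract a b = Fract a' b' \<and> y = Fract (h a') (h b')"
  then obtain a' b' where *: "b' \<noteq> 0" "Fract a b = Fract a' b'" "y = Fract (h a') (h b')"
    by blast
  then have "a * b' = a' * b" using assms(4) by (simp add: eq_fract)
  then have "h a * h b' = h a' * h b" by (metis assms(1))
  then show "y = Fract (h a) (h b)" using * assms(2,4) by (simp add: eq_fract)
qed

lemma ga_push_add: "ga_push \<phi> (f + g) = ga_push \<phi> f + ga_push \<phi> g"
  by transfer (rule push_pm_add)

lemma ga_push_mult:
  assumes "\<And>x y. \<phi> (x + y) = \<phi> x + \<phi> y"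
  shows "ga_push \<phi> (f * g) = ga_push \<phi> f * ga_push \<phi> g"
  using assms by transfer (rule push_pm_mult)

lemma ga_push_eq_0_iff:
  assumes "inj \<phi>"
  shows "ga_push \<phi> f = 0 \<longleftrightarrow> f = 0"
  using assms by transfer (rule push_pm_eq_0_iff)

lemma inj_ga_push:
  assumes "inj \<phi>"
  shows "inj (ga_push \<phi>)"
proof (rule injI, transfer fixing: \<phi>)
  fix f g assume "push_pm \<phi> f = push_pm \<phi> g"
  then have "Poly_Mapping.lookup f \<mu> = Poly_Mapping.lookup g \<mu>" for \<mu>
    using lookup_push_pm[OF assms, of f \<mu>] lookup_push_pm[OF assms, of g \<mu>] by simp
  then show "f = g" by (rule poly_mapping_eqI)
qed

lemma frac_push_Fract:
  assumes "\<And>x y. \<phi> (x + y) = \<phi> x + \<phi> y" "inj \<phi>" "b \<noteq> 0"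
  shows "frac_push \<phi> (Fract a b) = Fract (ga_push \<phi> a) (ga_push \<phi> b)"
  unfolding frac_push_def
  by (intro map_fract_Fract ga_push_mult ga_push_eq_0_iff inj_ga_push assms)

lemma frac_push_expo:
  assumes "\<And>x y. \<phi> (x + y) = \<phi> x + \<phi> y" "inj \<phi>"
  shows "frac_push \<phi> (\<pi>\<^bsup>\<mu>\<^esup>) = \<pi>\<^bsup>\<phi> \<mu>\<^esup>"
proof -
  have "\<phi> 0 = 0" using assms(1)[of 0 0] by simp
  then have "ga_push \<phi> 1 = 1" by transfer (simp add: single_one[symmetric] del: single_one)
  moreover have "ga_push \<phi> (ga_single \<mu> 1) = ga_single (\<phi> \<mu>) 1" by transfer simp
  ultimately show ?thesis
    unfolding expo_def by (simp add: frac_push_Fract assms)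
qed


section \<open>Based root data\<close>

text \<open>\<open>'y\<close> is the cocharacter lattice \<open>P\<close>. The character lattice is its dual, so roots are
  additive maps \<open>'y \<Rightarrow> int\<close> and the pairing is application.\<close>

record 'y root_datum =
  roots :: "('y \<Rightarrow> int) set"
  coroot :: "('y \<Rightarrow> int) \<Rightarrow> 'y"
  simple :: "('y \<Rightarrow> int) set"

definition root_refl :: "'y::ab_group_add root_datum \<Rightarrow> ('y \<Rightarrow> int) \<Rightarrow> 'y \<Rightarrow> 'y" where
  "root_refl D \<alpha> y = y - zscale (\<alpha> y) (coroot D \<alpha>)"

definition pos_roots :: "'y root_datum \<Rightarrow> ('y \<Rightarrow> int) set" where
  "pos_roots D = {\<alpha> \<in> roots D.
     \<exists>n :: ('y \<Rightarrow> int) \<Rightarrow> nat. \<forall>y. \<alpha> y = (\<Sum>\<beta>\<in>simple D. int (n \<beta>) * \<beta> y)}"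

text \<open>Reduced root datum \<open>(roots, coroots)\<close> together with a base.\<close>

definition based_root_datum :: "'y::fin_free_ab_group root_datum \<Rightarrow> bool" where
  "based_root_datum D \<longleftrightarrow>
     finite (roots D) \<and>
     (\<forall>\<alpha>\<in>roots D. \<forall>x y. \<alpha> (x + y) = \<alpha> x + \<alpha> y) \<and>
     inj_on (coroot D) (roots D) \<and>
     (\<forall>\<alpha>\<in>roots D. \<alpha> (coroot D \<alpha>) = 2) \<and>
     (\<forall>\<alpha>\<in>roots D. \<forall>\<beta>\<in>roots D. (\<lambda>y. \<beta> y - \<beta> (coroot D \<alpha>) * \<alpha> y) \<in> roots D) \<and>
     (\<forall>\<alpha>\<in>roots D. \<forall>\<beta>\<in>roots D. root_refl D \<alpha> (coroot D \<beta>) \<in> coroot D ` roots D) \<and>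
     (\<forall>\<alpha>\<in>roots D. (\<lambda>y. 2 * \<alpha> y) \<notin> roots D) \<and>
     simple D \<subseteq> roots D \<and>
     (\<forall>n :: ('y \<Rightarrow> int) \<Rightarrow> int. (\<forall>y. (\<Sum>\<beta>\<in>simple D. n \<beta> * \<beta> y) = 0) \<longrightarrow>
        (\<forall>\<beta>\<in>simple D. n \<beta> = 0)) \<and>
     (\<forall>\<alpha>\<in>roots D. \<alpha> \<in> pos_roots D \<or> (\<lambda>y. - \<alpha> y) \<in> pos_roots D)"

inductive_set weyl :: "'y::ab_group_add root_datum \<Rightarrow> ('y \<Rightarrow> 'y) set" for D where
  weyl_id: "id \<in> weyl D"
| weyl_refl: "\<alpha> \<in> roots D \<Longrightarrow> w \<in> weyl D \<Longrightarrow> root_refl D \<alpha> \<circ> w \<in> weyl D"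

definition word_prod :: "'y::ab_group_add root_datum \<Rightarrow> ('y \<Rightarrow> int) list \<Rightarrow> 'y \<Rightarrow> 'y" where
  "word_prod D as = foldr (\<lambda>\<alpha> w. root_refl D \<alpha> \<circ> w) as id"

definition weyl_length :: "'y::ab_group_add root_datum \<Rightarrow> ('y \<Rightarrow> 'y) \<Rightarrow> nat" where
  "weyl_length D w = (LEAST k. \<exists>as. set as \<subseteq> simple D \<and> length as = k \<and> word_prod D as = w)"

definition reduced_word ::
    "'y::ab_group_add root_datum \<Rightarrow> ('y \<Rightarrow> 'y) \<Rightarrow> ('y \<Rightarrow> int) list \<Rightarrow> bool" where
  "reduced_word D w as \<longleftrightarrow>
     set as \<subseteq> simple D \<and> word_prod D as = w \<and> length as = weyl_length D w"

text \<open>\<open>W\<close> acts on roots by \<open>w\<alpha> = \<alpha> \<circ> w\<^sup>-\<^sup>1\<close>.\<close>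

definition weyl_conj :: "'y::ab_group_add root_datum \<Rightarrow> ('y \<Rightarrow> int) \<Rightarrow> ('y \<Rightarrow> int) \<Rightarrow> bool" where
  "weyl_conj D \<alpha> \<beta> \<longleftrightarrow> (\<exists>w\<in>weyl D. \<beta> = \<alpha> \<circ> inv w)"


section \<open>The finite Hecke algebra\<close>

text \<open>Elements are complex-valued functions supported on \<open>W\<close>: the coefficients with respect to the
  basis \<open>T\<^sub>w\<close>. The product is determined by \<open>T\<^sub>s T\<^sub>w = T\<^sub>s\<^sub>w\<close> if \<open>\<ell>(sw) > \<ell>(w)\<close> and
  \<open>T\<^sub>s T\<^sub>w = (q - 1) T\<^sub>w + q T\<^sub>s\<^sub>w\<close> otherwise, which encodes the braid and quadratic relations.\<close>

type_synonym 'y hecke = "('y \<Rightarrow> 'y) \<Rightarrow> complex"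

definition hecke_carrier :: "'y::ab_group_add root_datum \<Rightarrow> 'y hecke set" where
  "hecke_carrier D = {h. \<forall>w. w \<notin> weyl D \<longrightarrow> h w = 0}"

definition hecke_T :: "('y \<Rightarrow> 'y) \<Rightarrow> 'y hecke" where
  "hecke_T w = (\<lambda>u. if u = w then 1 else 0)"

definition hecke_T_simple_basis ::
    "'y::ab_group_add root_datum \<Rightarrow> nat \<Rightarrow> ('y \<Rightarrow> int) \<Rightarrow> ('y \<Rightarrow> 'y) \<Rightarrow> 'y hecke" where
  "hecke_T_simple_basis D q \<alpha> w =
     (if weyl_length D (root_refl D \<alpha> \<circ> w) > weyl_length D w then hecke_T (root_refl D \<alpha> \<circ> w)
      else (\<lambda>u. (of_nat q - 1) * hecke_T w u + of_nat q * hecke_T (root_refl D \<alpha> \<circ> w) u))"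

definition hecke_T_simple_mult ::
    "'y::ab_group_add root_datum \<Rightarrow> nat \<Rightarrow> ('y \<Rightarrow> int) \<Rightarrow> 'y hecke \<Rightarrow> 'y hecke" where
  "hecke_T_simple_mult D q \<alpha> h = (\<lambda>u. \<Sum>w\<in>weyl D. h w * hecke_T_simple_basis D q \<alpha> w u)"

definition hecke_mult ::
    "'y::ab_group_add root_datum \<Rightarrow> nat \<Rightarrow> 'y hecke \<Rightarrow> 'y hecke \<Rightarrow> 'y hecke" where
  "hecke_mult D q a b =
     (\<lambda>u. \<Sum>w\<in>weyl D. a w * foldr (hecke_T_simple_mult D q) (SOME as. reduced_word D w as) b u)"

definition hecke_character ::
    "'y::ab_group_add root_datum \<Rightarrow> nat \<Rightarrow> ('y hecke \<Rightarrow> complex) \<Rightarrow> bool" where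
  "hecke_character D q \<epsilon> \<longleftrightarrow>
     (\<forall>a\<in>hecke_carrier D. \<forall>b\<in>hecke_carrier D. \<epsilon> (\<lambda>u. a u + b u) = \<epsilon> a + \<epsilon> b) \<and>
     (\<forall>c. \<forall>a\<in>hecke_carrier D. \<epsilon> (\<lambda>u. c * a u) = c * \<epsilon> a) \<and>
     \<epsilon> (hecke_T id) = 1 \<and>
     (\<forall>a\<in>hecke_carrier D. \<forall>b\<in>hecke_carrier D. \<epsilon> (hecke_mult D q a b) = \<epsilon> a * \<epsilon> b)"

definition char_pos_roots ::
    "'y::ab_group_add root_datum \<Rightarrow> ('y hecke \<Rightarrow> complex) \<Rightarrow> complex \<Rightarrow> ('y \<Rightarrow> int) set" where
  "char_pos_roots D \<epsilon> c = {\<beta> \<in> pos_roots D.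
     \<exists>\<alpha>\<in>simple D. \<epsilon> (hecke_T (root_refl D \<alpha>)) = c \<and> weyl_conj D \<alpha> \<beta>}"


section \<open>The operators\<close>

definition T_op :: "'y::fin_free_ab_group root_datum \<Rightarrow> nat \<Rightarrow> ('y hecke \<Rightarrow> complex) \<Rightarrow>
    ('y \<Rightarrow> int) \<Rightarrow> 'y Frac_alg \<Rightarrow> 'y Frac_alg" where
  "T_op D q \<epsilon> \<alpha> f =
     (const_frac (\<epsilon> (hecke_T (root_refl D \<alpha>))) + (1 - of_nat q) / (1 - \<pi>\<^bsup>- coroot D \<alpha>\<^esup>))
       * frac_push (root_refl D \<alpha>) f
     + (of_nat q - 1) / (1 - \<pi>\<^bsup>- coroot D \<alpha>\<^esup>) * f"

definition T_tw :: "'y::fin_free_ab_group root_datum \<Rightarrow> nat \<Rightarrow> ('y hecke \<Rightarrow> complex) \<Rightarrow> 'y \<Rightarrow>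
    ('y \<Rightarrow> int) \<Rightarrow> 'y Frac_alg \<Rightarrow> 'y Frac_alg" where
  "T_tw D q \<epsilon> \<rho>\<epsilon> \<alpha> f = \<pi>\<^bsup>\<rho>\<epsilon>\<^esup> * T_op D q \<epsilon> \<alpha> (\<pi>\<^bsup>- \<rho>\<epsilon>\<^esup> * f)"

definition T_tw_word :: "'y::fin_free_ab_group root_datum \<Rightarrow> nat \<Rightarrow> ('y hecke \<Rightarrow> complex) \<Rightarrow> 'y \<Rightarrow>
    ('y \<Rightarrow> int) list \<Rightarrow> 'y Frac_alg \<Rightarrow> 'y Frac_alg" where
  "T_tw_word D q \<epsilon> \<rho>\<epsilon> as = foldr (\<lambda>\<alpha> F. T_tw D q \<epsilon> \<rho>\<epsilon> \<alpha> \<circ> F) as id"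

abbreviation to_half :: "'y::fin_free_ab_group Frac_alg \<Rightarrow> 'y half Frac_alg" where
  "to_half \<equiv> frac_push half_incl"

definition rho_check :: "'y::fin_free_ab_group root_datum \<Rightarrow> 'y half" where
  "rho_check D = half (\<Sum>\<alpha>\<in>pos_roots D. coroot D \<alpha>)"

definition Omega_op :: "'y::fin_free_ab_group root_datum \<Rightarrow> 'y half Frac_alg \<Rightarrow> 'y half Frac_alg" where
  "Omega_op D f =
     \<pi>\<^bsup>- rho_check D\<^esup>
     * (\<Prod>\<alpha>\<in>pos_roots D. inverse (to_half (\<pi>\<^bsup>- coroot D \<alpha>\<^esup>) - 1))
     * (\<Sum>w\<in>weyl D. (- 1) ^ weyl_length D w * frac_push (half_map w) (\<pi>\<^bsup>- rho_check D\<^esup> * f))"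

end

theory Submission
  imports Defs "HOL-Computational_Algebra.Polynomial"
begin

text \<open>Conjugation by \<open>\<Prod>(1 - q \<pi>\<^bsup>\<alpha>\<^esup>)\<close>, the product over \<open>\<Phi>\<^sup>+\<^sub>-\<^sub>1(\<epsilon>)\<close>, turns the operators of the trivial
  character into the twisted operators of \<open>\<epsilon>\<close>, so only the trivial character matters. There the sum
  \<open>L\<close> of all \<open>T\<^sub>w\<close> satisfies \<open>T\<^sub>s L = q L\<close>, that is, \<open>s L = L\<close> for every simple reflection. Expanding
  \<open>L = \<Sum> c\<^sub>u u\<close>, independence of characters gives \<open>v(c\<^sub>u) = c\<^sub>v\<^sub>u\<close>, so all coefficients are known from
  that of the longest element, which only the longest \<open>T\<^sub>w\<close> contributes to. The alternating sum
  \<open>\<Omega>\<close> has the same form, because \<open>\<pi>\<^bsup>\<rho>\<^esup> \<Prod>(\<pi>\<^bsup>-\<alpha>\<^esup> - 1)\<close> is anti-invariant.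

  The relation \<open>T\<^sub>s L = q L\<close> needs that \<open>T\<^sub>w\<close> does not depend on the reduced word. Instead of
  verifying braid relations in rank two, let \<open>X\<close> be the difference of the operators of two reduced words
  of the same element, acting on the group algebra. On leading terms for the filtration by a
  \<open>W\<close>-invariant norm the operators act through the regular representation of the finite Hecke
  algebra, so \<open>X\<close> strictly lowers the filtration. At a real point deep in the positive chamber the \<open>T\<^sub>s\<close>
  are self-adjoint for a positive definite form, and the adjoint \<open>X'\<close> of \<open>X\<close> is given by the reversed
  words. Hence \<open>X' X\<close> is nilpotent and positive semidefinite, which forces \<open>X = 0\<close>.\<close>

text \<open>Three obstacles shape the comparison of reduced words. The invariant norm is only
  semidefinite when the group has a central torus; what is used is that it is a nonnegative integer
  and drops strictly inside a root string. The inner product sees only the values on one W-orbit of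
  points, so the point is chosen after the element \<open>X r\<close>, away from its zeros. It lies
  deep in the chamber because the coefficient of a reflection there is (x - q)/(x - 1), with x the
  value at a coroot: this is positive for x > q and also for x < 1/q, hence along the whole orbit.
  Finally, leading terms make sense only for finite sums of monomials, so the argument runs on the
  group algebra and reaches the fraction field through W-invariant denominators, over which all
  operators are linear. The conjugation works because \<rho> - s \<rho>, for the half sum \<rho>
  over the roots of type -1, is the simple coroot or 0 according to the value -1 or q of the
  character on T_s, and the same dichotomy governs the quotient of the conjugating product by its
  reflection.\<close>

hide_const (open) Rat.Fract

section \<open>Integer scaling\<close>

lemma zscale_nat: "zscale (int n) x = ((+) x ^^ n) 0"
  by (simp add: zscale_def)

lemma zscale_0 [simp]: "zscale 0 x = 0"
  by (simp add: zscale_def)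

lemma zscale_succ: "zscale (k + 1) x = zscale k x + x"
proof (cases "0 \<le> k")
  case True
  then obtain n where "k = int n" by (metis nonneg_int_cases)
  then have "k + 1 = int (Suc n)" by simp
  then show ?thesis unfolding \<open>k = int n\<close> by (simp only: zscale_nat) (simp add: add.commute)
next
  case False
  then obtain n where n: "k = - int (Suc n)"
    by (metis add.commute int_cases of_nat_0_le_iff of_nat_Suc)
  have *: "zscale (- int m) x = - (((+) x ^^ m) 0)" for m
    by (cases "m = 0") (simp_all add: zscale_def)
  have "k + 1 = - int n" by (simp add: n)
  then have "zscale (k + 1) x = - (((+) x ^^ n) 0)" by (simp only: *)
  moreover have "zscale k x = - (((+) x ^^ Suc n) 0)" unfolding n by (rule *)
  ultimately show ?thesis by simp
qed

lemma zscale_pred: "zscale (k - 1) x = zscale k x - x"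
  using zscale_succ[of "k - 1" x] by simp

lemma zscale_1 [simp]: "zscale 1 x = x"
  using zscale_succ[of 0 x] by simp

lemma zscale_add_left: "zscale (j + k) x = zscale j x + zscale k x"
proof (induction k rule: int_induct[where k = 0])
  case (step1 i)
  then show ?case by (metis add.assoc zscale_succ)
next
  case (step2 i)
  then show ?case by (metis add_diff_eq zscale_pred)
qed simp

lemma zscale_minus_left: "zscale (- k) x = - zscale k x"
  using zscale_add_left[of k "- k" x] by (simp add: eq_neg_iff_add_eq_0 add.commute)

lemma zscale_diff_left: "zscale (j - k) x = zscale j x - zscale k x"
  using zscale_add_left[of j "- k" x] by (simp add: zscale_minus_left)

lemma zscale_add_right: "zscale k (x + y) = zscale k x + zscale k y"
  by (induction k rule: int_induct[where k = 0])
    (simp_all add: zscale_succ zscale_pred algebra_simps)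

lemma zscale_zero_right [simp]: "zscale k 0 = 0"
  using zscale_add_right[of k 0 0] by simp

lemma zscale_minus_right: "zscale k (- x) = - zscale k x"
  using zscale_add_right[of k x "- x"] by (simp add: eq_neg_iff_add_eq_0 add.commute)

lemma zscale_diff_right: "zscale k (x - y) = zscale k x - zscale k y"
  using zscale_add_right[of k x "- y"] by (simp add: zscale_minus_right)

lemma zscale_2: "zscale 2 x = x + x"
  using zscale_succ[of 1 x] by simp

lemma additive_zscale:
  assumes "additive f"
  shows "f (zscale k x) = zscale k (f x)"
  by (induction k rule: int_induct[where k = 0])
    (simp_all add: zscale_succ zscale_pred additive.add[OF assms] additive.diff[OF assms]
      additive.zero[OF assms])

lemma zscale_int: "zscale k (n :: int) = k * n"
  by (induction k rule: int_induct[where k = 0])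
    (simp_all add: zscale_succ zscale_pred algebra_simps)

text \<open>Integer coordinates make the lattice torsion-free. This is what turns a repetition among
  finitely many coroots into an equality in \<open>coroot_comp_refl\<close>.\<close>

lemma zscale_eq_0_iff:
  fixes x :: "'a::fin_free_ab_group"
  shows "zscale k x = 0 \<longleftrightarrow> k = 0 \<or> x = 0"
proof
  obtain n and c :: "'a \<Rightarrow> nat \<Rightarrow> int" where
    c: "bij_betw c UNIV {v. \<forall>i\<ge>n. v i = 0}" "\<And>x y i. c (x + y) i = c x i + c y i"
    using ex_coordinates by blast
  have ad: "additive (\<lambda>x. c x i)" for i by standard (rule c(2))
  assume "zscale k x = 0"
  then have "k * c x i = 0" for i
    using additive_zscale[OF ad, of k x i] additive.zero[OF ad] by (simp add: zscale_int)
  then have "k \<noteq> 0 \<Longrightarrow> c x = c 0" by (auto simp: fun_eq_iff additive.zero[OF ad])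
  then show "k = 0 \<or> x = 0" using c(1) by (auto simp: bij_betw_def dest: injD)
qed auto

text \<open>Half sums of coroots are accessible only through their doubles, so equations such as
  \<open>refl_rho\<close> are proved doubled and then halved by this rule. It also makes
  \<open>half_incl\<close> injective.\<close>

lemma double_cancel:
  fixes x y :: "'a::fin_free_ab_group"
  shows "x + x = y + y \<longleftrightarrow> x = y"
  using zscale_eq_0_iff[of 2 "x - y"] by (auto simp: zscale_2 algebra_simps)

section \<open>Roots and the Weyl group\<close>

text \<open>That simple reflections generate \<open>W\<close> holds for every based root datum; it is assumed here
  because the theorem supplies it in the form of the reduced words.\<close>

locale weyl_datum =
  fixes D :: "'y::fin_free_ab_group root_datum"
  assumes based: "based_root_datum D"
    and generated: "w \<in> weyl D \<Longrightarrow> \<exists>as. set as \<subseteq> simple D \<and> word_prod D as = w"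
begin

abbreviation "s \<equiv> root_refl D"
abbreviation "cr \<equiv> coroot D"
abbreviation "pos \<equiv> pos_roots D"
abbreviation "len \<equiv> weyl_length D"

section \<open>Reflections acting on roots and coroots\<close>

lemma finite_roots: "finite (roots D)"
  and root_add: "\<alpha> \<in> roots D \<Longrightarrow> \<alpha> (x + y) = \<alpha> x + \<alpha> y"
  and root_coroot: "\<alpha> \<in> roots D \<Longrightarrow> \<alpha> (cr \<alpha>) = 2"
  and reduced: "\<alpha> \<in> roots D \<Longrightarrow> (\<lambda>y. 2 * \<alpha> y) \<notin> roots D"
  and simple_root: "\<alpha> \<in> simple D \<Longrightarrow> \<alpha> \<in> roots D"
  and pos_or_neg: "\<alpha> \<in> roots D \<Longrightarrow> \<alpha> \<in> pos \<or> (\<lambda>y. - \<alpha> y) \<in> pos"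
  using based by (auto simp: based_root_datum_def)

lemma simple_independent:
  "(\<And>y. (\<Sum>\<beta>\<in>simple D. n \<beta> * \<beta> y) = (0::int)) \<Longrightarrow> \<beta> \<in> simple D \<Longrightarrow> n \<beta> = 0"
  using based by (auto simp: based_root_datum_def)

lemma refl_root':
  "\<alpha> \<in> roots D \<Longrightarrow> \<beta> \<in> roots D \<Longrightarrow> (\<lambda>y. \<beta> y - \<beta> (cr \<alpha>) * \<alpha> y) \<in> roots D"
  and refl_coroot: "\<alpha> \<in> roots D \<Longrightarrow> \<beta> \<in> roots D \<Longrightarrow> s \<alpha> (cr \<beta>) \<in> cr ` roots D"
  using based by (auto simp: based_root_datum_def)

lemma finite_simple: "finite (simple D)"
  by (rule finite_subset[OF _ finite_roots]) (auto intro: simple_root)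

lemma pos_root: "\<beta> \<in> pos \<Longrightarrow> \<beta> \<in> roots D"
  by (simp add: pos_roots_def)

lemma finite_pos: "finite pos"
  by (rule finite_subset[OF _ finite_roots]) (auto intro: pos_root)

lemma root_additive: "\<alpha> \<in> roots D \<Longrightarrow> additive \<alpha>"
  by standard (rule root_add)

lemma root_zero: "\<alpha> \<in> roots D \<Longrightarrow> \<alpha> 0 = 0"
  and root_minus: "\<alpha> \<in> roots D \<Longrightarrow> \<alpha> (- x) = - \<alpha> x"
  and root_diff: "\<alpha> \<in> roots D \<Longrightarrow> \<alpha> (x - y) = \<alpha> x - \<alpha> y"
  and root_zscale: "\<alpha> \<in> roots D \<Longrightarrow> \<alpha> (zscale k x) = k * \<alpha> x"
  by (simp_all add: root_additive additive.zero additive.minus additive.diff additive_zscale zscale_int)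

lemma refl_additive: "\<alpha> \<in> roots D \<Longrightarrow> additive (s \<alpha>)"
  by standard (simp add: root_refl_def root_add zscale_add_left)

lemma refl_refl [simp]: "\<alpha> \<in> roots D \<Longrightarrow> s \<alpha> (s \<alpha> y) = y"
  by (simp add: root_refl_def root_diff root_zscale root_coroot zscale_minus_left)

lemma refl_comp_refl: "\<alpha> \<in> roots D \<Longrightarrow> s \<alpha> \<circ> s \<alpha> = id"
  by (simp add: fun_eq_iff)

lemma refl_bij: "\<alpha> \<in> roots D \<Longrightarrow> bij (s \<alpha>)"
  by (rule o_bij[of "s \<alpha>"]) (simp_all add: refl_comp_refl)

text \<open>Reflections are involutions, so precomposition with \<open>s \<alpha>\<close> is the
  action of \<open>s \<alpha>\<close> on roots and agrees with the reflection formula in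
  \<open>based_root_datum\<close>.\<close>

lemma root_comp_refl: "\<alpha> \<in> roots D \<Longrightarrow> \<beta> \<in> roots D \<Longrightarrow> \<beta> \<circ> s \<alpha> \<in> roots D"
proof -
  assume "\<alpha> \<in> roots D" "\<beta> \<in> roots D"
  moreover from this have "\<beta> \<circ> s \<alpha> = (\<lambda>y. \<beta> y - \<beta> (cr \<alpha>) * \<alpha> y)"
    by (simp add: fun_eq_iff root_refl_def root_diff root_zscale mult.commute)
  ultimately show ?thesis using refl_root' by simp
qed

lemma comp_refl_self: "\<alpha> \<in> roots D \<Longrightarrow> \<alpha> \<circ> s \<alpha> = (\<lambda>y. - \<alpha> y)"
  by (simp add: fun_eq_iff root_refl_def root_diff root_zscale root_coroot)

lemma neg_root: "\<alpha> \<in> roots D \<Longrightarrow> (\<lambda>y. - \<alpha> y) \<in> roots D"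
  using root_comp_refl[of \<alpha> \<alpha>] by (simp add: comp_refl_self)

text \<open>With \<open>\<gamma> = \<beta> \<circ> s\<^sub>\<alpha>\<close>, the product of the reflection in \<open>\<gamma>\<close> and the conjugated reflection is a
  unipotent map permuting the finite set of coroots, hence trivial.\<close>

lemma coroot_comp_refl:
  assumes a: "\<alpha> \<in> roots D" and b: "\<beta> \<in> roots D"
  shows "cr (\<beta> \<circ> s \<alpha>) = s \<alpha> (cr \<beta>)"
proof -
  define \<gamma> where "\<gamma> = \<beta> \<circ> s \<alpha>"
  define d where "d = s \<alpha> (cr \<beta>)"
  have g: "\<gamma> \<in> roots D" unfolding \<gamma>_def using a b by (rule root_comp_refl)
  have gd: "\<gamma> d = 2" using a b by (simp add: \<gamma>_def d_def root_coroot)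
  define e where "e = cr \<gamma> - d"
  have ge: "\<gamma> e = 0" using g gd by (simp add: e_def root_diff root_coroot)
  have r2: "s \<alpha> (s \<beta> (s \<alpha> y)) = y - zscale (\<gamma> y) d" for y
    using a b by (simp add: root_refl_def[of D \<beta>] additive.diff[OF refl_additive]
        additive_zscale[OF refl_additive] \<gamma>_def d_def)
  define u where "u y = s \<gamma> (s \<alpha> (s \<beta> (s \<alpha> y)))" for y
  have u: "u y = y + zscale (\<gamma> y) e" for y
    unfolding u_def r2 using g gd
    by (simp add: root_refl_def root_diff root_zscale e_def zscale_diff_right zscale_minus_left)
  have "u y \<in> cr ` roots D" if "y \<in> cr ` roots D" for y
    using that a b g refl_coroot unfolding u_def by (metis imageE)
  then have mem: "(u ^^ n) (cr \<gamma>) \<in> cr ` roots D" for n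
    using g by (induction n) auto
  have un: "(u ^^ n) (cr \<gamma>) = cr \<gamma> + zscale (2 * int n) e" for n
    using g by (induction n)
      (simp_all add: u root_coroot root_add root_zscale ge zscale_add_left distrib_left add_ac)
  have "\<not> inj (\<lambda>n. (u ^^ n) (cr \<gamma>))"
    using mem finite_roots
    by (meson finite_imageI finite_subset image_subsetI infinite_UNIV_nat finite_imageD)
  then obtain m n :: nat where mn: "m \<noteq> n" "(u ^^ m) (cr \<gamma>) = (u ^^ n) (cr \<gamma>)"
    by (auto simp: inj_def)
  then have "zscale (2 * int m - 2 * int n) e = 0"
    by (simp add: un zscale_diff_left)
  then have "e = 0" using mn(1) by (simp add: zscale_eq_0_iff)
  then show ?thesis by (simp add: e_def \<gamma>_def d_def)
qed

lemma refl_comp_root: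
  "\<alpha> \<in> roots D \<Longrightarrow> \<beta> \<in> roots D \<Longrightarrow> s \<alpha> \<circ> s (\<beta> \<circ> s \<alpha>) = s \<beta> \<circ> s \<alpha>"
  by (simp add: fun_eq_iff root_refl_def[of D "\<beta> \<circ> s \<alpha>"] root_refl_def[of D \<beta>] coroot_comp_refl
      additive.diff[OF refl_additive] additive_zscale[OF refl_additive])

lemma coroot_neg: "\<alpha> \<in> roots D \<Longrightarrow> cr (\<lambda>y. - \<alpha> y) = - cr \<alpha>"
  using coroot_comp_refl[of \<alpha> \<alpha>] by (simp add: comp_refl_self root_refl_def root_coroot zscale_2)

section \<open>Positive roots under simple reflections\<close>

lemma simple_pos: assumes "\<alpha> \<in> simple D" shows "\<alpha> \<in> pos"
proof -
  have "\<alpha> y = (\<Sum>\<beta>\<in>simple D. int (if \<beta> = \<alpha> then 1 else 0) * \<beta> y)" for y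
    using assms finite_simple by (simp add: if_distrib[of int] if_distrib[of "\<lambda>t. t * _"] cong: if_cong)
  then show ?thesis using assms simple_root
    unfolding pos_roots_def by (intro CollectI conjI exI[of _ "\<lambda>\<beta>. if \<beta> = \<alpha> then 1 else 0"]) blast+
qed

text \<open>The two expansions add up to a vanishing nonnegative combination of simple roots.
  Independence makes every coefficient zero, and \<beta> = 0 contradicts its value 2 on the
  coroot.\<close>

lemma not_pos_and_neg: assumes "\<beta> \<in> pos" shows "(\<lambda>y. - \<beta> y) \<notin> pos"
proof
  assume "(\<lambda>y. - \<beta> y) \<in> pos"
  then obtain m where m: "\<And>y. - \<beta> y = (\<Sum>\<gamma>\<in>simple D. int (m \<gamma>) * \<gamma> y)"
    by (auto simp: pos_roots_def)
  obtain n where n: "\<And>y. \<beta> y = (\<Sum>\<gamma>\<in>simple D. int (n \<gamma>) * \<gamma> y)"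
    using assms by (auto simp: pos_roots_def)
  have "(\<Sum>\<gamma>\<in>simple D. (int (m \<gamma>) + int (n \<gamma>)) * \<gamma> y) = 0" for y
    using m[of y] n[of y] by (simp add: distrib_right sum.distrib)
  then have "\<gamma> \<in> simple D \<Longrightarrow> int (m \<gamma>) + int (n \<gamma>) = 0" for \<gamma>
    using simple_independent[of "\<lambda>\<gamma>. int (m \<gamma>) + int (n \<gamma>)"] by blast
  then have "\<gamma> \<in> simple D \<Longrightarrow> n \<gamma> = 0" for \<gamma> by fastforce
  then have "\<beta> y = 0" for y by (auto simp: n intro!: sum.neutral)
  then show False using root_coroot[OF pos_root[OF assms]] by simp
qed

lemma neg_pos_iff: "\<beta> \<in> roots D \<Longrightarrow> (\<lambda>y. - \<beta> y) \<in> pos \<longleftrightarrow> \<beta> \<notin> pos"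
  using pos_or_neg not_pos_and_neg by blast

text \<open>A simple reflection changes only the \<alpha>-coefficient of \<beta>. If the image were
  negative, all other coefficients would vanish and \<beta> would be a multiple of \<alpha>.\<close>

lemma simple_perm:
  assumes a: "\<alpha> \<in> simple D" and b: "\<beta> \<in> pos" and ne: "\<beta> \<noteq> \<alpha>"
  shows "\<beta> \<circ> s \<alpha> \<in> pos"
proof (rule ccontr)
  note ar = simple_root[OF a] and br = pos_root[OF b]
  assume "\<beta> \<circ> s \<alpha> \<notin> pos"
  then have "(\<lambda>y. - (\<beta> \<circ> s \<alpha>) y) \<in> pos" using neg_pos_iff root_comp_refl ar br by blast
  then obtain m where m: "\<And>y. - (\<beta> \<circ> s \<alpha>) y = (\<Sum>\<gamma>\<in>simple D. int (m \<gamma>) * \<gamma> y)"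
    by (auto simp: pos_roots_def)
  obtain n where n: "\<And>y. \<beta> y = (\<Sum>\<gamma>\<in>simple D. int (n \<gamma>) * \<gamma> y)"
    using b by (auto simp: pos_roots_def)
  define c where "c = \<beta> (cr \<alpha>)"
  have "(\<beta> \<circ> s \<alpha>) y = \<beta> y - c * \<alpha> y" for y
    using br by (simp add: root_refl_def root_diff root_zscale c_def)
  then have "(\<Sum>\<gamma>\<in>simple D. int (m \<gamma>) * \<gamma> y) + (\<Sum>\<gamma>\<in>simple D. int (n \<gamma>) * \<gamma> y) - c * \<alpha> y = 0" for y
    using m[of y] n[of y] by simp
  moreover have "c * \<alpha> y = (\<Sum>\<gamma>\<in>simple D. (if \<gamma> = \<alpha> then c else 0) * \<gamma> y)" for y
    using a finite_simple by (simp add: if_distrib[of "\<lambda>t. t * _"] cong: if_cong)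
  ultimately have "(\<Sum>\<gamma>\<in>simple D. (int (m \<gamma>) + int (n \<gamma>) - (if \<gamma> = \<alpha> then c else 0)) * \<gamma> y) = 0" for y
    by (simp add: distrib_right left_diff_distrib sum.distrib sum_subtractf)
  then have "int (m \<gamma>) + int (n \<gamma>) - (if \<gamma> = \<alpha> then c else 0) = 0" if "\<gamma> \<in> simple D" for \<gamma>
    using simple_independent[of "\<lambda>\<gamma>. int (m \<gamma>) + int (n \<gamma>) - (if \<gamma> = \<alpha> then c else 0)"] that by blast
  then have n0: "n \<gamma> = 0" if "\<gamma> \<in> simple D" "\<gamma> \<noteq> \<alpha>" for \<gamma>
    using that by fastforce
  have na: "\<beta> y = int (n \<alpha>) * \<alpha> y" for y
  proof -
    have "\<beta> y = (\<Sum>\<gamma>\<in>{\<alpha>}. int (n \<gamma>) * \<gamma> y)"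
      unfolding n using a finite_simple n0 by (intro sum.mono_neutral_right) auto
    then show ?thesis by simp
  qed
  \<comment> \<open>The multiple divides 2; the value 1 contradicts \<beta> \<noteq> \<alpha> and
    the value 2 contradicts reducedness.\<close>
  then have "int (n \<alpha>) * \<alpha> (cr \<beta>) = 2" using root_coroot[OF br] by metis
  then have "int (n \<alpha>) dvd 2" by (metis dvd_triv_left)
  then have "n \<alpha> \<le> 2" "n \<alpha> \<noteq> 0" using zdvd_imp_le[of "int (n \<alpha>)" 2] by (auto intro: Nat.gr0I)
  then consider "n \<alpha> = 1" | "n \<alpha> = 2" by linarith
  then show False
  proof cases
    case 1 then show False using na ne by (auto simp: fun_eq_iff)
  next
    case 2 then have "\<beta> = (\<lambda>y. 2 * \<alpha> y)" using na by auto
    then show False using reduced[OF ar] br by simp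
  qed
qed

section \<open>Words and the action of W\<close>

lemma word_prod_Nil [simp]: "word_prod D [] = id"
  and word_prod_Cons [simp]: "word_prod D (\<alpha> # as) = s \<alpha> \<circ> word_prod D as"
  by (simp_all add: word_prod_def)

lemma word_prod_append: "word_prod D (as @ bs) = word_prod D as \<circ> word_prod D bs"
  by (induction as) (simp_all add: o_assoc)

lemma weyl_word: "set as \<subseteq> simple D \<Longrightarrow> word_prod D as \<in> weyl D"
  by (induction as) (auto intro: weyl_id weyl_refl simple_root)

text \<open>\<open>weyl\<close> is built from all reflections, whereas signs and lengths are
  controlled only for simple ones; \<open>generated\<close> bridges the two.\<close>

lemma weyl_induct [consumes 1, case_names id refl]:
  assumes "w \<in> weyl D" "P id"
    and "\<And>\<alpha> w. \<alpha> \<in> simple D \<Longrightarrow> w \<in> weyl D \<Longrightarrow> P w \<Longrightarrow> P (s \<alpha> \<circ> w)"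
  shows "P w"
proof -
  obtain as where as: "set as \<subseteq> simple D" "word_prod D as = w" using generated[OF assms(1)] by blast
  have "P (word_prod D as)" using as(1)
    by (induction as) (auto intro!: assms weyl_word)
  then show ?thesis using as by simp
qed

lemma weyl_comp: "w \<in> weyl D \<Longrightarrow> v \<in> weyl D \<Longrightarrow> w \<circ> v \<in> weyl D"
  by (rule weyl.induct[of w D "\<lambda>w. w \<circ> v \<in> weyl D"]) (auto simp only: comp_assoc id_comp intro: weyl_refl)

lemma refl_weyl: "\<alpha> \<in> roots D \<Longrightarrow> s \<alpha> \<in> weyl D"
  using weyl_refl[OF _ weyl_id] by fastforce

lemma weyl_bij: "w \<in> weyl D \<Longrightarrow> bij w"
  by (erule weyl.induct[of w D bij]) (auto intro: bij_comp refl_bij)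

lemma weyl_additive: "w \<in> weyl D \<Longrightarrow> additive w"
  by (erule weyl.induct[of w D additive])
    (auto intro!: additive.intro simp: additive.add additive.add[OF refl_additive])

lemma inv_refl: "\<alpha> \<in> roots D \<Longrightarrow> inv (s \<alpha>) = s \<alpha>"
  by (rule inv_unique_comp) (simp_all add: refl_comp_refl)

lemma weyl_inv: "w \<in> weyl D \<Longrightarrow> inv w \<in> weyl D"
  by (erule weyl.induct[of w D "\<lambda>w. inv w \<in> weyl D"])
    (auto simp: o_inv_distrib refl_bij weyl_bij inv_refl intro!: weyl_id weyl_comp refl_weyl)

lemma weyl_inv_comp [simp]: "w \<in> weyl D \<Longrightarrow> inv w \<circ> w = id" "w \<in> weyl D \<Longrightarrow> w \<circ> inv w = id"
  by (auto simp: fun_eq_iff weyl_bij bij_is_inj surj_f_inv_f[OF bij_is_surj])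

lemma root_comp_weyl: "w \<in> weyl D \<Longrightarrow> \<beta> \<in> roots D \<Longrightarrow> \<beta> \<circ> w \<in> roots D"
proof (induction arbitrary: \<beta> rule: weyl.induct)
  case (weyl_refl \<alpha> w)
  show "\<beta> \<circ> (s \<alpha> \<circ> w) \<in> roots D"
    unfolding o_assoc by (rule weyl_refl.IH[OF root_comp_refl[OF weyl_refl.hyps(1) weyl_refl.prems]])
qed simp

lemma coroot_comp_weyl: "w \<in> weyl D \<Longrightarrow> \<beta> \<in> roots D \<Longrightarrow> w (cr (\<beta> \<circ> w)) = cr \<beta>"
proof (induction arbitrary: \<beta> rule: weyl.induct)
  case (weyl_refl \<alpha> w)
  have "w (cr (\<beta> \<circ> s \<alpha> \<circ> w)) = s \<alpha> (cr \<beta>)"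
    using weyl_refl.IH[of "\<beta> \<circ> s \<alpha>"] weyl_refl.prems weyl_refl.hyps(1)
    by (simp only: root_comp_refl coroot_comp_refl)
  then show "(s \<alpha> \<circ> w) (cr (\<beta> \<circ> (s \<alpha> \<circ> w))) = cr \<beta>"
    using weyl_refl.hyps(1) by (simp add: o_assoc)
next
  case weyl_id
  show "id (cr (\<beta> \<circ> id)) = cr \<beta>" by simp
qed

lemma coroot_comp_weyl': "w \<in> weyl D \<Longrightarrow> \<beta> \<in> roots D \<Longrightarrow> cr (\<beta> \<circ> w) = inv w (cr \<beta>)"
  using coroot_comp_weyl weyl_bij by (metis bij_inv_eq_iff)

text \<open>With W acting on roots by precomposition with the inverse, this is the familiar rule
  that conjugating the reflection in \<gamma> by w gives the reflection in w \<gamma>, for \<gamma>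
  = \<open>\<beta> \<circ> w\<close>.\<close>

lemma refl_comp_weyl: "w \<in> weyl D \<Longrightarrow> \<beta> \<in> roots D \<Longrightarrow> w \<circ> s (\<beta> \<circ> w) = s \<beta> \<circ> w"
proof (rule ext)
  fix y assume "w \<in> weyl D" "\<beta> \<in> roots D"
  then show "(w \<circ> s (\<beta> \<circ> w)) y = (s \<beta> \<circ> w) y"
    by (simp add: root_refl_def additive.diff[OF weyl_additive] additive_zscale[OF weyl_additive]
        coroot_comp_weyl[unfolded o_def] o_def)
qed

lemma neg_comp: "(\<lambda>y. - \<beta> y) \<circ> w = (\<lambda>y. - (\<beta> \<circ> w) y)"
  by (simp add: fun_eq_iff)

section \<open>Exchange condition and length\<close>

lemma comp_refl_pos_iff:
  "\<alpha> \<in> roots D \<Longrightarrow> w \<in> weyl D \<Longrightarrow> \<alpha> \<circ> (s \<alpha> \<circ> w) \<in> pos \<longleftrightarrow> \<alpha> \<circ> w \<notin> pos"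
  by (simp only: o_assoc comp_refl_self neg_comp) (rule neg_pos_iff[OF root_comp_weyl])

text \<open>\<open>\<gamma> \<circ> word_prod D as\<close> is the image of \<gamma> under the
  inverse of the product. Following \<gamma> through the letters, \<open>simple_perm\<close> lets
  the sign change only where the transported root equals the current letter; multiplying by
  \<open>s \<gamma>\<close> deletes that letter.\<close>

lemma exchange:
  assumes "set as \<subseteq> simple D" "\<gamma> \<in> pos" "\<gamma> \<circ> word_prod D as \<notin> pos"
  shows "\<exists>bs. set bs \<subseteq> simple D \<and> Suc (length bs) = length as \<and> s \<gamma> \<circ> word_prod D as = word_prod D bs"
  using assms
proof (induction as arbitrary: \<gamma>)
  case (Cons \<beta> as)
  then have b: "\<beta> \<in> simple D" "\<beta> \<in> roots D" using simple_root by auto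
  show ?case
  proof (cases "\<gamma> = \<beta>")
    case True
    then show ?thesis using Cons.prems b
      by (intro exI[of _ as]) (simp add: o_assoc refl_comp_refl)
  next
    case False
    then have "\<gamma> \<circ> s \<beta> \<in> pos" using b Cons.prems by (intro simple_perm)
    then obtain bs where bs: "set bs \<subseteq> simple D" "Suc (length bs) = length as"
      "s (\<gamma> \<circ> s \<beta>) \<circ> word_prod D as = word_prod D bs"
      using Cons.IH[of "\<gamma> \<circ> s \<beta>"] Cons.prems by (auto simp only: o_assoc word_prod_Cons list.set insert_subset)
    have "s \<gamma> \<circ> word_prod D (\<beta> # as) = s \<beta> \<circ> word_prod D bs"
      using refl_comp_root[of \<beta> \<gamma>] b pos_root[OF Cons.prems(2)] bs(3)[symmetric]
      by (simp add: o_assoc)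
    then have "s \<gamma> \<circ> word_prod D (\<beta> # as) = word_prod D (\<beta> # bs)" by (simp only: word_prod_Cons)
    moreover have "set (\<beta> # bs) \<subseteq> simple D" "Suc (length (\<beta> # bs)) = length (\<beta> # as)"
      using bs b by simp_all
    ultimately show ?thesis by blast
  qed
qed simp

lemma len_word:
  assumes "w \<in> weyl D"
  obtains as where "set as \<subseteq> simple D" "word_prod D as = w" "length as = len w"
proof -
  have "\<exists>k as. set as \<subseteq> simple D \<and> length as = k \<and> word_prod D as = w"
    using generated[OF assms] by blast
  from LeastI_ex[OF this] obtain as where
    "set as \<subseteq> simple D \<and> length as = len w \<and> word_prod D as = w"
    unfolding weyl_length_def by (elim exE)
  then show ?thesis by (elim conjE) (rule that)
qed

lemma len_le: "set as \<subseteq> simple D \<Longrightarrow> len (word_prod D as) \<le> length as"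
  unfolding weyl_length_def by (rule Least_le) blast

lemma len_refl_neg:
  assumes a: "\<alpha> \<in> simple D" and w: "w \<in> weyl D" and n: "\<alpha> \<circ> w \<notin> pos"
  shows "len w = Suc (len (s \<alpha> \<circ> w))"
proof -
  note ar = simple_root[OF a]
  obtain as where as: "set as \<subseteq> simple D" "word_prod D as = w" "length as = len w"
    using len_word[OF w] .
  then obtain bs where "set bs \<subseteq> simple D" "Suc (length bs) = length as" "s \<alpha> \<circ> w = word_prod D bs"
    using exchange[OF as(1) simple_pos[OF a]] n by auto
  then have 1: "Suc (len (s \<alpha> \<circ> w)) \<le> len w" using len_le as by force
  obtain cs where cs: "set cs \<subseteq> simple D" "word_prod D cs = s \<alpha> \<circ> w" "length cs = len (s \<alpha> \<circ> w)"
    using len_word[OF weyl_refl[OF ar w]] .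
  have "word_prod D (\<alpha> # cs) = w" using ar by (simp add: cs o_assoc refl_comp_refl)
  then have "len w \<le> Suc (len (s \<alpha> \<circ> w))" using len_le[of "\<alpha> # cs"] a cs by simp
  with 1 show ?thesis by simp
qed

lemma len_refl_pos:
  assumes a: "\<alpha> \<in> simple D" and w: "w \<in> weyl D" and n: "\<alpha> \<circ> w \<in> pos"
  shows "len (s \<alpha> \<circ> w) = Suc (len w)"
proof -
  note ar = simple_root[OF a]
  have "\<alpha> \<circ> (s \<alpha> \<circ> w) \<notin> pos" using n comp_refl_pos_iff[OF ar w] by blast
  from len_refl_neg[OF a weyl_refl[OF ar w] this] show ?thesis
    using ar by (simp add: o_assoc refl_comp_refl)
qed

lemma len_refl_less_iff:
  "\<alpha> \<in> simple D \<Longrightarrow> w \<in> weyl D \<Longrightarrow> len w < len (s \<alpha> \<circ> w) \<longleftrightarrow> \<alpha> \<circ> w \<in> pos"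
  using len_refl_neg len_refl_pos by force

lemma len_id [simp]: "len id = 0"
  using len_le[of "[]"] by simp

text \<open>For w \<noteq> id the first letter \<alpha> of a shortest word would shorten w, whereas
  positivity of \<open>\<alpha> \<circ> w\<close> makes \<open>s \<alpha>\<close> lengthen
  it.\<close>

lemma pos_all_id:
  assumes w: "w \<in> weyl D" and p: "\<And>\<alpha>. \<alpha> \<in> simple D \<Longrightarrow> \<alpha> \<circ> w \<in> pos"
  shows "w = id"
proof (rule ccontr)
  assume "w \<noteq> id"
  obtain as where as: "set as \<subseteq> simple D" "word_prod D as = w" "length as = len w"
    using len_word[OF w] .
  with \<open>w \<noteq> id\<close> obtain \<alpha> bs where ab: "as = \<alpha> # bs" by (cases as) auto
  then have a: "\<alpha> \<in> simple D" "\<alpha> \<in> roots D" using as simple_root by auto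
  have "s \<alpha> \<circ> w = word_prod D bs" using as ab a by (auto simp: o_assoc refl_comp_refl)
  then have "len (s \<alpha> \<circ> w) \<le> length bs" using len_le as ab by auto
  moreover have "len (s \<alpha> \<circ> w) = Suc (len w)" by (rule len_refl_pos[OF a(1) w p[OF a(1)]])
  ultimately show False using as ab by simp
qed

text \<open>The roots need not separate points of the lattice, so faithfulness of W on them is not
  formal; it comes from \<open>pos_all_id\<close> for \<open>w \<circ> inv v\<close>. Finiteness of
  W follows from it.\<close>

lemma weyl_eq_if_roots_eq:
  assumes "w \<in> weyl D" "v \<in> weyl D" "\<And>\<beta>. \<beta> \<in> roots D \<Longrightarrow> \<beta> \<circ> w = \<beta> \<circ> v"
  shows "w = v"
proof -
  have "w \<circ> inv v = id"
  proof (rule pos_all_id)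
    show "w \<circ> inv v \<in> weyl D" using assms by (intro weyl_comp weyl_inv)
    fix \<alpha> assume a: "\<alpha> \<in> simple D"
    have "\<alpha> \<circ> (w \<circ> inv v) = \<alpha> \<circ> (v \<circ> inv v)"
      using assms(3)[OF simple_root[OF a]] by (simp add: o_assoc)
    then show "\<alpha> \<circ> (w \<circ> inv v) \<in> pos" using assms(2) simple_pos[OF a] by simp
  qed
  then have "w \<circ> (inv v \<circ> v) = v" by (simp add: o_assoc)
  then show ?thesis using assms by simp
qed

lemma finite_weyl: "finite (weyl D)"
proof -
  have "(\<lambda>w. \<lambda>\<beta>\<in>roots D. \<beta> \<circ> w) ` weyl D \<subseteq> (\<Pi>\<^sub>E \<beta>\<in>roots D. roots D)"
    using root_comp_weyl by auto
  then have "finite ((\<lambda>w. \<lambda>\<beta>\<in>roots D. \<beta> \<circ> w) ` weyl D)"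
    by (rule finite_subset) (intro finite_PiE finite_roots)
  moreover have "inj_on (\<lambda>w. \<lambda>\<beta>\<in>roots D. \<beta> \<circ> w) (weyl D)"
    by (rule inj_onI) (metis restrict_apply' weyl_eq_if_roots_eq)
  ultimately show ?thesis by (rule finite_imageD)
qed

lemma sum_weyl_left: "v \<in> weyl D \<Longrightarrow> (\<Sum>w\<in>weyl D. F (v \<circ> w)) = (\<Sum>w\<in>weyl D. F w)"
  by (rule sum.reindex_bij_witness[of _ "\<lambda>w. inv v \<circ> w" "\<lambda>w. v \<circ> w"])
    (auto simp: o_assoc weyl_comp weyl_inv)

lemma sum_weyl_right: "v \<in> weyl D \<Longrightarrow> (\<Sum>w\<in>weyl D. F (w \<circ> v)) = (\<Sum>w\<in>weyl D. F w)"
  by (rule sum.reindex_bij_witness[of _ "\<lambda>w. w \<circ> inv v" "\<lambda>w. w \<circ> v"])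
    (auto simp: comp_assoc weyl_comp weyl_inv)

text \<open>Reducedness in recursive form, suited to induction: every letter lengthens the product
  of the letters to its right. \<open>reduced_word_iff\<close> identifies it with minimal
  length.\<close>

fun redw :: "('y \<Rightarrow> int) list \<Rightarrow> bool" where
  "redw [] \<longleftrightarrow> True"
| "redw (\<alpha> # as) \<longleftrightarrow> \<alpha> \<in> simple D \<and> \<alpha> \<circ> word_prod D as \<in> pos \<and> redw as"

lemma redw_simple: "redw as \<Longrightarrow> set as \<subseteq> simple D"
  by (induction as) auto

lemma len_redw: "redw as \<Longrightarrow> len (word_prod D as) = length as"
  by (induction as) (auto simp: len_refl_pos weyl_word redw_simple)

lemma redw_if_len: "set as \<subseteq> simple D \<Longrightarrow> len (word_prod D as) = length as \<Longrightarrow> redw as"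
proof (induction as)
  case (Cons \<alpha> as)
  then have a: "\<alpha> \<in> simple D" and v: "word_prod D as \<in> weyl D" by (auto intro: weyl_word)
  have "len (word_prod D as) \<le> length as" using Cons by (intro len_le) auto
  moreover have l: "len (s \<alpha> \<circ> word_prod D as) = Suc (length as)"
    using Cons.prems(2) by (simp only: word_prod_Cons list.size)
  ultimately have p: "\<alpha> \<circ> word_prod D as \<in> pos"
    using len_refl_less_iff[OF a v] by simp
  have "len (word_prod D as) = length as" using len_refl_pos[OF a v p] l by simp
  then show ?case using Cons a p by simp
qed simp

lemma reduced_word_iff: "reduced_word D w as \<longleftrightarrow> redw as \<and> word_prod D as = w"
proof
  assume "reduced_word D w as"
  then show "redw as \<and> word_prod D as = w"
    using redw_if_len[of as] by (simp add: reduced_word_def)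
next
  assume "redw as \<and> word_prod D as = w"
  then show "reduced_word D w as"
    using len_redw[of as] redw_simple[of as] by (simp add: reduced_word_def)
qed

lemma ex_redw:
  assumes "w \<in> weyl D" obtains as where "redw as" "word_prod D as = w"
proof -
  obtain as where "set as \<subseteq> simple D" "word_prod D as = w" "length as = len w"
    using len_word[OF assms] .
  then show ?thesis by (intro that[of as] redw_if_len) simp_all
qed

lemma inv_refl_comp: "w \<in> weyl D \<Longrightarrow> \<alpha> \<in> roots D \<Longrightarrow> inv (s \<alpha> \<circ> w) = inv w \<circ> s \<alpha>"
  by (simp add: o_inv_distrib weyl_bij refl_bij inv_refl)

lemma word_prod_rev: "set as \<subseteq> simple D \<Longrightarrow> word_prod D (rev as) = inv (word_prod D as)"
proof (induction as)
  case (Cons \<alpha> as)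
  then have a: "\<alpha> \<in> roots D" "word_prod D as \<in> weyl D" by (auto intro: weyl_word simple_root)
  have "word_prod D (rev (\<alpha> # as)) = inv (word_prod D as) \<circ> s \<alpha>"
    using Cons by (simp add: word_prod_append)
  also have "\<dots> = inv (word_prod D (\<alpha> # as))"
    using inv_refl_comp[OF a(2,1)] by (simp only: word_prod_Cons)
  finally show ?case .
qed simp

lemma len_inv: assumes "w \<in> weyl D" shows "len (inv w) = len w"
proof -
  have *: "len (inv w) \<le> len w" if v: "w \<in> weyl D" for w
  proof -
    obtain as where "set as \<subseteq> simple D" "word_prod D as = w" "length as = len w"
      using len_word[OF v] .
    then show ?thesis using len_le[of "rev as"] word_prod_rev[of as] by simp
  qed
  show ?thesis using *[OF assms] *[OF weyl_inv[OF assms]] assms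
    by (simp add: inv_inv_eq weyl_bij)
qed

lemma inv_comp_refl: "w \<in> weyl D \<Longrightarrow> \<alpha> \<in> roots D \<Longrightarrow> inv (w \<circ> s \<alpha>) = s \<alpha> \<circ> inv w"
  by (simp add: o_inv_distrib weyl_bij refl_bij inv_refl)

lemma refl_less_right:
  assumes "\<alpha> \<in> simple D" "w \<in> weyl D"
  shows "len w < len (w \<circ> s \<alpha>) \<longleftrightarrow> \<alpha> \<circ> inv w \<in> pos"
  using len_refl_less_iff[OF assms(1) weyl_inv[OF assms(2)]] assms
    len_inv[of w] len_inv[of "w \<circ> s \<alpha>"]
  by (simp add: inv_comp_refl simple_root weyl_comp refl_weyl)

text \<open>The reflection in \<beta> makes \<beta> negative. Along a word of simple reflections for
  it, the transported root must change sign at some letter, and there it equals that simple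
  root.\<close>

lemma conj_simple:
  assumes b: "\<beta> \<in> pos" obtains \<alpha> where "\<alpha> \<in> simple D" "weyl_conj D \<alpha> \<beta>"
proof -
  have *: "\<exists>\<alpha>\<in>simple D. \<exists>w\<in>weyl D. \<beta> \<circ> w = \<alpha>" if "set as \<subseteq> simple D" "\<beta> \<in> pos" "\<beta> \<circ> word_prod D as \<notin> pos" for as \<beta>
    using that
  proof (induction as arbitrary: \<beta>)
    case (Cons \<gamma> as)
    show ?case
    proof (cases "\<beta> = \<gamma>")
      case True then show ?thesis using Cons.prems weyl_id by (metis comp_id list.set_intros(1) subsetD)
    next
      case False
      then have "\<beta> \<circ> s \<gamma> \<in> pos" using Cons.prems simple_perm by simp
      then obtain \<alpha> w where "\<alpha> \<in> simple D" "w \<in> weyl D" "\<beta> \<circ> s \<gamma> \<circ> w = \<alpha>"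
        using Cons.IH[of "\<beta> \<circ> s \<gamma>"] Cons.prems
        by (auto simp only: o_assoc word_prod_Cons list.set insert_subset)
      moreover from this have "s \<gamma> \<circ> w \<in> weyl D"
        using Cons.prems by (intro weyl_refl simple_root) simp_all
      ultimately show ?thesis by (metis o_assoc)
    qed
  qed simp
  note br = pos_root[OF b]
  obtain as where as: "set as \<subseteq> simple D" "word_prod D as = s \<beta>" using generated[OF refl_weyl[OF br]] by blast
  have "\<beta> \<circ> word_prod D as \<notin> pos" using as b br by (simp add: comp_refl_self not_pos_and_neg)
  from *[OF as(1) b this] obtain \<alpha> w where "\<alpha> \<in> simple D" "w \<in> weyl D" "\<beta> \<circ> w = \<alpha>" by blast
  then have "\<beta> = \<alpha> \<circ> inv w" by (auto simp: comp_assoc)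
  with \<open>w \<in> weyl D\<close> \<open>\<alpha> \<in> simple D\<close> show ?thesis using that by (auto simp: weyl_conj_def)
qed

lemma pos_nonpos_on_simple:
  assumes w: "w \<in> weyl D" and n: "\<And>\<alpha>. \<alpha> \<in> simple D \<Longrightarrow> \<alpha> \<circ> w \<notin> pos" and b: "\<beta> \<in> pos"
  shows "\<beta> \<circ> w \<notin> pos"
proof
  assume bw: "\<beta> \<circ> w \<in> pos"
  have "\<forall>\<alpha>\<in>simple D. \<exists>m. \<forall>y. - (\<alpha> \<circ> w) y = (\<Sum>\<gamma>\<in>simple D. int (m \<gamma>) * \<gamma> y)"
  proof
    fix \<alpha> assume a: "\<alpha> \<in> simple D"
    have "(\<lambda>y. - (\<alpha> \<circ> w) y) \<in> pos"
      using n[OF a] neg_pos_iff[OF root_comp_weyl[OF w simple_root[OF a]]] by simp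
    then show "\<exists>m. \<forall>y. - (\<alpha> \<circ> w) y = (\<Sum>\<gamma>\<in>simple D. int (m \<gamma>) * \<gamma> y)"
      by (simp add: pos_roots_def)
  qed
  then obtain m where m: "\<And>\<alpha> y. \<alpha> \<in> simple D \<Longrightarrow> - \<alpha> (w y) = (\<Sum>\<gamma>\<in>simple D. int (m \<alpha> \<gamma>) * \<gamma> y)"
    by (auto simp: bchoice_iff)
  obtain k where k: "\<And>y. \<beta> y = (\<Sum>\<alpha>\<in>simple D. int (k \<alpha>) * \<alpha> y)"
    using b by (auto simp: pos_roots_def)
  have "- (\<beta> \<circ> w) y = (\<Sum>\<gamma>\<in>simple D. int (\<Sum>\<alpha>\<in>simple D. k \<alpha> * m \<alpha> \<gamma>) * \<gamma> y)" for y
  proof -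
    have "- (\<beta> \<circ> w) y = (\<Sum>\<alpha>\<in>simple D. int (k \<alpha>) * (- \<alpha> (w y)))"
      by (simp add: k sum_negf)
    also have "\<dots> = (\<Sum>\<alpha>\<in>simple D. int (k \<alpha>) * (\<Sum>\<gamma>\<in>simple D. int (m \<alpha> \<gamma>) * \<gamma> y))"
      by (intro sum.cong) (simp_all add: m)
    also have "\<dots> = (\<Sum>\<alpha>\<in>simple D. \<Sum>\<gamma>\<in>simple D. int (k \<alpha> * m \<alpha> \<gamma>) * \<gamma> y)"
      by (simp add: sum_distrib_left mult.assoc)
    also have "\<dots> = (\<Sum>\<gamma>\<in>simple D. \<Sum>\<alpha>\<in>simple D. int (k \<alpha> * m \<alpha> \<gamma>) * \<gamma> y)"
      by (rule sum.swap)
    finally show ?thesis by (simp add: sum_distrib_right)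
  qed
  then have "(\<lambda>y. - (\<beta> \<circ> w) y) \<in> pos"
    using neg_root[OF root_comp_weyl[OF w pos_root[OF b]]]
    unfolding pos_roots_def by (intro CollectI conjI exI[of _ "\<lambda>\<gamma>. \<Sum>\<alpha>\<in>simple D. k \<alpha> * m \<alpha> \<gamma>"]) auto
  then show False using not_pos_and_neg[OF bw] by simp
qed

text \<open>An element of maximal length cannot be lengthened, so it makes all simple and hence all
  positive roots negative. For two such elements, \<open>w0 \<circ> inv w\<close> keeps the simple
  roots positive and is the identity by \<open>pos_all_id\<close>.\<close>

lemma longest_element:
  obtains w0 where "w0 \<in> weyl D" "\<And>\<beta>. \<beta> \<in> pos \<Longrightarrow> \<beta> \<circ> w0 \<notin> pos"
    "\<And>w. w \<in> weyl D \<Longrightarrow> w \<noteq> w0 \<Longrightarrow> len w < len w0"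
proof -
  let ?M = "Max (len ` weyl D)"
  have le: "w \<in> weyl D \<Longrightarrow> len w \<le> ?M" for w using finite_weyl by simp
  have neg: "\<beta> \<circ> w \<notin> pos" if "w \<in> weyl D" "len w = ?M" "\<beta> \<in> pos" for w \<beta>
  proof (rule pos_nonpos_on_simple[OF that(1) _ that(3)])
    fix \<alpha> assume a: "\<alpha> \<in> simple D"
    have "len (s \<alpha> \<circ> w) \<le> ?M" using le weyl_refl that a simple_root by blast
    then show "\<alpha> \<circ> w \<notin> pos" using len_refl_pos[OF a that(1)] that(2) by auto
  qed
  have "?M \<in> len ` weyl D" using finite_weyl weyl_id by (intro Max_in) auto
  then obtain w0 where w0: "w0 \<in> weyl D" "len w0 = ?M" by auto
  have "len w < len w0" if w: "w \<in> weyl D" "w \<noteq> w0" for w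
  proof (rule ccontr)
    assume "\<not> len w < len w0"
    then have wM: "len w = ?M" using le[OF w(1)] w0 by simp
    have "w0 \<circ> inv w = id"
    proof (rule pos_all_id)
      show W: "w0 \<circ> inv w \<in> weyl D" using w0 w by (intro weyl_comp weyl_inv)
      fix \<alpha> assume a: "\<alpha> \<in> simple D"
      note p = simple_pos[OF a] note ar = simple_root[OF a]
      show "\<alpha> \<circ> (w0 \<circ> inv w) \<in> pos"
      proof (rule ccontr)
        assume "\<alpha> \<circ> (w0 \<circ> inv w) \<notin> pos"
        then have "(\<lambda>y. - (\<alpha> \<circ> (w0 \<circ> inv w)) y) \<in> pos"
          using neg_pos_iff[OF root_comp_weyl[OF W ar]] by simp
        from neg[OF w(1) wM this] have "(\<lambda>y. - (\<alpha> \<circ> (w0 \<circ> inv w) \<circ> w) y) \<notin> pos"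
          by (simp only: neg_comp not_False_eq_True)
        moreover have "\<alpha> \<circ> (w0 \<circ> inv w) \<circ> w = \<alpha> \<circ> w0"
          by (simp only: comp_assoc weyl_inv_comp w(1) comp_id)
        ultimately have "(\<lambda>y. - (\<alpha> \<circ> w0) y) \<notin> pos" by (simp only: not_False_eq_True)
        then have "\<alpha> \<circ> w0 \<in> pos"
          using neg_pos_iff[OF root_comp_weyl[OF w0(1) ar]] by simp
        then show False using neg[OF w0 p] by simp
      qed
    qed
    then have "w0 \<circ> (inv w \<circ> w) = w" by (simp add: o_assoc)
    then show False using w by simp
  qed
  then show ?thesis using that w0 neg by blast
qed

end

section \<open>Group algebras and their fraction fields\<close>

lemma ga_single_0 [simp]: "ga_single \<mu> 0 = 0"
  by transfer simp

text \<open>Keeping the support inside \<open>K\<close> lets a bound on the exponents survive the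
  reduction to monomials; \<open>dl_leading\<close> relies on this.\<close>

lemma ga_induct_on [consumes 1, case_names zero single add]:
  assumes K: "Poly_Mapping.keys (ga_coeffs r) \<subseteq> K"
    and zero: "P 0" and single: "\<And>\<mu> c. \<mu> \<in> K \<Longrightarrow> P (ga_single \<mu> c)"
    and add: "\<And>r r'. P r \<Longrightarrow> P r' \<Longrightarrow> P (r + r')"
  shows "P r"
proof -
  have sum: "P (\<Sum>\<mu>\<in>A. ga_single \<mu> (g \<mu>))" if "finite A" "A \<subseteq> K" for A g
    using that by (induction A) (simp_all add: zero single add)
  have Abs: "Abs_ga (\<Sum>\<mu>\<in>A. f \<mu>) = (\<Sum>\<mu>\<in>A. Abs_ga (f \<mu>))" for A and f :: "'a \<Rightarrow> 'a \<Rightarrow>\<^sub>0 complex"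
    by (induction A rule: infinite_finite_induct)
      (auto simp: zero_group_algebra.abs_eq plus_group_algebra.abs_eq[symmetric])
  have "r = Abs_ga (\<Sum>\<mu>\<in>Poly_Mapping.keys (ga_coeffs r).
      Poly_Mapping.single \<mu> (Poly_Mapping.lookup (ga_coeffs r) \<mu>))"
    by (simp add: pm_sum_single[symmetric] ga_coeffs_inverse)
  also have "\<dots> = (\<Sum>\<mu>\<in>Poly_Mapping.keys (ga_coeffs r). ga_single \<mu> (Poly_Mapping.lookup (ga_coeffs r) \<mu>))"
    by (simp add: Abs ga_single.abs_eq)
  finally show ?thesis using sum[OF finite_keys K] by metis
qed

lemma ga_induct [case_names single add]:
  assumes "\<And>\<mu> c. P (ga_single \<mu> c)" "\<And>r r'. P r \<Longrightarrow> P r' \<Longrightarrow> P (r + r')"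
  shows "P r"
  using assms(1)[of undefined 0] by (intro ga_induct_on[of r UNIV P] assms) simp_all

lemma ga_single_add: "ga_single \<mu> (c + d) = ga_single \<mu> c + ga_single \<mu> d"
  by transfer (rule single_add)

lemma ga_single_mult: "ga_single \<mu> c * ga_single \<nu> d = ga_single (\<mu> + \<nu>) (c * d)"
  by transfer (simp add: mult_single)

lemma ga_one: "1 = ga_single 0 1"
  by transfer (simp add: single_one)

lemma ga_push_single [simp]: "ga_push \<phi> (ga_single \<mu> c) = ga_single (\<phi> \<mu>) c"
  by transfer simp

lemma ga_push_zero [simp]: "ga_push \<phi> 0 = 0"
  by transfer simp

lemma ga_push_one: "additive \<phi> \<Longrightarrow> ga_push \<phi> 1 = 1"
  by (simp add: ga_one additive.zero)

lemma ga_push_comp: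
  fixes r :: "'a::ab_group_add group_algebra" and \<psi> :: "'a \<Rightarrow> 'b::ab_group_add" and \<phi> :: "'b \<Rightarrow> 'c::ab_group_add"
  shows "ga_push \<phi> (ga_push \<psi> r) = ga_push (\<phi> \<circ> \<psi>) r"
  by (induction r rule: ga_induct) (simp_all add: ga_push_add)

lemma ga_push_id: "ga_push id r = (r :: 'a::ab_group_add group_algebra)"
  by (induction r rule: ga_induct) (simp_all add: ga_push_add)

section \<open>The group algebra inside its fraction field\<close>

definition of_ga :: "'a::fin_free_ab_group group_algebra \<Rightarrow> 'a Frac_alg" where
  "of_ga r = Fract r 1"

lemma of_ga_0 [simp]: "of_ga 0 = 0"
  and of_ga_1 [simp]: "of_ga 1 = 1"
  and of_ga_add: "of_ga (r + r') = of_ga r + of_ga r'"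
  and of_ga_diff: "of_ga (r - r') = of_ga r - of_ga r'"
  and of_ga_mult: "of_ga (r * r') = of_ga r * of_ga r'"
  and of_ga_eq_iff [simp]: "of_ga r = of_ga r' \<longleftrightarrow> r = r'"
  by (simp_all add: of_ga_def Zero_fract_def One_fract_def eq_fract)

lemma of_ga_eq_0_iff [simp]: "of_ga r = 0 \<longleftrightarrow> r = 0"
  using of_ga_eq_iff[of r 0] by simp

lemma of_ga_cases: obtains a b where "x = of_ga a / of_ga b" "b \<noteq> 0"
  by (cases x rule: Fract_cases) (auto simp: of_ga_def)

lemma expo_of_ga: "\<pi>\<^bsup>\<mu>\<^esup> = of_ga (ga_single \<mu> 1)"
  by (simp add: expo_def of_ga_def)

lemma expo_add: "\<pi>\<^bsup>\<mu> + \<nu>\<^esup> = \<pi>\<^bsup>\<mu>\<^esup> * \<pi>\<^bsup>\<nu>\<^esup>"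
  by (simp add: expo_of_ga of_ga_mult[symmetric] ga_single_mult)

lemma expo_0 [simp]: "\<pi>\<^bsup>0\<^esup> = 1"
  by (simp add: expo_of_ga ga_one[symmetric])

lemma expo_nonzero [simp]: "\<pi>\<^bsup>\<mu>\<^esup> \<noteq> 0"
  using expo_add[of \<mu> "- \<mu>"] by auto

lemma expo_minus: "\<pi>\<^bsup>- \<mu>\<^esup> = inverse (\<pi>\<^bsup>\<mu>\<^esup>)"
  using expo_add[of \<mu> "- \<mu>"] by (simp add: inverse_unique)

lemma expo_inj [simp]: "\<pi>\<^bsup>\<mu>\<^esup> = \<pi>\<^bsup>\<nu>\<^esup> \<longleftrightarrow> \<mu> = \<nu>"
proof
  assume "\<pi>\<^bsup>\<mu>\<^esup> = \<pi>\<^bsup>\<nu>\<^esup>"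
  then have "Poly_Mapping.single \<mu> (1::complex) = Poly_Mapping.single \<nu> 1"
    unfolding expo_of_ga of_ga_eq_iff by transfer
  then have "Poly_Mapping.lookup (Poly_Mapping.single \<mu> (1::complex)) \<mu>
      = Poly_Mapping.lookup (Poly_Mapping.single \<nu> 1) \<mu>" by simp
  then show "\<mu> = \<nu>" by (simp add: lookup_single when_def split: if_splits)
qed simp

lemma expo_eq_1_iff [simp]: "\<pi>\<^bsup>\<mu>\<^esup> = 1 \<longleftrightarrow> \<mu> = 0" "1 = \<pi>\<^bsup>\<mu>\<^esup> \<longleftrightarrow> \<mu> = 0"
  using expo_inj[of \<mu> 0] expo_inj[of 0 \<mu>] by (auto simp del: expo_inj)

lemma const_frac_of_ga: "const_frac c = of_ga (ga_single 0 c)"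
  by (simp add: const_frac_def of_ga_def)

lemma const_frac_add: "const_frac (c + d) = const_frac c + const_frac d"
  by (simp add: const_frac_of_ga ga_single_add of_ga_add)

lemma const_frac_1 [simp]: "const_frac 1 = 1"
  by (simp add: const_frac_of_ga ga_one[symmetric])

lemma const_frac_0 [simp]: "const_frac 0 = 0"
  by (simp add: const_frac_of_ga)

lemma const_frac_minus: "const_frac (- c) = - const_frac c"
  using const_frac_add[of c "- c"] by (simp add: eq_neg_iff_add_eq_0 add.commute)

lemma const_frac_of_nat [simp]: "const_frac (of_nat n) = of_nat n"
  by (induction n) (simp_all add: const_frac_add)

lemma of_ga_single: "of_ga (ga_single \<mu> c) = const_frac c * \<pi>\<^bsup>\<mu>\<^esup>"
  by (simp add: const_frac_of_ga expo_of_ga of_ga_mult[symmetric] ga_single_mult)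

text \<open>Equality would compare the coefficient q at \<mu> with the coefficient 1 or 0, depending
  on whether \<mu> = 0.\<close>

lemma of_nat_q_expo_neq_1:
  assumes "1 < q"
  shows "1 - of_nat q * \<pi>\<^bsup>\<mu>\<^esup> \<noteq> (0 :: 'a::fin_free_ab_group Frac_alg)"
proof
  assume "1 - of_nat q * \<pi>\<^bsup>\<mu>\<^esup> = (0 :: 'a Frac_alg)"
  then have "of_ga (ga_single \<mu> (of_nat q)) = of_ga (ga_single (0::'a) 1)"
    by (simp add: of_ga_single ga_one[symmetric])
  then have "Poly_Mapping.single \<mu> (of_nat q :: complex) = Poly_Mapping.single 0 1"
    unfolding of_ga_eq_iff by transfer
  then have "Poly_Mapping.lookup (Poly_Mapping.single \<mu> (of_nat q :: complex)) \<mu>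
      = Poly_Mapping.lookup (Poly_Mapping.single 0 1) \<mu>" by simp
  then show False using assms by (simp add: lookup_single lookup_one when_def split: if_splits)
qed

text \<open>One interface for Weyl group elements, their extensions to the half lattice and the
  inclusion \<open>half_incl\<close>. Injectivity keeps denominators nonzero.\<close>

locale lattice_emb =
  fixes \<phi> :: "'a::fin_free_ab_group \<Rightarrow> 'b::fin_free_ab_group"
  assumes ad: "additive \<phi>" and inj: "inj \<phi>"
begin

lemma push_Fract: "b \<noteq> 0 \<Longrightarrow> frac_push \<phi> (Fract a b) = Fract (ga_push \<phi> a) (ga_push \<phi> b)"
  by (rule frac_push_Fract) (auto simp: additive.add[OF ad] inj)

lemma push_ga_mult: "ga_push \<phi> (r * r') = ga_push \<phi> r * ga_push \<phi> r'"
  by (rule ga_push_mult) (rule additive.add[OF ad])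

lemma push_ga_eq_0: "ga_push \<phi> r = 0 \<longleftrightarrow> r = 0"
  by (rule ga_push_eq_0_iff) (rule inj)

lemma push_of_ga: "frac_push \<phi> (of_ga r) = of_ga (ga_push \<phi> r)"
  by (simp add: of_ga_def push_Fract ga_push_one ad)

lemma push_mult: "frac_push \<phi> (x * y) = frac_push \<phi> x * frac_push \<phi> y"
  by (cases x rule: Fract_cases; cases y rule: Fract_cases)
    (simp add: push_Fract push_ga_mult push_ga_eq_0)

lemma push_add: "frac_push \<phi> (x + y) = frac_push \<phi> x + frac_push \<phi> y"
  by (cases x rule: Fract_cases; cases y rule: Fract_cases)
    (simp add: push_Fract push_ga_mult ga_push_add push_ga_eq_0)

lemma push_0 [simp]: "frac_push \<phi> 0 = 0"
  using push_of_ga[of 0] by simp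

lemma push_1 [simp]: "frac_push \<phi> 1 = 1"
  using push_of_ga[of 1] by (simp add: ga_push_one ad)

lemma push_minus: "frac_push \<phi> (- x) = - frac_push \<phi> x"
  using push_add[of x "- x"] by (simp add: eq_neg_iff_add_eq_0 add.commute)

lemma push_diff: "frac_push \<phi> (x - y) = frac_push \<phi> x - frac_push \<phi> y"
  using push_add[of x "- y"] by (simp add: push_minus)

lemma push_inverse: "frac_push \<phi> (inverse x) = inverse (frac_push \<phi> x)"
proof (cases "x = 0")
  case False
  then have "frac_push \<phi> x * frac_push \<phi> (inverse x) = 1" by (simp add: push_mult[symmetric])
  then show ?thesis by (simp add: inverse_unique)
qed simp

lemma push_divide: "frac_push \<phi> (x / y) = frac_push \<phi> x / frac_push \<phi> y"
  by (simp add: divide_inverse push_mult push_inverse)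

lemma push_of_nat [simp]: "frac_push \<phi> (of_nat n) = of_nat n"
  by (induction n) (simp_all add: push_add)

lemma push_sum: "frac_push \<phi> (\<Sum>i\<in>A. f i) = (\<Sum>i\<in>A. frac_push \<phi> (f i))"
  by (induction A rule: infinite_finite_induct) (simp_all add: push_add)

lemma push_prod: "frac_push \<phi> (\<Prod>i\<in>A. f i) = (\<Prod>i\<in>A. frac_push \<phi> (f i))"
  by (induction A rule: infinite_finite_induct) (simp_all add: push_mult)

lemma push_expo [simp]: "frac_push \<phi> (\<pi>\<^bsup>\<mu>\<^esup>) = \<pi>\<^bsup>\<phi> \<mu>\<^esup>"
  by (rule frac_push_expo) (auto simp: additive.add[OF ad] inj)

lemma push_comp:
  assumes "lattice_emb \<psi>"
  shows "frac_push \<psi> (frac_push \<phi> x) = frac_push (\<psi> \<circ> \<phi>) x"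
proof -
  interpret p: lattice_emb \<psi> by fact
  interpret c: lattice_emb "\<psi> \<circ> \<phi>"
    by standard (auto simp: additive.add[OF ad] additive.add[OF p.ad] intro: inj_compose p.inj inj)
  show ?thesis
    by (cases x rule: Fract_cases)
      (simp add: push_Fract p.push_Fract c.push_Fract push_ga_eq_0 ga_push_comp)
qed

end

lemma frac_push_id: "frac_push id x = x"
proof -
  interpret lattice_emb "id :: 'a::fin_free_ab_group \<Rightarrow> 'a" by standard auto
  show ?thesis by (cases x rule: Fract_cases) (simp add: push_Fract ga_push_id)
qed

lemma expo_independent:
  fixes c :: "('a::ab_group_add \<Rightarrow> 'b) \<Rightarrow> 'b::fin_free_ab_group Frac_alg"
  assumes "finite S" "\<And>w. w \<in> S \<Longrightarrow> additive w" "\<And>\<mu>. (\<Sum>w\<in>S. c w * \<pi>\<^bsup>w \<mu>\<^esup>) = 0" "w \<in> S"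
  shows "c w = 0"
  using assms
proof (induction S arbitrary: c w rule: finite_induct)
  case (insert v S)
  have *: "c w = 0" if w: "w \<in> S" for w
  proof -
    have "w \<noteq> v" using w insert.hyps by auto
    then obtain \<mu> where \<mu>: "w \<mu> \<noteq> v \<mu>" by (auto simp: fun_eq_iff)
    have "(\<Sum>u\<in>S. c u * (\<pi>\<^bsup>u \<mu>\<^esup> - \<pi>\<^bsup>v \<mu>\<^esup>) * \<pi>\<^bsup>u \<nu>\<^esup>) = 0" for \<nu>
    proof -
      have "(\<Sum>u\<in>S. c u * (\<pi>\<^bsup>u \<mu>\<^esup> - \<pi>\<^bsup>v \<mu>\<^esup>) * \<pi>\<^bsup>u \<nu>\<^esup>)
          = (\<Sum>u\<in>insert v S. c u * (\<pi>\<^bsup>u \<mu>\<^esup> - \<pi>\<^bsup>v \<mu>\<^esup>) * \<pi>\<^bsup>u \<nu>\<^esup>)"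
        using insert.hyps by simp
      also have "\<dots> = (\<Sum>u\<in>insert v S. c u * \<pi>\<^bsup>u (\<mu> + \<nu>)\<^esup> - \<pi>\<^bsup>v \<mu>\<^esup> * (c u * \<pi>\<^bsup>u \<nu>\<^esup>))"
        using insert.prems(1)
        by (intro sum.cong) (auto simp: additive.add expo_add algebra_simps)
      also have "\<dots> = (\<Sum>u\<in>insert v S. c u * \<pi>\<^bsup>u (\<mu> + \<nu>)\<^esup>) - \<pi>\<^bsup>v \<mu>\<^esup> * (\<Sum>u\<in>insert v S. c u * \<pi>\<^bsup>u \<nu>\<^esup>)"
        by (simp only: sum_subtractf sum_distrib_left)
      also have "\<dots> = 0" by (simp only: insert.prems(2)) simp
      finally show ?thesis .
    qed
    from insert.IH[OF insert.prems(1) this w] show "c w = 0" using \<mu> by simp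
  qed
  have "additive v" using insert.prems(1) by simp
  then have "c v = 0" using insert.prems(2)[of 0] insert.hyps * by (simp add: additive.zero)
  then show ?case using * insert.prems(3) by auto
qed simp

section \<open>Evaluation of group algebra elements\<close>

definition ga_ev :: "('a \<Rightarrow> complex) \<Rightarrow> 'a group_algebra \<Rightarrow> complex" where
  "ga_ev \<chi> r = (\<Sum>\<mu>\<in>Poly_Mapping.keys (ga_coeffs r). Poly_Mapping.lookup (ga_coeffs r) \<mu> * \<chi> \<mu>)"

lemma ga_ev_superset:
  assumes "finite A" "Poly_Mapping.keys (ga_coeffs r) \<subseteq> A"
  shows "ga_ev \<chi> r = (\<Sum>\<mu>\<in>A. Poly_Mapping.lookup (ga_coeffs r) \<mu> * \<chi> \<mu>)"
  unfolding ga_ev_def using assms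
  by (intro sum.mono_neutral_left) (auto simp: in_keys_iff)

lemma ga_ev_single [simp]: "ga_ev \<chi> (ga_single \<mu> c) = c * \<chi> \<mu>"
  by (subst ga_ev_superset[of "{\<mu>}"]) (auto simp: ga_single.rep_eq)

lemma ga_ev_add: "ga_ev \<chi> (r + r') = ga_ev \<chi> r + ga_ev \<chi> r'"
proof -
  let ?A = "Poly_Mapping.keys (ga_coeffs r) \<union> Poly_Mapping.keys (ga_coeffs r')"
  have "Poly_Mapping.keys (ga_coeffs (r + r')) \<subseteq> ?A"
    by (simp add: plus_group_algebra.rep_eq Poly_Mapping.keys_add)
  then show ?thesis
    by (simp add: ga_ev_superset[of ?A] plus_group_algebra.rep_eq lookup_add distrib_right sum.distrib)
qed

lemma ga_ev_0 [simp]: "ga_ev \<chi> 0 = 0"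
  using ga_ev_add[of \<chi> 0 0] by simp

lemma ga_ev_diff: "ga_ev \<chi> (r - r') = ga_ev \<chi> r - ga_ev \<chi> r'"
  using ga_ev_add[of \<chi> "r - r'" r'] by simp

lemma ga_ev_mult:
  assumes "\<And>x y. \<chi> (x + y) = \<chi> x * \<chi> y"
  shows "ga_ev \<chi> (r * r') = ga_ev \<chi> r * ga_ev \<chi> r'"
proof (induction r rule: ga_induct)
  case (single \<mu> c)
  show ?case
    by (induction r' rule: ga_induct)
      (simp_all add: ga_single_mult ga_ev_add assms distrib_left mult_ac)
qed (simp add: ga_ev_add distrib_right)

lemma ga_ev_push:
  fixes r :: "'a::ab_group_add group_algebra" and \<phi> :: "'a \<Rightarrow> 'b::ab_group_add"
  shows "ga_ev \<chi> (ga_push \<phi> r) = ga_ev (\<chi> \<circ> \<phi>) r"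
  by (induction r rule: ga_induct) (simp_all add: ga_push_add ga_ev_add)

text \<open>The coordinates of x and, one degree above them, \<open>\<omega> x\<close> are the
  coefficients of a polynomial in an integer parameter b. For x \<noteq> 0 it is not the zero
  polynomial, so it vanishes for finitely many b only; on \<open>B\<close> its leading coefficient
  is positive. Any large b works.\<close>

lemma separating_functional:
  fixes \<omega> :: "'a::fin_free_ab_group \<Rightarrow> int"
  assumes \<omega>: "additive \<omega>" and B: "finite B" "\<And>b. b \<in> B \<Longrightarrow> 0 < \<omega> b"
    and K: "finite K" "0 \<notin> K"
  shows "\<exists>\<phi> :: 'a \<Rightarrow> int. additive \<phi> \<and> (\<forall>b\<in>B. 0 < \<phi> b) \<and> (\<forall>x\<in>K. \<phi> x \<noteq> 0)"
proof -
  obtain n and c :: "'a \<Rightarrow> nat \<Rightarrow> int" where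
    c: "bij_betw c UNIV {v. \<forall>i\<ge>n. v i = 0}" "\<And>x y i. c (x + y) i = c x i + c y i"
    using ex_coordinates by blast
  have ad: "additive (\<lambda>x. c x i)" for i by standard (rule c(2))
  define p where "p x = monom (real_of_int (\<omega> x)) n + (\<Sum>i<n. monom (real_of_int (c x i)) i)" for x
  define \<phi> where "\<phi> b x = \<omega> x * int b ^ n + (\<Sum>i<n. c x i * int b ^ i)" for b x
  have poly: "poly (p x) (real b) = real_of_int (\<phi> b x)" for b x
    by (simp add: p_def \<phi>_def poly_monom poly_sum)
  have coeff: "coeff (p x) i = (if i < n then real_of_int (c x i) else if i = n then real_of_int (\<omega> x) else 0)" for x i
    by (simp add: p_def coeff_sum)
  have nz: "p x \<noteq> 0" if "x \<noteq> 0" for x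
  proof
    assume "p x = 0"
    then have "c x i = 0" if "i < n" for i using coeff[of x i] that by simp
    moreover have "c x \<in> {v. \<forall>i\<ge>n. v i = 0}" using c(1) by (auto simp: bij_betw_def)
    then have "c x i = 0" if "\<not> i < n" for i using that by simp
    ultimately have "c x = c 0" by (auto simp: fun_eq_iff additive.zero[OF ad])
    then show False using \<open>x \<noteq> 0\<close> c(1) by (auto simp: bij_betw_def dest: injD)
  qed
  have "eventually (\<lambda>b. \<phi> b x \<noteq> 0) sequentially" if "x \<in> K" for x
  proof -
    have "finite {y. poly (p x) y = 0}" using that K by (intro poly_roots_finite nz) auto
    then have "finite (real -` {y. poly (p x) y = 0})" by (rule finite_vimageI) (simp add: inj_on_def)
    moreover have "real -` {y. poly (p x) y = 0} = {b. \<not> \<phi> b x \<noteq> 0}" by (auto simp: poly)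
    ultimately show ?thesis
      by (simp add: cofinite_eq_sequentially[symmetric] eventually_cofinite)
  qed
  then have e1: "eventually (\<lambda>b. \<forall>x\<in>K. \<phi> b x \<noteq> 0) sequentially"
    using K by (intro eventually_ball_finite) auto
  have "eventually (\<lambda>b. 0 < \<phi> b x) sequentially" if "x \<in> B" for x
  proof -
    have d: "degree (p x) = n"
    proof (rule antisym)
      show "degree (p x) \<le> n" by (rule degree_le) (auto simp: coeff)
      show "n \<le> degree (p x)" using B(2)[OF that] by (intro le_degree) (simp add: coeff)
    qed
    then have "0 < lead_coeff (p x)" using B(2)[OF that] by (simp add: coeff)
    from poly_pinfty_gt_lc[OF this] obtain m where "\<And>y. m \<le> y \<Longrightarrow> lead_coeff (p x) \<le> poly (p x) y"
      by blast
    then have "0 < \<phi> b x" if "m \<le> real b" for b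
      using that \<open>0 < lead_coeff (p x)\<close> poly[of x b] by (smt (verit) of_int_0_less_iff)
    moreover have "eventually (\<lambda>b. m \<le> real b) sequentially"
      using eventually_ge_at_top[of "nat \<lceil>m\<rceil>"]
      by eventually_elim linarith
    ultimately show ?thesis by (auto elim: eventually_mono)
  qed
  then have "eventually (\<lambda>b. \<forall>x\<in>B. 0 < \<phi> b x) sequentially"
    using B by (intro eventually_ball_finite) auto
  with e1 have "eventually (\<lambda>b. (\<forall>x\<in>K. \<phi> b x \<noteq> 0) \<and> (\<forall>x\<in>B. 0 < \<phi> b x)) sequentially"
    by (rule eventually_conj)
  from eventually_happens'[OF sequentially_bot this]
  obtain b where b: "\<forall>x\<in>K. \<phi> b x \<noteq> 0" "\<forall>x\<in>B. 0 < \<phi> b x" by blast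
  have "additive (\<phi> b)"
    by standard (simp add: \<phi>_def additive.add[OF \<omega>] c(2) distrib_right sum.distrib)
  then show ?thesis using b by blast
qed

text \<open>Along a one-parameter family x \<mapsto> t^\<phi>(x), with \<phi> injective on the
  support of r, the element becomes a nonzero Laurent polynomial in t, so all but finitely many t
  are admissible.\<close>

lemma ex_character_nonvanishing:
  fixes \<omega> :: "'a::fin_free_ab_group \<Rightarrow> int" and r :: "'a group_algebra"
  assumes \<omega>: "additive \<omega>" and B: "finite B" "\<And>b. b \<in> B \<Longrightarrow> 0 < \<omega> b" and r: "r \<noteq> 0"
  obtains \<chi> :: "'a \<Rightarrow> real" where "\<And>x y. \<chi> (x + y) = \<chi> x * \<chi> y" "\<And>x. 0 < \<chi> x"
    "\<And>b. b \<in> B \<Longrightarrow> M < \<chi> b" "ga_ev (of_real \<circ> \<chi>) r \<noteq> 0"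
proof -
  define K where "K = Poly_Mapping.keys (ga_coeffs r)"
  define cf where "cf = Poly_Mapping.lookup (ga_coeffs r)"
  have fin: "finite K" by (simp add: K_def)
  \<comment> \<open>A functional that is nonzero on the nonzero differences is injective on
    \<open>K\<close>, so no two monomials can merge.\<close>
  define K' where "K' = (\<lambda>(a, b). a - b) ` (K \<times> K) - {0}"
  have K': "finite K'" "0 \<notin> K'" using fin by (simp_all add: K'_def)
  obtain \<phi> :: "'a \<Rightarrow> int" where \<phi>: "additive \<phi>" "\<And>b. b \<in> B \<Longrightarrow> 0 < \<phi> b"
    "\<And>x. x \<in> K' \<Longrightarrow> \<phi> x \<noteq> 0"
    using separating_functional[OF \<omega> B K'] by blast
  have inj: "inj_on \<phi> K"
  proof (rule inj_onI, rule ccontr)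
    fix x y assume xy: "x \<in> K" "y \<in> K" "\<phi> x = \<phi> y" "x \<noteq> y"
    then have "x - y \<in> K'" unfolding K'_def by force
    from \<phi>(3)[OF this] xy show False by (simp add: additive.diff[OF \<phi>(1)])
  qed
  \<comment> \<open>A common shift makes all exponents nonnegative, turning the Laurent polynomial
    into a polynomial.\<close>
  obtain N :: int where N: "\<And>x. x \<in> K \<Longrightarrow> 0 \<le> \<phi> x + N"
  proof
    fix x assume "x \<in> K"
    then have "- \<phi> x \<le> (\<Sum>x\<in>K. \<bar>\<phi> x\<bar>)"
      using member_le_sum[of x K "\<lambda>x. \<bar>\<phi> x\<bar>"] fin by auto
    then show "0 \<le> \<phi> x + (\<Sum>x\<in>K. \<bar>\<phi> x\<bar>)" by simp
  qed
  define P where "P = (\<Sum>x\<in>K. monom (cf x) (nat (\<phi> x + N)))"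
  have "K \<noteq> {}" using r by (auto simp: K_def ga_coeffs_inject[symmetric] zero_group_algebra.rep_eq)
  then obtain x0 where x0: "x0 \<in> K" by blast
  have "coeff P (nat (\<phi> x0 + N)) = (\<Sum>x\<in>K. if x = x0 then cf x else 0)"
    unfolding P_def coeff_sum
  proof (intro sum.cong refl)
    fix x assume x: "x \<in> K"
    then have "nat (\<phi> x + N) = nat (\<phi> x0 + N) \<longleftrightarrow> x = x0"
      using N[OF x] N[OF x0] inj x0 by (auto simp: nat_eq_iff inj_on_def)
    then show "coeff (monom (cf x) (nat (\<phi> x + N))) (nat (\<phi> x0 + N)) = (if x = x0 then cf x else 0)"
      by simp
  qed
  also have "\<dots> = cf x0" using x0 fin by simp
  also have "\<dots> \<noteq> 0" using x0 by (simp add: cf_def K_def in_keys_iff)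
  finally have "P \<noteq> 0" by auto
  then have "finite {z. poly P z = 0}" by (rule poly_roots_finite)
  then have "finite ((of_real :: real \<Rightarrow> complex) -` {z. poly P z = 0})"
    by (rule finite_vimageI) (simp add: inj_on_def)
  moreover have "infinite {max 1 M<..}" by (rule infinite_Ioi)
  ultimately obtain t where t: "max 1 M < t" "poly P (of_real t) \<noteq> 0"
    by (metis (mono_tags, lifting) finite_subset greaterThan_iff mem_Collect_eq subsetI vimageI)
  then have t1: "1 < t" "M < t" by auto
  define \<chi> where "\<chi> x = t powi \<phi> x" for x
  have ga_ev_P: "of_real (t powi N) * ga_ev (of_real \<circ> \<chi>) r = poly P (of_real t)"
  proof -
    have "poly P (of_real t) = (\<Sum>x\<in>K. cf x * of_real t ^ nat (\<phi> x + N))"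
      by (simp add: P_def poly_sum poly_monom)
    also have "\<dots> = (\<Sum>x\<in>K. cf x * of_real (\<chi> x * t powi N))"
    proof (intro sum.cong refl arg_cong2[of _ _ _ _ "(*)"])
      fix x assume "x \<in> K"
      then have "t ^ nat (\<phi> x + N) = t powi (\<phi> x + N)"
        using N by (simp add: power_int_def)
      also have "\<dots> = \<chi> x * t powi N" using t1 by (simp add: \<chi>_def power_int_add)
      finally show "complex_of_real t ^ nat (\<phi> x + N) = of_real (\<chi> x * t powi N)"
        by (metis of_real_power)
    qed
    also have "\<dots> = of_real (t powi N) * ga_ev (of_real \<circ> \<chi>) r"
      by (simp add: ga_ev_def K_def cf_def sum_distrib_left mult_ac)
    finally show ?thesis by simp
  qed
  show ?thesis
  proof (rule that[of \<chi>])
    show "\<chi> (x + y) = \<chi> x * \<chi> y" for x y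
      using t1 by (simp add: \<chi>_def additive.add[OF \<phi>(1)] power_int_add)
    show "0 < \<chi> x" for x using t1 by (simp add: \<chi>_def)
    show "M < \<chi> b" if "b \<in> B" for b
    proof -
      have "t powi 1 \<le> t powi \<phi> b" using \<phi>(2)[OF that] t1 by (intro power_int_increasing) auto
      then show ?thesis using t1 by (simp add: \<chi>_def)
    qed
    show "ga_ev (of_real \<circ> \<chi>) r \<noteq> 0" using ga_ev_P t by auto
  qed
qed

section \<open>The regular representation of the finite Hecke algebra\<close>

context weyl_datum
begin

lemma refl_neg: "\<beta> \<in> roots D \<Longrightarrow> s (\<lambda>y. - \<beta> y) = s \<beta>"
  by (simp add: fun_eq_iff root_refl_def coroot_neg zscale_minus_left zscale_minus_right)

lemma bij_pos_minus_simple: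
  assumes "\<alpha> \<in> simple D"
  shows "bij_betw (\<lambda>\<beta>. \<beta> \<circ> s \<alpha>) (pos - {\<alpha>}) (pos - {\<alpha>})"
proof -
  note ar = simple_root[OF assms]
  have inv: "\<beta> \<circ> s \<alpha> \<circ> s \<alpha> = \<beta>" for \<beta> :: "'y \<Rightarrow> int"
    using refl_comp_refl[OF ar] by (simp add: comp_assoc)
  have "\<beta> \<circ> s \<alpha> \<in> pos - {\<alpha>}" if "\<beta> \<in> pos - {\<alpha>}" for \<beta>
  proof -
    have "\<beta> \<circ> s \<alpha> \<noteq> \<alpha>"
    proof
      assume "\<beta> \<circ> s \<alpha> = \<alpha>"
      then have "\<beta> = \<alpha> \<circ> s \<alpha>" using inv[of \<beta>] by simp
      then show False using that not_pos_and_neg[OF simple_pos[OF assms]] comp_refl_self[OF ar] by auto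
    qed
    then show ?thesis using simple_perm[OF assms] that by simp
  qed
  then show ?thesis
    by (intro bij_betw_byWitness[where f' = "\<lambda>\<beta>. \<beta> \<circ> s \<alpha>"]) (auto simp only: inv)
qed

text \<open>\<open>F\<close> is left general: with coroots it gives the reflection of their sum,
  with values at a point the change of height in \<open>antidominant_conj\<close>.\<close>

lemma sum_pos_refl:
  assumes a: "\<alpha> \<in> simple D"
  shows "(\<Sum>\<beta>\<in>pos. F (\<beta> \<circ> s \<alpha>)) = (\<Sum>\<beta>\<in>pos. F \<beta>) - F \<alpha> + (F (\<lambda>y. - \<alpha> y) :: 'z::ab_group_add)"
proof -
  have "(\<Sum>\<beta>\<in>pos. F (\<beta> \<circ> s \<alpha>)) = F (\<alpha> \<circ> s \<alpha>) + (\<Sum>\<beta>\<in>pos - {\<alpha>}. F (\<beta> \<circ> s \<alpha>))"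
    by (rule sum.remove[OF finite_pos simple_pos[OF a]])
  also have "(\<Sum>\<beta>\<in>pos - {\<alpha>}. F (\<beta> \<circ> s \<alpha>)) = (\<Sum>\<beta>\<in>pos - {\<alpha>}. F \<beta>)"
    by (rule sum.reindex_bij_betw[OF bij_pos_minus_simple[OF a]])
  also have "\<dots> = (\<Sum>\<beta>\<in>pos. F \<beta>) - F \<alpha>"
    using sum.remove[OF finite_pos simple_pos[OF a], of F] by simp
  finally have e: "(\<Sum>\<beta>\<in>pos. F (\<beta> \<circ> s \<alpha>)) = F (\<alpha> \<circ> s \<alpha>) + ((\<Sum>\<beta>\<in>pos. F \<beta>) - F \<alpha>)" .
  show ?thesis unfolding e comp_refl_self[OF simple_root[OF a]] by (rule add.commute)
qed

lemma pos_comp_simple_iff: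
  assumes a: "\<alpha> \<in> simple D" and g: "\<gamma> \<in> roots D" and ne: "\<gamma> \<noteq> \<alpha>" "\<gamma> \<noteq> (\<lambda>y. - \<alpha> y)"
  shows "\<gamma> \<circ> s \<alpha> \<in> pos \<longleftrightarrow> \<gamma> \<in> pos"
proof
  assume "\<gamma> \<in> pos"
  then show "\<gamma> \<circ> s \<alpha> \<in> pos" using simple_perm[OF a _ ne(1)] by blast
next
  assume p: "\<gamma> \<circ> s \<alpha> \<in> pos"
  show "\<gamma> \<in> pos"
  proof (rule ccontr)
    assume "\<gamma> \<notin> pos"
    then have "(\<lambda>y. - \<gamma> y) \<in> pos" using neg_pos_iff[OF g] by simp
    moreover have "(\<lambda>y. - \<gamma> y) \<noteq> \<alpha>" using ne(2) by force
    ultimately have "(\<lambda>y. - \<gamma> y) \<circ> s \<alpha> \<in> pos" by (rule simple_perm[OF a])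
    then show False using p not_pos_and_neg by (simp only: neg_comp)
  qed
qed

end

locale hecke_datum = weyl_datum D for D :: "'y::fin_free_ab_group root_datum" +
  fixes q :: nat
  assumes q: "1 < q"
begin

text \<open>Left and right multiplication by \<open>T\<^sub>s\<close> in the basis \<open>T\<^sub>w\<close>, on coefficient functions.\<close>

definition hleft :: "('y \<Rightarrow> int) \<Rightarrow> (('y \<Rightarrow> 'y) \<Rightarrow> complex) \<Rightarrow> ('y \<Rightarrow> 'y) \<Rightarrow> complex" where
  "hleft \<alpha> h u = (if \<alpha> \<circ> u \<in> pos then of_nat q * h (s \<alpha> \<circ> u)
     else h (s \<alpha> \<circ> u) + (of_nat q - 1) * h u)"

definition hright :: "('y \<Rightarrow> int) \<Rightarrow> (('y \<Rightarrow> 'y) \<Rightarrow> complex) \<Rightarrow> ('y \<Rightarrow> 'y) \<Rightarrow> complex" where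
  "hright \<beta> h u = (if \<beta> \<circ> inv u \<in> pos then of_nat q * h (u \<circ> s \<beta>)
     else h (u \<circ> s \<beta>) + (of_nat q - 1) * h u)"

text \<open>A direct check that presupposes no associativity. The two rules interfere only if
  \<open>\<beta> \<circ> inv u\<close> is \<alpha> or -\<alpha>, and then
  \<open>s \<alpha> \<circ> u\<close> = \<open>u \<circ> s \<beta>\<close>; otherwise neither
  multiplication affects the sign condition of the other.\<close>

lemma hleft_hright:
  assumes a: "\<alpha> \<in> simple D" and b: "\<beta> \<in> simple D" and u: "u \<in> weyl D"
  shows "hleft \<alpha> (hright \<beta> h) u = hright \<beta> (hleft \<alpha> h) u"
proof -
  note ar = simple_root[OF a] and br = simple_root[OF b]
  have i1: "\<beta> \<circ> inv (s \<alpha> \<circ> u) = \<beta> \<circ> inv u \<circ> s \<alpha>"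
    using inv_refl_comp[OF u ar] by (simp only: o_assoc)
  have i2: "\<alpha> \<circ> (u \<circ> s \<beta>) = \<alpha> \<circ> u \<circ> s \<beta>" by (rule o_assoc)
  have i3: "s \<alpha> \<circ> (u \<circ> s \<beta>) = s \<alpha> \<circ> u \<circ> s \<beta>" by (rule o_assoc)
  have rb: "\<beta> \<circ> inv u \<in> roots D" using u br by (intro root_comp_weyl weyl_inv)
  have ra: "\<alpha> \<circ> u \<in> roots D" using u ar by (intro root_comp_weyl)
  have iu: "\<gamma> \<circ> inv u \<circ> u = \<gamma>" "\<gamma> \<circ> u \<circ> inv u = \<gamma>" for \<gamma> :: "'y \<Rightarrow> int"
    using u by (simp_all add: comp_assoc)
  have sw: "u \<circ> s (\<alpha> \<circ> u) = s \<alpha> \<circ> u" by (rule refl_comp_weyl[OF u ar])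
  consider (eq) "\<beta> \<circ> inv u = \<alpha>" | (neg) "\<beta> \<circ> inv u = (\<lambda>y. - \<alpha> y)"
    | (gen) "\<beta> \<circ> inv u \<noteq> \<alpha>" "\<beta> \<circ> inv u \<noteq> (\<lambda>y. - \<alpha> y)" by blast
  then show ?thesis
  proof cases
    case eq
    then have e: "\<alpha> \<circ> u = \<beta>" using iu(1)[of \<beta>] by simp
    have su: "u \<circ> s \<beta> = s \<alpha> \<circ> u" using sw e by simp
    have "\<beta> \<circ> s \<beta> \<notin> pos" "\<alpha> \<circ> s \<alpha> \<notin> pos"
      using comp_refl_self[OF ar] comp_refl_self[OF br] not_pos_and_neg simple_pos a b by auto
    then show ?thesis using simple_pos[OF a] simple_pos[OF b]
      unfolding hleft_def hright_def i1 i2 i3 eq e by (simp add: su)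
  next
    case neg
    have "(\<lambda>y. - \<beta> y) = (\<lambda>y. - (\<beta> \<circ> inv u) y) \<circ> u"
      using iu(1)[of \<beta>] by (simp only: neg_comp)
    then have e: "\<alpha> \<circ> u = (\<lambda>y. - \<beta> y)" unfolding neg by simp
    have su: "u \<circ> s \<beta> = s \<alpha> \<circ> u" using sw e refl_neg[OF br] by simp
    have n: "(\<lambda>y. - \<alpha> y) \<circ> s \<alpha> = \<alpha>" "(\<lambda>y. - \<beta> y) \<circ> s \<beta> = \<beta>"
      using comp_refl_self[OF ar] comp_refl_self[OF br] by (simp_all add: fun_eq_iff)
    show ?thesis using simple_pos[OF a] simple_pos[OF b] not_pos_and_neg[of \<alpha>] not_pos_and_neg[of \<beta>]
      unfolding hleft_def hright_def i1 i2 i3 neg e n by (simp add: su algebra_simps)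
  next
    case gen
    have "\<alpha> \<circ> u \<noteq> \<beta>" using gen(1) iu(2)[of \<alpha>] by auto
    moreover have "\<alpha> \<circ> u \<noteq> (\<lambda>y. - \<beta> y)"
    proof
      assume "\<alpha> \<circ> u = (\<lambda>y. - \<beta> y)"
      then have "\<alpha> = (\<lambda>y. - (\<beta> \<circ> inv u) y)" using iu(2)[of \<alpha>] neg_comp[of \<beta> "inv u"] by simp
      then show False using gen(2) by (auto simp: fun_eq_iff)
    qed
    ultimately have "\<alpha> \<circ> u \<circ> s \<beta> \<in> pos \<longleftrightarrow> \<alpha> \<circ> u \<in> pos" by (rule pos_comp_simple_iff[OF b ra])
    moreover have "\<beta> \<circ> inv u \<circ> s \<alpha> \<in> pos \<longleftrightarrow> \<beta> \<circ> inv u \<in> pos" by (rule pos_comp_simple_iff[OF a rb gen])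
    ultimately show ?thesis
      unfolding hleft_def hright_def i1 i2 i3 by (simp only:) (auto simp: algebra_simps)
  qed
qed

text \<open>Coefficient functions are total, but only their values on W carry meaning; the
  congruence rules exchange functions that agree there.\<close>

lemma hleft_cong: "u \<in> weyl D \<Longrightarrow> \<alpha> \<in> simple D \<Longrightarrow> (\<And>v. v \<in> weyl D \<Longrightarrow> h v = h' v) \<Longrightarrow> hleft \<alpha> h u = hleft \<alpha> h' u"
  by (simp add: hleft_def weyl_refl simple_root)

lemma hright_cong: "u \<in> weyl D \<Longrightarrow> \<alpha> \<in> simple D \<Longrightarrow> (\<And>v. v \<in> weyl D \<Longrightarrow> h v = h' v) \<Longrightarrow> hright \<alpha> h u = hright \<alpha> h' u"
  by (simp add: hright_def weyl_comp refl_weyl simple_root)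

lemma hleft_words_cong:
  "set as \<subseteq> simple D \<Longrightarrow> u \<in> weyl D \<Longrightarrow> (\<And>v. v \<in> weyl D \<Longrightarrow> h v = h' v) \<Longrightarrow>
     foldr hleft as h u = foldr hleft as h' u"
  by (induction as arbitrary: u) (auto intro: hleft_cong)

lemma hleft_words_hright:
  "set as \<subseteq> simple D \<Longrightarrow> \<beta> \<in> simple D \<Longrightarrow> u \<in> weyl D \<Longrightarrow>
     foldr hleft as (hright \<beta> h) u = hright \<beta> (foldr hleft as h) u"
proof (induction as arbitrary: u)
  case (Cons \<alpha> as)
  have "foldr hleft (\<alpha> # as) (hright \<beta> h) u = hleft \<alpha> (hright \<beta> (foldr hleft as h)) u"
    using Cons by (auto intro!: hleft_cong)
  also have "\<dots> = hright \<beta> (foldr hleft (\<alpha> # as) h) u" using Cons by (simp add: hleft_hright)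
  finally show ?case .
qed simp

lemma hleft_words_hright_words:
  "set as \<subseteq> simple D \<Longrightarrow> set bs \<subseteq> simple D \<Longrightarrow> u \<in> weyl D \<Longrightarrow>
     foldr hleft as (foldr hright bs h) u = foldr hright bs (foldr hleft as h) u"
proof (induction bs arbitrary: u)
  case (Cons \<beta> bs)
  have "foldr hleft as (foldr hright (\<beta> # bs) h) u = hright \<beta> (foldr hleft as (foldr hright bs h)) u"
    using Cons by (simp add: hleft_words_hright)
  also have "\<dots> = foldr hright (\<beta> # bs) (foldr hleft as h) u"
    using Cons by (auto intro!: hright_cong)
  finally show ?case .
qed simp

lemma hleft_basis:
  assumes a: "\<alpha> \<in> simple D" and u: "u \<in> weyl D" and v: "v \<in> weyl D" and p: "\<alpha> \<circ> u \<in> pos"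
  shows "hleft \<alpha> (hecke_T u) v = hecke_T (s \<alpha> \<circ> u) v"
proof -
  note ar = simple_root[OF a]
  have ss: "s \<alpha> \<circ> (s \<alpha> \<circ> w) = w" for w :: "'y \<Rightarrow> 'y" using ar by (simp add: o_assoc refl_comp_refl)
  have iff: "s \<alpha> \<circ> v = u \<longleftrightarrow> v = s \<alpha> \<circ> u" using ss by metis
  have n: "\<alpha> \<circ> (s \<alpha> \<circ> u) \<notin> pos" using comp_refl_pos_iff[OF ar u] p by simp
  have nu: "v \<noteq> u" if "\<alpha> \<circ> v \<notin> pos" using that p by blast
  have nv: "\<alpha> \<circ> v \<notin> pos" if "v = s \<alpha> \<circ> u" using that n by simp
  show ?thesis unfolding hleft_def hecke_T_def iff
    by (cases "\<alpha> \<circ> v \<in> pos"; cases "v = s \<alpha> \<circ> u") (use nu nv in simp_all)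
qed

lemma hright_basis:
  assumes a: "\<alpha> \<in> simple D" and u: "u \<in> weyl D" and v: "v \<in> weyl D" and p: "\<alpha> \<circ> inv u \<in> pos"
  shows "hright \<alpha> (hecke_T u) v = hecke_T (u \<circ> s \<alpha>) v"
proof -
  note ar = simple_root[OF a]
  have ss: "w \<circ> s \<alpha> \<circ> s \<alpha> = w" for w :: "'y \<Rightarrow> 'y" using ar by (simp add: comp_assoc refl_comp_refl)
  have iff: "v \<circ> s \<alpha> = u \<longleftrightarrow> v = u \<circ> s \<alpha>" using ss by metis
  have n: "\<alpha> \<circ> inv (u \<circ> s \<alpha>) \<notin> pos"
    using comp_refl_pos_iff[OF ar weyl_inv[OF u]] p inv_comp_refl[OF u ar] by simp
  have nu: "v \<noteq> u" if "\<alpha> \<circ> inv v \<notin> pos" using that p by blast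
  have nv: "\<alpha> \<circ> inv v \<notin> pos" if "v = u \<circ> s \<alpha>" using that n by simp
  show ?thesis unfolding hright_def hecke_T_def iff
    by (cases "\<alpha> \<circ> inv v \<in> pos"; cases "v = u \<circ> s \<alpha>") (use nu nv in simp_all)
qed

lemma hleft_word_basis:
  "redw as \<Longrightarrow> v \<in> weyl D \<Longrightarrow> foldr hleft as (hecke_T id) v = hecke_T (word_prod D as) v"
proof (induction as arbitrary: v)
  case (Cons \<alpha> as)
  then have w: "word_prod D as \<in> weyl D" by (intro weyl_word redw_simple) simp
  have a: "\<alpha> \<in> simple D" and p: "redw as" using Cons.prems by simp_all
  have "foldr hleft (\<alpha> # as) (hecke_T id) v = hleft \<alpha> (foldr hleft as (hecke_T id)) v" by simp
  also have "\<dots> = hleft \<alpha> (hecke_T (word_prod D as)) v"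
    by (rule hleft_cong[OF Cons.prems(2) a]) (rule Cons.IH[OF p])
  also have "\<dots> = hecke_T (word_prod D (\<alpha> # as)) v" using Cons.prems w by (simp add: hleft_basis)
  finally show ?case .
qed simp

lemma hright_word_basis:
  "redw bs \<Longrightarrow> v \<in> weyl D \<Longrightarrow> foldr hright bs (hecke_T id) v = hecke_T (inv (word_prod D bs)) v"
proof (induction bs arbitrary: v)
  case (Cons \<beta> bs)
  then have w: "word_prod D bs \<in> weyl D" by (intro weyl_word redw_simple) simp
  then have ii: "inv (inv (word_prod D bs)) = word_prod D bs" by (simp add: inv_inv_eq weyl_bij)
  have b: "\<beta> \<in> simple D" "\<beta> \<in> roots D" using Cons.prems simple_root by auto
  have p: "redw bs" using Cons.prems by simp
  have "foldr hright (\<beta> # bs) (hecke_T id) v = hright \<beta> (foldr hright bs (hecke_T id)) v" by simp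
  also have "\<dots> = hright \<beta> (hecke_T (inv (word_prod D bs))) v"
    by (rule hright_cong[OF Cons.prems(2) b(1)]) (rule Cons.IH[OF p])
  also have "\<dots> = hecke_T (inv (word_prod D bs) \<circ> s \<beta>) v"
    using Cons.prems w ii by (intro hright_basis weyl_inv) simp_all
  also have "\<dots> = hecke_T (inv (word_prod D (\<beta> # bs))) v"
    using inv_refl_comp[OF w b(2)] by (simp only: word_prod_Cons)
  finally show ?case .
qed (simp add: inv_id)

lemma hleft_sum:
  "hleft \<alpha> (\<lambda>v. \<Sum>w\<in>A. c w * H w v) u = (\<Sum>w\<in>A. c w * hleft \<alpha> (H w) u)"
  by (simp add: hleft_def sum_distrib_left sum.distrib distrib_left mult_ac)

lemma hleft_words_sum:
  "foldr hleft as (\<lambda>v. \<Sum>w\<in>A. c w * H w v) = (\<lambda>v. \<Sum>w\<in>A. c w * foldr hleft as (H w) v)"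
proof (induction as)
  case (Cons \<alpha> as)
  show ?case by (rule ext) (simp add: Cons.IH hleft_sum)
qed simp

text \<open>Left multiplications commute with right multiplications, so a product of left multiplications
  is determined by its value at the unit.\<close>

lemma hleft_words_eq:
  assumes as: "redw as" and bs: "redw bs" and eq: "word_prod D as = word_prod D bs" and u: "u \<in> weyl D"
  shows "foldr hleft as h u = foldr hleft bs h u"
proof -
  note sa = redw_simple[OF as] and sb = redw_simple[OF bs]
  have T: "foldr hleft as (hecke_T w) u = foldr hleft bs (hecke_T w) u" if w: "w \<in> weyl D" for w
  proof -
    obtain cs where cs: "redw cs" "word_prod D cs = inv w" using ex_redw[OF weyl_inv[OF w]] by blast
    note sc = redw_simple[OF cs(1)]
    have wc: "foldr hright cs (hecke_T id) v = hecke_T w v" if "v \<in> weyl D" for v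
      using hright_word_basis[OF cs(1) that] w by (simp add: cs inv_inv_eq weyl_bij)
    have "foldr hleft xs (hecke_T w) u = foldr hright cs (foldr hleft xs (hecke_T id)) u"
      if x: "set xs \<subseteq> simple D" for xs
    proof -
      have "foldr hleft xs (foldr hright cs (hecke_T id)) u = foldr hleft xs (hecke_T w) u"
        by (rule hleft_words_cong[OF x u]) (rule wc)
      then show ?thesis using hleft_words_hright_words[OF x sc u] by simp
    qed
    moreover have "foldr hright cs (foldr hleft as (hecke_T id)) u = foldr hright cs (foldr hleft bs (hecke_T id)) u"
    proof -
      have "foldr hright ds h u = foldr hright ds h' u"
        if "set ds \<subseteq> simple D" "u \<in> weyl D" "\<And>v. v \<in> weyl D \<Longrightarrow> h v = h' v" for ds h h' u
        using that by (induction ds arbitrary: u) (auto intro: hright_cong)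
      from this[OF sc u] show ?thesis using hleft_word_basis as bs eq by presburger
    qed
    ultimately show ?thesis using sa sb by simp
  qed
  let ?H = "\<lambda>v. \<Sum>w\<in>weyl D. h w * hecke_T w v"
  have H: "h v = ?H v" if "v \<in> weyl D" for v
    using that finite_weyl by (simp add: hecke_T_def if_distrib cong: if_cong)
  have "foldr hleft as h u = foldr hleft as ?H u" by (rule hleft_words_cong[OF sa u H])
  also have "\<dots> = foldr hleft bs ?H u" unfolding hleft_words_sum by (intro sum.cong) (simp_all add: T)
  also have "\<dots> = foldr hleft bs h u" by (rule hleft_words_cong[OF sb u H, symmetric])
  finally show ?thesis .
qed

section \<open>The action on leading terms\<close>

text \<open>The top-degree part of the operator for the trivial character, written on coefficients:
  \<open>ga_coeff_dl_main\<close> is the link to monomials.\<close>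

definition gr_op :: "('y \<Rightarrow> int) \<Rightarrow> ('y \<Rightarrow> complex) \<Rightarrow> 'y \<Rightarrow> complex" where
  "gr_op \<alpha> m \<mu> = (if \<alpha> \<mu> \<le> 0 then of_nat q * m (s \<alpha> \<mu>) else m (s \<alpha> \<mu>) + (of_nat q - 1) * m \<mu>)"

text \<open>On the orbit of an antidominant \<nu> the sign of \<alpha> at u \<nu> is dictated by the
  sign of the root \<open>\<alpha> \<circ> u\<close>, so pulling back along u \<mapsto> u \<nu>
  carries \<open>gr_op\<close> to \<open>hleft\<close>.\<close>

lemma gr_op_orbit:
  assumes anti: "\<forall>\<beta>\<in>pos. \<beta> \<nu> \<le> 0" and a: "\<alpha> \<in> simple D" and u: "u \<in> weyl D"
  shows "gr_op \<alpha> m (u \<nu>) = hleft \<alpha> (\<lambda>v. m (v \<nu>)) u"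
proof (cases "\<alpha> \<circ> u \<in> pos")
  case True
  then show ?thesis using bspec[OF anti True] by (simp add: gr_op_def hleft_def)
next
  case False
  note ar = simple_root[OF a]
  have "(\<lambda>y. - (\<alpha> \<circ> u) y) \<in> pos" using False neg_pos_iff root_comp_weyl u ar by blast
  from bspec[OF anti this] have "0 \<le> \<alpha> (u \<nu>)" by simp
  \<comment> \<open>On a wall the two branches of \<open>gr_op\<close> coincide, since m + (q - 1) m
    = q m; a nontrivial stabiliser of \<nu> therefore does no harm.\<close>
  moreover have "s \<alpha> (u \<nu>) = u \<nu>" if "\<alpha> (u \<nu>) = 0" using that by (simp add: root_refl_def)
  ultimately show ?thesis using False
    by (cases "\<alpha> (u \<nu>) = 0") (simp_all add: gr_op_def hleft_def left_diff_distrib)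
qed

lemma gr_op_words_orbit:
  assumes anti: "\<forall>\<beta>\<in>pos. \<beta> \<nu> \<le> 0"
  shows "set as \<subseteq> simple D \<Longrightarrow> u \<in> weyl D \<Longrightarrow>
    foldr gr_op as m (u \<nu>) = foldr hleft as (\<lambda>v. m (v \<nu>)) u"
proof (induction as arbitrary: u)
  case (Cons \<alpha> as)
  have "foldr gr_op (\<alpha> # as) m (u \<nu>) = hleft \<alpha> (\<lambda>v. foldr gr_op as m (v \<nu>)) u"
    using Cons.prems by (simp add: gr_op_orbit[OF anti])
  also have "\<dots> = foldr hleft (\<alpha> # as) (\<lambda>v. m (v \<nu>)) u"
    using Cons by (auto intro!: hleft_cong)
  finally show ?case .
qed simp

text \<open>A conjugate \<nu> minimising the sum of the positive roots is antidominant, because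
  \<open>s \<alpha>\<close> changes that sum by -2 \<alpha> \<nu>.\<close>

lemma antidominant_conj:
  obtains w \<nu> where "w \<in> weyl D" "\<mu> = w \<nu>" "\<forall>\<beta>\<in>pos. \<beta> \<nu> \<le> 0"
proof -
  define H where "H v = (\<Sum>\<beta>\<in>pos. \<beta> (v \<mu>))" for v :: "'y \<Rightarrow> 'y"
  have "finite (H ` weyl D)" "H ` weyl D \<noteq> {}" using finite_weyl weyl_id by auto
  then have "Min (H ` weyl D) \<in> H ` weyl D" by (rule Min_in)
  then obtain v where v: "v \<in> weyl D" "H v = Min (H ` weyl D)" by auto
  have min: "H v \<le> H u" if "u \<in> weyl D" for u using that v finite_weyl by simp
  define \<nu> where "\<nu> = v \<mu>"
  have simp_le: "\<alpha> \<nu> \<le> 0" if a: "\<alpha> \<in> simple D" for \<alpha>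
  proof -
    have "H (s \<alpha> \<circ> v) = H v - \<alpha> \<nu> + (- \<alpha> \<nu>)"
      using sum_pos_refl[OF a, of "\<lambda>\<beta>. \<beta> \<nu>"] by (simp add: H_def \<nu>_def)
    then show ?thesis using min[OF weyl_refl[OF simple_root[OF a] v(1)]] by simp
  qed
  have "\<beta> \<nu> \<le> 0" if b: "\<beta> \<in> pos" for \<beta>
  proof -
    obtain n where n: "\<And>y. \<beta> y = (\<Sum>\<alpha>\<in>simple D. int (n \<alpha>) * \<alpha> y)"
      using b by (auto simp: pos_roots_def)
    show ?thesis unfolding n by (intro sum_nonpos) (simp add: simp_le mult_nonneg_nonpos)
  qed
  moreover have "\<mu> = inv v \<nu>" using v by (simp add: \<nu>_def weyl_bij bij_is_inj)
  ultimately show ?thesis using that weyl_inv[OF v(1)] by blast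
qed

lemma gr_op_words_eq:
  assumes as: "redw as" and bs: "redw bs" and eq: "word_prod D as = word_prod D bs"
  shows "foldr gr_op as m \<mu> = foldr gr_op bs m \<mu>"
proof -
  obtain w \<nu> where w: "w \<in> weyl D" and \<mu>: "\<mu> = w \<nu>" and anti: "\<forall>\<beta>\<in>pos. \<beta> \<nu> \<le> 0"
    using antidominant_conj[of \<mu>] by blast
  show ?thesis unfolding \<mu>
    using gr_op_words_orbit[OF anti redw_simple[OF as] w] gr_op_words_orbit[OF anti redw_simple[OF bs] w]
      hleft_words_eq[OF as bs eq w] by simp
qed

section \<open>An invariant bilinear form on the lattice\<close>

text \<open>The canonical W-invariant form. It vanishes on central cocharacters but is positive on
  coroots, which suffices for the filtration.\<close>

definition bform :: "'y \<Rightarrow> 'y \<Rightarrow> int" where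
  "bform \<mu> \<nu> = (\<Sum>\<gamma>\<in>roots D. \<gamma> \<mu> * \<gamma> \<nu>)"

lemma bform_add_right: "bform \<mu> (\<nu> + \<nu>') = bform \<mu> \<nu> + bform \<mu> \<nu>'"
  unfolding bform_def sum.distrib[symmetric]
  by (intro sum.cong) (simp_all add: root_add algebra_simps)

lemma bform_commute: "bform \<mu> \<nu> = bform \<nu> \<mu>"
  by (simp add: bform_def mult.commute)

lemma bform_additive: "additive (bform \<mu>)"
  by standard (rule bform_add_right)

lemma bform_refl: "\<alpha> \<in> roots D \<Longrightarrow> bform (s \<alpha> \<mu>) (s \<alpha> \<nu>) = bform \<mu> \<nu>"
proof -
  assume a: "\<alpha> \<in> roots D"
  have inv: "\<beta> \<circ> s \<alpha> \<circ> s \<alpha> = \<beta>" for \<beta> :: "'y \<Rightarrow> int"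
    using refl_comp_refl[OF a] by (simp add: comp_assoc)
  have "(\<Sum>\<gamma>\<in>roots D. (\<gamma> \<circ> s \<alpha>) \<mu> * (\<gamma> \<circ> s \<alpha>) \<nu>) = (\<Sum>\<gamma>\<in>roots D. \<gamma> \<mu> * \<gamma> \<nu>)"
    by (rule sum.reindex_bij_witness[of _ "\<lambda>\<gamma>. \<gamma> \<circ> s \<alpha>" "\<lambda>\<gamma>. \<gamma> \<circ> s \<alpha>"])
      (simp_all only: inv root_comp_refl[OF a])
  then show ?thesis by (simp add: bform_def)
qed

text \<open>Invariance under \<open>s \<alpha>\<close>, which negates its coroot and subtracts
  \<open>\<alpha> \<mu>\<close> times that coroot from \<mu>.\<close>

lemma bform_coroot:
  assumes a: "\<alpha> \<in> roots D"
  shows "2 * bform \<mu> (cr \<alpha>) = \<alpha> \<mu> * bform (cr \<alpha>) (cr \<alpha>)"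
proof -
  have c: "s \<alpha> (cr \<alpha>) = - cr \<alpha>" using a by (simp add: root_refl_def root_coroot zscale_2)
  have "bform \<mu> (cr \<alpha>) = bform (- cr \<alpha>) (s \<alpha> \<mu>)"
    using bform_refl[OF a, of \<mu> "cr \<alpha>"] bform_commute[of "s \<alpha> \<mu>" "- cr \<alpha>"] by (simp add: c)
  also have "\<dots> = - bform (cr \<alpha>) \<mu> + \<alpha> \<mu> * bform (cr \<alpha>) (cr \<alpha>)"
    by (simp add: bform_commute[of "- cr \<alpha>"] root_refl_def additive.minus[OF bform_additive]
        bform_commute[of "\<mu> - _"] additive.diff[OF bform_additive] additive_zscale[OF bform_additive]
        zscale_int bform_commute[of \<mu> "cr \<alpha>"])
  finally show ?thesis using bform_commute[of "cr \<alpha>" \<mu>] by simp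
qed

lemma bform_self_nonneg: "0 \<le> bform \<mu> \<mu>"
  unfolding bform_def by (intro sum_nonneg) simp

lemma bform_coroot_pos: "\<alpha> \<in> roots D \<Longrightarrow> 0 < bform (cr \<alpha>) (cr \<alpha>)"
  unfolding bform_def using finite_roots
  by (intro sum_pos2[of _ \<alpha>]) (simp_all add: root_coroot)

text \<open>Along the string the norm is a quadratic polynomial in k with positive leading
  coefficient, taking equal values at 0 and at \<open>\<alpha> \<mu>\<close>; strictly between them
  it is smaller.\<close>

lemma bform_string:
  assumes a: "\<alpha> \<in> roots D" and k: "0 < k" "k < \<alpha> \<mu>"
  shows "bform (\<mu> - zscale k (cr \<alpha>)) (\<mu> - zscale k (cr \<alpha>)) < bform \<mu> \<mu>"
proof -
  let ?A = "bform (cr \<alpha>) (cr \<alpha>)" and ?b = "bform \<mu> (cr \<alpha>)"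
  have "bform (\<mu> - zscale k (cr \<alpha>)) (\<mu> - zscale k (cr \<alpha>)) = bform \<mu> \<mu> - 2 * k * ?b + k * k * ?A"
    by (simp add: bform_commute[of "\<mu> - _"] additive.diff[OF bform_additive]
        additive_zscale[OF bform_additive] zscale_int bform_commute[of "cr \<alpha>" \<mu>] algebra_simps)
  also have "2 * k * ?b = k * (\<alpha> \<mu> * ?A)" by (simp add: bform_coroot[OF a, symmetric])
  also have "bform \<mu> \<mu> - k * (\<alpha> \<mu> * ?A) + k * k * ?A = bform \<mu> \<mu> - k * (\<alpha> \<mu> - k) * ?A"
    by (simp add: algebra_simps)
  also have "\<dots> < bform \<mu> \<mu>" using k bform_coroot_pos[OF a] by simp
  finally show ?thesis .
qed

lemma simple_sum_coroots:
  assumes a: "\<alpha> \<in> simple D" shows "\<alpha> (\<Sum>\<beta>\<in>pos. cr \<beta>) = 2"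
proof -
  note ar = simple_root[OF a]
  let ?R = "\<Sum>\<beta>\<in>pos. cr \<beta>"
  have "s \<alpha> ?R = (\<Sum>\<beta>\<in>pos. cr (\<beta> \<circ> s \<alpha>))"
    by (simp add: additive.sum[OF refl_additive[OF ar]] coroot_comp_refl ar pos_root)
  also have "\<dots> = ?R - cr \<alpha> + (- cr \<alpha>)"
    using sum_pos_refl[OF a, of cr] by (simp add: coroot_neg ar)
  finally have e: "?R - zscale (\<alpha> ?R) (cr \<alpha>) = ?R - cr \<alpha> + (- cr \<alpha>)" by (simp only: root_refl_def)
  have "zscale (\<alpha> ?R) (cr \<alpha>) = ?R - (?R - zscale (\<alpha> ?R) (cr \<alpha>))" by simp
  also have "\<dots> = zscale 2 (cr \<alpha>)" unfolding e by (simp add: zscale_2)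
  finally have "zscale (\<alpha> ?R - 2) (cr \<alpha>) = 0" by (simp add: zscale_diff_left)
  moreover have "cr \<alpha> \<noteq> 0" using root_coroot[OF ar] root_zero[OF ar] by auto
  ultimately show ?thesis by (simp add: zscale_eq_0_iff)
qed

text \<open>Pairing with the sum R of the positive coroots: a simple root takes the value 2 on R, so
  every positive root is positive on R, and \<open>bform_coroot\<close> transfers this to
  coroots.\<close>

lemma ex_positive_functional:
  "\<exists>\<omega> :: 'y \<Rightarrow> int. additive \<omega> \<and> (\<forall>\<beta>\<in>pos. 0 < \<omega> (cr \<beta>))"
proof (intro exI conjI ballI)
  let ?R = "\<Sum>\<beta>\<in>pos. cr \<beta>"
  show "additive (bform ?R)" by (rule bform_additive)
  fix \<beta> assume b: "\<beta> \<in> pos"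
  note br = pos_root[OF b]
  obtain n where n: "\<And>y. \<beta> y = (\<Sum>\<alpha>\<in>simple D. int (n \<alpha>) * \<alpha> y)"
    using b by (auto simp: pos_roots_def)
  have R: "\<beta> ?R = (\<Sum>\<alpha>\<in>simple D. int (n \<alpha>) * 2)"
    unfolding n by (intro sum.cong refl) (simp add: simple_sum_coroots)
  have "\<exists>\<alpha>\<in>simple D. n \<alpha> \<noteq> 0"
  proof (rule ccontr)
    assume "\<not> ?thesis"
    then have "\<beta> (cr \<beta>) = 0" unfolding n by (intro sum.neutral) auto
    then show False using root_coroot[OF br] by simp
  qed
  then have "0 < \<beta> ?R" unfolding R using finite_simple by (auto intro: sum_pos2)
  then have "0 < 2 * bform ?R (cr \<beta>)"
    unfolding bform_coroot[OF br] using bform_coroot_pos[OF br] by simp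
  then show "0 < bform ?R (cr \<beta>)" by simp
qed

end

section \<open>Demazure--Lusztig operators for the trivial character\<close>

abbreviation gx :: "'a::ab_group_add \<Rightarrow> 'a group_algebra" where
  "gx \<mu> \<equiv> ga_single \<mu> 1"

lemma gx_mult_single: "gx \<mu> * ga_single \<nu> c = ga_single (\<mu> + \<nu>) c"
  by (simp add: ga_single_mult)

lemma of_nat_ga: "(of_nat n :: 'a::ab_group_add group_algebra) = ga_single 0 (of_nat n)"
  by (induction n) (simp_all add: ga_single_add ga_one add.commute)

text \<open>The finite geometric series that arises on dividing a difference of two monomials by 1 -
  \<open>gx (- a)\<close>.\<close>

definition ga_string :: "'a::ab_group_add \<Rightarrow> 'a \<Rightarrow> complex \<Rightarrow> nat \<Rightarrow> 'a group_algebra" where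
  "ga_string \<mu> a c n = (\<Sum>k<n. ga_single (\<mu> - zscale (int k) a) c)"

lemma ga_string_telescope:
  "(1 - gx (- a)) * ga_string \<mu> a c n = ga_single \<mu> c - ga_single (\<mu> - zscale (int n) a) c"
proof (induction n)
  case (Suc n)
  have "(1 - gx (- a)) * ga_single (\<mu> - zscale (int n) a) c =
      ga_single (\<mu> - zscale (int n) a) c - ga_single (\<mu> - zscale (int (Suc n)) a) c"
    by (simp add: left_diff_distrib gx_mult_single zscale_succ add.commute[of 1] diff_diff_eq add.commute[of _ a] minus_diff_commute)
  then show ?case using Suc by (simp add: ga_string_def distrib_left)
qed (simp add: ga_string_def)

abbreviation ga_coeff :: "'a group_algebra \<Rightarrow> 'a \<Rightarrow> complex" where
  "ga_coeff r \<equiv> Poly_Mapping.lookup (ga_coeffs r)"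

lemma ga_coeff_add: "ga_coeff (r + r') \<mu> = ga_coeff r \<mu> + ga_coeff r' \<mu>"
  by (simp add: plus_group_algebra.rep_eq lookup_add)

lemma ga_coeff_diff: "ga_coeff (r - r') \<mu> = ga_coeff r \<mu> - ga_coeff r' \<mu>"
  by (simp add: minus_group_algebra.rep_eq lookup_minus)

lemma ga_coeff_0 [simp]: "ga_coeff 0 \<mu> = 0"
  by (simp add: zero_group_algebra.rep_eq)

lemma ga_coeff_single: "ga_coeff (ga_single \<mu> c) \<nu> = (if \<nu> = \<mu> then c else 0)"
  by (simp add: ga_single.rep_eq lookup_single when_def)

lemma ga_coeff_sum: "ga_coeff (\<Sum>i\<in>A. r i) \<mu> = (\<Sum>i\<in>A. ga_coeff (r i) \<mu>)"
  by (induction A rule: infinite_finite_induct) (simp_all add: ga_coeff_add)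

lemma ga_coeff_of_nat_mult: "ga_coeff (of_nat n * r) \<mu> = of_nat n * ga_coeff r \<mu>"
  by (induction n) (simp_all add: distrib_right ga_coeff_add)

lemma ga_eqI: "(\<And>\<mu>. ga_coeff r \<mu> = ga_coeff r' \<mu>) \<Longrightarrow> r = r'"
  by (metis ga_coeffs_inject poly_mapping_eqI)

context hecke_datum
begin

lemma coroot_nonzero: "\<alpha> \<in> roots D \<Longrightarrow> cr \<alpha> \<noteq> 0"
  using root_coroot root_zero by (metis zero_neq_numeral)

lemma gx_coroot_neq: "\<alpha> \<in> roots D \<Longrightarrow> 1 - gx (- cr \<alpha>) \<noteq> 0"
proof
  assume a: "\<alpha> \<in> roots D" and "1 - gx (- cr \<alpha>) = 0"
  then have "gx (- cr \<alpha>) = (1 :: 'y group_algebra)" by simp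
  then have "ga_coeff (gx (- cr \<alpha>)) 0 = ga_coeff (1 :: 'y group_algebra) 0" by (simp only:)
  then show False using coroot_nonzero[OF a] by (simp add: ga_one ga_coeff_single)
qed

text \<open>Division by 1 - \<open>gx (- cr \<alpha>)\<close> is expressed by clearing the
  denominator. The quotient is unique in an integral domain and exists because it does on monomials,
  where the series telescopes.\<close>

definition dl_rel :: "('y \<Rightarrow> int) \<Rightarrow> 'y group_algebra \<Rightarrow> 'y group_algebra \<Rightarrow> bool" where
  "dl_rel \<alpha> r r' \<longleftrightarrow> (1 - gx (- cr \<alpha>)) * r' =
     (1 - of_nat q * gx (- cr \<alpha>)) * ga_push (s \<alpha>) r + (of_nat q - 1) * r"

definition dl :: "('y \<Rightarrow> int) \<Rightarrow> 'y group_algebra \<Rightarrow> 'y group_algebra" where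
  "dl \<alpha> r = (THE r'. dl_rel \<alpha> r r')"

lemma dl_rel_unique: "\<alpha> \<in> roots D \<Longrightarrow> dl_rel \<alpha> r r' \<Longrightarrow> dl_rel \<alpha> r r'' \<Longrightarrow> r' = r''"
  unfolding dl_rel_def using mult_left_cancel[OF gx_coroot_neq] by metis

lemma dl_eqI: "\<alpha> \<in> roots D \<Longrightarrow> dl_rel \<alpha> r r' \<Longrightarrow> dl \<alpha> r = r'"
  unfolding dl_def using dl_rel_unique by blast

lemma dl_rel_add: "dl_rel \<alpha> r1 r1' \<Longrightarrow> dl_rel \<alpha> r2 r2' \<Longrightarrow> dl_rel \<alpha> (r1 + r2) (r1' + r2')"
  by (simp add: dl_rel_def ga_push_add distrib_left add_ac)

text \<open>The endpoints of the root string, which have the same norm as \<mu>.\<close>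

definition dl_main :: "('y \<Rightarrow> int) \<Rightarrow> 'y \<Rightarrow> complex \<Rightarrow> 'y group_algebra" where
  "dl_main \<alpha> \<mu> c = (if 0 < \<alpha> \<mu> then of_nat q * ga_single (s \<alpha> \<mu>) c + (of_nat q - 1) * ga_single \<mu> c
     else if \<alpha> \<mu> = 0 then of_nat q * ga_single \<mu> c else ga_single (s \<alpha> \<mu>) c)"

text \<open>The interior of the string. Starting one coroot below the upper end and taking
  \<open>\<alpha> \<mu>\<close> - 1 terms (with the sign of \<open>\<alpha> \<mu>\<close> reversed
  in the other case) leaves out both endpoints; on the wall the sum is empty, as \<open>nat\<close>
  sends -1 to 0.\<close>

definition dl_low :: "('y \<Rightarrow> int) \<Rightarrow> 'y \<Rightarrow> complex \<Rightarrow> 'y group_algebra" where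
  "dl_low \<alpha> \<mu> c = (of_nat q - 1) *
     (if 0 < \<alpha> \<mu> then ga_string (\<mu> - cr \<alpha>) (cr \<alpha>) c (nat (\<alpha> \<mu> - 1))
      else - ga_string (s \<alpha> \<mu> - cr \<alpha>) (cr \<alpha>) c (nat (- \<alpha> \<mu> - 1)))"

lemma dl_rel_single:
  assumes a: "\<alpha> \<in> roots D"
  shows "dl_rel \<alpha> (ga_single \<mu> c) (dl_main \<alpha> \<mu> c + dl_low \<alpha> \<mu> c)"
proof -
  let ?Y = "gx (- cr \<alpha>)" and ?S = "ga_single (s \<alpha> \<mu>) c" and ?L = "ga_single \<mu> c" and ?q = "of_nat q :: 'y group_algebra"
  consider (p) "0 < \<alpha> \<mu>" | (z) "\<alpha> \<mu> = 0" | (n) "\<alpha> \<mu> < 0" by linarith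
  then show ?thesis
  proof cases
    case p
    have "\<mu> - cr \<alpha> - zscale (\<alpha> \<mu> - 1) (cr \<alpha>) = s \<alpha> \<mu>"
      by (simp add: root_refl_def zscale_diff_left)
    then have t: "(1 - ?Y) * ga_string (\<mu> - cr \<alpha>) (cr \<alpha>) c (nat (\<alpha> \<mu> - 1)) = ?Y * ?L - ?S"
      using p ga_string_telescope[of "cr \<alpha>" "\<mu> - cr \<alpha>" c "nat (\<alpha> \<mu> - 1)"]
      by (simp add: gx_mult_single)
    have "(1 - ?Y) * (dl_main \<alpha> \<mu> c + dl_low \<alpha> \<mu> c) =
       (1 - ?Y) * (?q * ?S + (?q - 1) * ?L) +
       (?q - 1) * ((1 - ?Y) * ga_string (\<mu> - cr \<alpha>) (cr \<alpha>) c (nat (\<alpha> \<mu> - 1)))"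
      using p by (simp add: dl_main_def dl_low_def distrib_left mult_ac)
    then show ?thesis unfolding t dl_rel_def ga_push_single by (simp add: algebra_simps)
  next
    case z
    have "s \<alpha> \<mu> = \<mu>" using z by (simp add: root_refl_def)
    then show ?thesis using z by (simp add: dl_rel_def dl_main_def dl_low_def ga_string_def algebra_simps)
  next
    case n
    have "s \<alpha> \<mu> - cr \<alpha> - zscale (- \<alpha> \<mu> - 1) (cr \<alpha>) = \<mu>"
      by (simp add: root_refl_def zscale_diff_left zscale_minus_left)
    then have t: "(1 - ?Y) * ga_string (s \<alpha> \<mu> - cr \<alpha>) (cr \<alpha>) c (nat (- \<alpha> \<mu> - 1)) = ?Y * ?S - ?L"
      using n ga_string_telescope[of "cr \<alpha>" "s \<alpha> \<mu> - cr \<alpha>" c "nat (- \<alpha> \<mu> - 1)"]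
      by (simp add: gx_mult_single)
    have "(1 - ?Y) * (dl_main \<alpha> \<mu> c + dl_low \<alpha> \<mu> c) =
       (1 - ?Y) * ?S -
       (?q - 1) * ((1 - ?Y) * ga_string (s \<alpha> \<mu> - cr \<alpha>) (cr \<alpha>) c (nat (- \<alpha> \<mu> - 1)))"
      using n by (simp add: dl_main_def dl_low_def right_diff_distrib[of "1 - ?Y"] mult.left_commute[of "1 - ?Y"])
    then show ?thesis unfolding t dl_rel_def ga_push_single by (simp add: algebra_simps)
  qed
qed

lemma dl_rel: assumes a: "\<alpha> \<in> roots D" shows "dl_rel \<alpha> r (dl \<alpha> r)"
proof -
  have "\<exists>r'. dl_rel \<alpha> r r'"
    by (induction r rule: ga_induct) (use dl_rel_single[OF a] dl_rel_add in blast)+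
  then show ?thesis using dl_eqI[OF a] by auto
qed

lemma dl_single: "\<alpha> \<in> roots D \<Longrightarrow> dl \<alpha> (ga_single \<mu> c) = dl_main \<alpha> \<mu> c + dl_low \<alpha> \<mu> c"
  by (intro dl_eqI dl_rel_single)

lemma dl_add: "\<alpha> \<in> roots D \<Longrightarrow> dl \<alpha> (r + r') = dl \<alpha> r + dl \<alpha> r'"
  by (intro dl_eqI dl_rel_add dl_rel)

lemma dl_0: assumes "\<alpha> \<in> roots D" shows "dl \<alpha> 0 = 0"
proof -
  have "dl \<alpha> 0 + dl \<alpha> 0 = dl \<alpha> 0" using dl_add[OF assms, of 0 0] by (simp only: add_0_left)
  then show ?thesis by (simp only: add_cancel_left_right)
qed

lemma dl_words_0: "set as \<subseteq> simple D \<Longrightarrow> foldr dl as 0 = 0"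
  by (induction as) (simp_all add: dl_0 simple_root)

section \<open>The filtration by norm\<close>

abbreviation "nrm \<mu> \<equiv> bform \<mu> \<mu>"

text \<open>The strict bound makes \<open>fil 0\<close> contain only 0 and gives
  \<open>fil (Suc N)\<close> the top level N, so a lowering operator uses up exactly one
  index.\<close>

definition fil :: "nat \<Rightarrow> 'y group_algebra \<Rightarrow> bool" where
  "fil N r \<longleftrightarrow> (\<forall>\<mu>. ga_coeff r \<mu> \<noteq> 0 \<longrightarrow> nrm \<mu> < int N)"

lemma fil_0: "fil 0 r \<Longrightarrow> r = 0"
  unfolding fil_def using bform_self_nonneg by (intro ga_eqI) (metis ga_coeff_0 of_nat_0 not_le)

lemma ex_fil: "\<exists>N. fil N r"
proof -
  let ?K = "Poly_Mapping.keys (ga_coeffs r)"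
  have "\<forall>\<mu>\<in>?K. nat (nrm \<mu>) < Suc (\<Sum>\<mu>\<in>?K. nat (nrm \<mu>))"
    using member_le_sum[of _ ?K "\<lambda>\<mu>. nat (nrm \<mu>)"] by (simp add: less_Suc_eq_le)
  then have "fil (Suc (\<Sum>\<mu>\<in>?K. nat (nrm \<mu>))) r"
    unfolding fil_def using bform_self_nonneg by (metis in_keys_iff nat_less_iff)
  then show ?thesis ..
qed

lemma nrm_refl: "\<alpha> \<in> roots D \<Longrightarrow> nrm (s \<alpha> \<mu>) = nrm \<mu>"
  by (rule bform_refl)

lemma ga_string_low:
  assumes a: "\<alpha> \<in> roots D" and nz: "ga_coeff (ga_string (\<mu> - cr \<alpha>) (cr \<alpha>) c (nat (\<alpha> \<mu> - 1))) \<nu> \<noteq> 0"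
  shows "nrm \<nu> < nrm \<mu>"
proof -
  obtain k where k: "k < nat (\<alpha> \<mu> - 1)" and
    "ga_coeff (ga_single (\<mu> - cr \<alpha> - zscale (int k) (cr \<alpha>)) c) \<nu> \<noteq> 0"
    using nz unfolding ga_string_def ga_coeff_sum by (meson lessThan_iff sum.not_neutral_contains_not_neutral)
  then have "\<nu> = \<mu> - zscale (int k + 1) (cr \<alpha>)"
    by (simp add: ga_coeff_single zscale_add_left algebra_simps split: if_splits)
  then show ?thesis using bform_string[OF a, of "int k + 1" \<mu>] k by simp
qed

lemma dl_low_low:
  assumes a: "\<alpha> \<in> roots D" and nz: "ga_coeff (dl_low \<alpha> \<mu> c) \<nu> \<noteq> 0"
  shows "nrm \<nu> < nrm \<mu>"
proof -
  have q1: "(of_nat q - 1 :: 'y group_algebra) = of_nat (q - 1)" using q by simp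
  have um: "ga_coeff (- r) \<mu> = - ga_coeff r \<mu>" for r \<mu>
    using ga_coeff_diff[of 0 r \<mu>] by simp
  show ?thesis
  proof (cases "0 < \<alpha> \<mu>")
    case True
    then show ?thesis using nz ga_string_low[OF a] by (auto simp: dl_low_def q1 ga_coeff_of_nat_mult)
  next
    case False
    have "\<alpha> (s \<alpha> \<mu>) = - \<alpha> \<mu>" using comp_refl_self[OF a] by (simp add: fun_eq_iff)
    then show ?thesis using nz False ga_string_low[OF a, of "s \<alpha> \<mu>"]
      by (auto simp: dl_low_def q1 ga_coeff_of_nat_mult um nrm_refl[OF a] simp del: of_nat_diff)
  qed
qed

lemma ga_coeff_dl_main:
  assumes a: "\<alpha> \<in> roots D"
  shows "ga_coeff (dl_main \<alpha> \<mu> c) \<nu> = gr_op \<alpha> (ga_coeff (ga_single \<mu> c)) \<nu>"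
proof -
  have q1: "(of_nat q - 1 :: 'y group_algebra) = of_nat (q - 1)" using q by simp
  have sw: "s \<alpha> \<nu> = \<mu> \<longleftrightarrow> \<nu> = s \<alpha> \<mu>" using refl_refl[OF a] by metis
  have as: "\<alpha> (s \<alpha> \<mu>) = - \<alpha> \<mu>" using comp_refl_self[OF a] by (simp add: fun_eq_iff)
  have sm: "s \<alpha> \<mu> = \<mu> \<longleftrightarrow> \<alpha> \<mu> = 0"
    using as by (auto simp: root_refl_def)
  show ?thesis
    unfolding dl_main_def gr_op_def q1 using q as sm
    by (auto simp: ga_coeff_add ga_coeff_of_nat_mult ga_coeff_single sw simp del: of_nat_diff)
      (auto simp: of_nat_diff)
qed

lemma gr_op_add: "gr_op \<alpha> (\<lambda>x. m x + m' x) \<mu> = gr_op \<alpha> m \<mu> + gr_op \<alpha> m' \<mu>"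
  by (simp add: gr_op_def algebra_simps)

text \<open>On monomials \<open>dl_main\<close> preserves the norm and \<open>dl_low\<close> lowers
  it strictly, so at level N only the former is seen.\<close>

lemma dl_leading:
  assumes a: "\<alpha> \<in> roots D" and r: "fil (Suc N) r"
  shows "fil (Suc N) (dl \<alpha> r) \<and> (\<forall>\<mu>. nrm \<mu> = int N \<longrightarrow> ga_coeff (dl \<alpha> r) \<mu> = gr_op \<alpha> (ga_coeff r) \<mu>)"
proof -
  have "Poly_Mapping.keys (ga_coeffs r) \<subseteq> {\<mu>. nrm \<mu> < int (Suc N)}"
    using r by (auto simp: fil_def in_keys_iff)
  then show ?thesis
  proof (induction r rule: ga_induct_on)
    case zero
    show ?case by (simp add: dl_0[OF a] fil_def gr_op_def)
  next
    case (single \<mu> c)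
    have main: "nrm \<nu> = nrm \<mu>" if "ga_coeff (dl_main \<alpha> \<mu> c) \<nu> \<noteq> 0" for \<nu>
      using that unfolding ga_coeff_dl_main[OF a] gr_op_def
      by (auto simp: ga_coeff_single split: if_splits dest: arg_cong[where f = nrm] simp: nrm_refl[OF a])
    have low: "nrm \<nu> < nrm \<mu>" if "ga_coeff (dl_low \<alpha> \<mu> c) \<nu> \<noteq> 0" for \<nu>
      by (rule dl_low_low[OF a that])
    have "fil (Suc N) (dl \<alpha> (ga_single \<mu> c))"
      unfolding fil_def dl_single[OF a] ga_coeff_add using main low single
      by (smt (verit) add.right_neutral add.left_neutral mem_Collect_eq)
    moreover have "ga_coeff (dl \<alpha> (ga_single \<mu> c)) \<nu> = gr_op \<alpha> (ga_coeff (ga_single \<mu> c)) \<nu>"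
      if "nrm \<nu> = int N" for \<nu>
    proof -
      have "ga_coeff (dl_low \<alpha> \<mu> c) \<nu> = 0" using low[of \<nu>] that single by force
      then show ?thesis by (simp add: dl_single[OF a] ga_coeff_add ga_coeff_dl_main[OF a])
    qed
    ultimately show ?case by blast
  next
    case (add r r')
    have "fil (Suc N) (dl \<alpha> (r + r'))"
      using add unfolding fil_def dl_add[OF a] ga_coeff_add by (metis add.right_neutral)
    moreover have "ga_coeff (r + r') = (\<lambda>x. ga_coeff r x + ga_coeff r' x)"
      by (simp add: fun_eq_iff ga_coeff_add)
    ultimately show ?case
      using add by (simp only: gr_op_add) (simp add: dl_add[OF a] ga_coeff_add)
  qed
qed

lemma gr_op_level_cong:
  assumes "\<alpha> \<in> roots D" "\<And>\<mu>. nrm \<mu> = n \<Longrightarrow> m \<mu> = m' \<mu>" "nrm \<mu> = n"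
  shows "gr_op \<alpha> m \<mu> = gr_op \<alpha> m' \<mu>"
  using assms by (simp add: gr_op_def nrm_refl)

lemma dl_words_leading:
  assumes "set as \<subseteq> simple D" "fil (Suc N) r"
  shows "fil (Suc N) (foldr dl as r) \<and>
    (\<forall>\<mu>. nrm \<mu> = int N \<longrightarrow> ga_coeff (foldr dl as r) \<mu> = foldr gr_op as (ga_coeff r) \<mu>)"
  using assms
proof (induction as)
  case (Cons \<alpha> as)
  then have a: "\<alpha> \<in> roots D" by (simp add: simple_root)
  have IH: "fil (Suc N) (foldr dl as r)"
    "\<And>\<mu>. nrm \<mu> = int N \<Longrightarrow> ga_coeff (foldr dl as r) \<mu> = foldr gr_op as (ga_coeff r) \<mu>"
    using Cons by auto
  have "ga_coeff (dl \<alpha> (foldr dl as r)) \<mu> = gr_op \<alpha> (foldr gr_op as (ga_coeff r)) \<mu>"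
    if m: "nrm \<mu> = int N" for \<mu>
    using dl_leading[OF a IH(1)] gr_op_level_cong[OF a IH(2) m] m by simp
  then show ?case using dl_leading[OF a IH(1)] by simp
qed simp

lemma dl_words_fil: "set as \<subseteq> simple D \<Longrightarrow> fil N r \<Longrightarrow> fil N (foldr dl as r)"
proof (cases N)
  case 0
  assume as: "set as \<subseteq> simple D" and "fil N r"
  then have "r = 0" using fil_0 0 by simp
  then have "foldr dl as r = 0" using dl_words_0[OF as] by simp
  then show ?thesis by (simp add: fil_def)
qed (use dl_words_leading in blast)

lemma fil_diff: "fil N r \<Longrightarrow> fil N r' \<Longrightarrow> fil N (r - r')"
  unfolding fil_def ga_coeff_diff by (metis diff_zero)

text \<open>The level N parts are the graded operators of the two words, and these cancel by
  \<open>gr_op_words_eq\<close>.\<close>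

lemma dl_words_diff_fil:
  assumes as: "redw as" and bs: "redw bs" and eq: "word_prod D as = word_prod D bs" and r: "fil (Suc N) r"
  shows "fil N (foldr dl as r - foldr dl bs r)"
proof -
  note A = dl_words_leading[OF redw_simple[OF as] r] and B = dl_words_leading[OF redw_simple[OF bs] r]
  have z: "ga_coeff (foldr dl as r - foldr dl bs r) \<mu> = 0" if "nrm \<mu> = int N" for \<mu>
    using A B that gr_op_words_eq[OF as bs eq] by (simp add: ga_coeff_diff)
  have f: "fil (Suc N) (foldr dl as r - foldr dl bs r)" using A B by (intro fil_diff) auto
  show ?thesis unfolding fil_def
  proof (intro allI impI)
    fix \<mu> assume nz: "ga_coeff (foldr dl as r - foldr dl bs r) \<mu> \<noteq> 0"
    then have "nrm \<mu> < int (Suc N)" using f unfolding fil_def by blast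
    moreover have "nrm \<mu> \<noteq> int N" using z nz by blast
    ultimately show "nrm \<mu> < int N" by simp
  qed
qed

end

section \<open>Self-adjointness\<close>

text \<open>Evaluation on the orbit of a real character \<open>\<chi>\<close> far inside the positive chamber. There the
  coefficients of the operators are real and those in front of the reflections are positive, so
  that the operators are self-adjoint for a weighted inner product.\<close>

locale hecke_point = hecke_datum D q for D :: "'y::fin_free_ab_group root_datum" and q +
  fixes \<chi> :: "'y \<Rightarrow> real"
  assumes chi_add: "\<chi> (x + y) = \<chi> x * \<chi> y" and chi_pos: "0 < \<chi> x"
    and chi_large: "\<beta> \<in> pos \<Longrightarrow> real q < \<chi> (cr \<beta>)"
begin

text \<open>The index u stands for the orbit point \<open>\<chi> \<circ> u\<close>. Reflecting an
  element by \<open>s \<alpha>\<close> moves u to \<open>u \<circ> s \<alpha>\<close>, and at u the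
  root \<alpha> appears as \<open>\<alpha> \<circ> inv u\<close>.\<close>

definition ev :: "'y group_algebra \<Rightarrow> ('y \<Rightarrow> 'y) \<Rightarrow> complex" where
  "ev r u = ga_ev (of_real \<circ> \<chi> \<circ> u) r"

definition aco :: "('y \<Rightarrow> int) \<Rightarrow> real" where
  "aco \<beta> = (1 - real q * inverse (\<chi> (cr \<beta>))) / (1 - inverse (\<chi> (cr \<beta>)))"

definition bco :: "('y \<Rightarrow> int) \<Rightarrow> real" where
  "bco \<beta> = (real q - 1) / (1 - inverse (\<chi> (cr \<beta>)))"

text \<open>Chosen to make the weight times the reflection coefficient symmetric in u and
  \<open>u \<circ> s \<alpha>\<close>: between these two elements the factors for \<beta> \<noteq>
  \<alpha> are only permuted.\<close>

definition wgt :: "('y \<Rightarrow> 'y) \<Rightarrow> real" where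
  "wgt u = (\<Prod>\<beta>\<in>pos. inverse (aco (\<beta> \<circ> inv u)))"

definition ip :: "'y group_algebra \<Rightarrow> 'y group_algebra \<Rightarrow> complex" where
  "ip r r' = (\<Sum>u\<in>weyl D. of_real (wgt u) * (ev r u * cnj (ev r' u)))"

lemma chi_0: "\<chi> 0 = 1"
  using chi_add[of 0 0] chi_pos[of 0] by simp

lemma chi_minus: "\<chi> (- x) = inverse (\<chi> x)"
  using chi_add[of x "- x"] by (simp add: chi_0 inverse_unique)

lemma chi_coroot_cases:
  assumes "\<beta> \<in> roots D"
  obtains "real q < \<chi> (cr \<beta>)" | "\<chi> (cr \<beta>) < inverse (real q)"
proof (cases "\<beta> \<in> pos")
  case True then show ?thesis using chi_large that by blast
next
  case False
  then have "(\<lambda>y. - \<beta> y) \<in> pos" using assms neg_pos_iff by blast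
  from chi_large[OF this] have "real q < inverse (\<chi> (cr \<beta>))"
    using assms by (simp add: coroot_neg chi_minus)
  then have "\<chi> (cr \<beta>) < inverse (real q)"
    using q chi_pos[of "cr \<beta>"] by (simp add: field_simps)
  then show ?thesis using that by blast
qed

lemma chi_coroot_neq_1: "\<beta> \<in> roots D \<Longrightarrow> \<chi> (cr \<beta>) \<noteq> 1"
proof -
  assume b: "\<beta> \<in> roots D"
  show ?thesis using b
  proof (cases rule: chi_coroot_cases)
    case 1 then show ?thesis using q by simp
  next
    case 2
    moreover have "inverse (real q) < 1" using q by (simp add: field_simps)
    ultimately show ?thesis by simp
  qed
qed

text \<open>Numerator and denominator of (x - q)/(x - 1) are both positive for x > q and both
  negative for x < 1/q; roots of either sign are thus covered.\<close>

lemma aco_pos: "\<beta> \<in> roots D \<Longrightarrow> 0 < aco \<beta>"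
proof -
  assume b: "\<beta> \<in> roots D"
  let ?x = "\<chi> (cr \<beta>)"
  have x: "0 < ?x" by (rule chi_pos)
  have q1: "1 < real q" using q by simp
  have e: "aco \<beta> = (?x - real q) / (?x - 1)"
    using x chi_coroot_neq_1[OF b] by (simp add: aco_def field_simps)
  show ?thesis using b
  proof (cases rule: chi_coroot_cases)
    case 1 then show ?thesis using q1 unfolding e by simp
  next
    case 2
    moreover have "inverse (real q) < 1" using q1 by (simp add: field_simps)
    ultimately show ?thesis using q1 unfolding e by (intro divide_neg_neg) auto
  qed
qed

lemma wgt_pos: "u \<in> weyl D \<Longrightarrow> 0 < wgt u"
  unfolding wgt_def by (intro prod_pos) (simp add: aco_pos root_comp_weyl weyl_inv pos_root)

lemma wgt_refl:
  assumes a: "\<alpha> \<in> simple D" and u: "u \<in> weyl D"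
  shows "wgt (u \<circ> s \<alpha>) * aco (\<alpha> \<circ> inv (u \<circ> s \<alpha>)) = wgt u * aco (\<alpha> \<circ> inv u)"
proof -
  note ar = simple_root[OF a]
  define F where "F \<beta> = inverse (aco (\<beta> \<circ> inv u))" for \<beta>
  have i: "\<beta> \<circ> inv (u \<circ> s \<alpha>) = \<beta> \<circ> s \<alpha> \<circ> inv u" for \<beta> :: "'y \<Rightarrow> int"
    using inv_comp_refl[OF u ar] by (simp only: o_assoc)
  have 1: "wgt u = F \<alpha> * (\<Prod>\<beta>\<in>pos - {\<alpha>}. F \<beta>)"
    unfolding wgt_def F_def by (rule prod.remove[OF finite_pos simple_pos[OF a]])
  have "wgt (u \<circ> s \<alpha>) = (\<Prod>\<beta>\<in>pos. F (\<beta> \<circ> s \<alpha>))"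
    unfolding wgt_def F_def i ..
  also have "\<dots> = F (\<alpha> \<circ> s \<alpha>) * (\<Prod>\<beta>\<in>pos - {\<alpha>}. F (\<beta> \<circ> s \<alpha>))"
    by (rule prod.remove[OF finite_pos simple_pos[OF a]])
  also have "(\<Prod>\<beta>\<in>pos - {\<alpha>}. F (\<beta> \<circ> s \<alpha>)) = (\<Prod>\<beta>\<in>pos - {\<alpha>}. F \<beta>)"
    by (rule prod.reindex_bij_betw[OF bij_pos_minus_simple[OF a]])
  finally have 2: "wgt (u \<circ> s \<alpha>) = F (\<alpha> \<circ> s \<alpha>) * (\<Prod>\<beta>\<in>pos - {\<alpha>}. F \<beta>)" .
  have nz: "aco (\<gamma> \<circ> inv u) \<noteq> 0" if "\<gamma> \<in> roots D" for \<gamma>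
    using aco_pos[OF root_comp_weyl[OF weyl_inv[OF u] that]] by simp
  show ?thesis unfolding 1 2 i F_def using nz[OF ar] nz[OF root_comp_refl[OF ar ar]]
    by (simp add: field_simps)
qed

lemma ev_diff: "ev (r - r') u = ev r u - ev r' u"
  by (simp add: ev_def ga_ev_diff)

lemma ev_dl:
  assumes a: "\<alpha> \<in> simple D" and u: "u \<in> weyl D"
  shows "ev (dl \<alpha> r) u = of_real (aco (\<alpha> \<circ> inv u)) * ev r (u \<circ> s \<alpha>) + of_real (bco (\<alpha> \<circ> inv u)) * ev r u"
proof -
  note ar = simple_root[OF a]
  let ?c = "of_real \<circ> \<chi> \<circ> u :: 'y \<Rightarrow> complex"
  have c: "?c (x + y) = ?c x * ?c y" for x y
    by (simp add: additive.add[OF weyl_additive[OF u]] chi_add)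
  note m = ga_ev_mult[of ?c, OF c]
  have u1: "u (cr \<alpha>) = cr (\<alpha> \<circ> inv u)"
    using coroot_comp_weyl'[OF weyl_inv[OF u] ar] by (simp add: inv_inv_eq weyl_bij[OF u])
  let ?x = "\<chi> (cr (\<alpha> \<circ> inv u))"
  have x1: "?x \<noteq> 1" using u ar by (intro chi_coroot_neq_1 root_comp_weyl weyl_inv)
  have x0: "?x \<noteq> 0" using chi_pos[of "cr (\<alpha> \<circ> inv u)"] by simp
  have Y: "ga_ev ?c (gx (- cr \<alpha>)) = of_real (inverse ?x)"
    by (simp add: additive.minus[OF weyl_additive[OF u]] u1 chi_minus)
  have N: "ga_ev ?c (of_nat n) = of_nat n" for n
    by (simp add: of_nat_ga additive.zero[OF weyl_additive[OF u]] chi_0)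
  have One: "ga_ev ?c 1 = 1" using N[of 1] by simp
  have "?c \<circ> s \<alpha> = of_real \<circ> \<chi> \<circ> (u \<circ> s \<alpha>)" by (simp add: fun_eq_iff)
  then have P: "ga_ev ?c (ga_push (s \<alpha>) r) = ev r (u \<circ> s \<alpha>)"
    by (simp add: ga_ev_push ev_def)
  from arg_cong[OF dl_rel[OF ar, of r, unfolded dl_rel_def], of "ga_ev ?c"]
  have "(1 - of_real (inverse ?x)) * ev (dl \<alpha> r) u =
      (1 - of_nat q * of_real (inverse ?x)) * ev r (u \<circ> s \<alpha>) + (of_nat q - 1) * ev r u"
    by (simp only: m ga_ev_add ga_ev_diff Y N One P) (simp add: ev_def)
  moreover have "(1 - of_real (inverse ?x) :: complex) \<noteq> 0"
    using x1 by (metis inverse_eq_1_iff of_real_1 of_real_eq_iff right_minus_eq)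
  ultimately have "ev (dl \<alpha> r) u =
     ((1 - of_nat q * of_real (inverse ?x)) * ev r (u \<circ> s \<alpha>) + (of_nat q - 1) * ev r u) / (1 - of_real (inverse ?x))"
    by (metis nonzero_mult_div_cancel_left)
  then show ?thesis by (simp add: aco_def bco_def add_divide_distrib)
qed

text \<open>The diagonal coefficient is real, hence self-adjoint. In the reflection part,
  substituting \<open>u \<circ> s \<alpha>\<close> for u moves the reflection to the other argument,
  and \<open>wgt_refl\<close> keeps the coefficient.\<close>

lemma ip_dl:
  assumes a: "\<alpha> \<in> simple D"
  shows "ip (dl \<alpha> r) r' = ip r (dl \<alpha> r')"
proof -
  note ar = simple_root[OF a]
  have ss: "u \<circ> s \<alpha> \<circ> s \<alpha> = u" for u :: "'y \<Rightarrow> 'y" using ar by (simp add: comp_assoc refl_comp_refl)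
  define G where "G u = of_real (wgt u * aco (\<alpha> \<circ> inv u)) * (ev r (u \<circ> s \<alpha>) * cnj (ev r' u))" for u
  define H where "H u = of_real (wgt u * bco (\<alpha> \<circ> inv u)) * (ev r u * cnj (ev r' u))" for u
  have "ip (dl \<alpha> r) r' = (\<Sum>u\<in>weyl D. G u + H u)"
    unfolding ip_def by (intro sum.cong) (simp_all add: ev_dl[OF a] G_def H_def algebra_simps)
  also have "\<dots> = (\<Sum>u\<in>weyl D. G u) + (\<Sum>u\<in>weyl D. H u)" by (rule sum.distrib)
  also have "(\<Sum>u\<in>weyl D. G u) = (\<Sum>u\<in>weyl D. G (u \<circ> s \<alpha>))"
    by (rule sum_weyl_right[OF refl_weyl[OF ar], symmetric])
  also have "\<dots> = (\<Sum>u\<in>weyl D. of_real (wgt u * aco (\<alpha> \<circ> inv u)) * (ev r u * cnj (ev r' (u \<circ> s \<alpha>))))"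
    by (intro sum.cong refl) (simp only: G_def wgt_refl[OF a] ss)
  also have "\<dots> + (\<Sum>u\<in>weyl D. H u) = ip r (dl \<alpha> r')"
    unfolding ip_def sum.distrib[symmetric]
    by (intro sum.cong) (simp_all add: ev_dl[OF a] H_def algebra_simps)
  finally show ?thesis .
qed

lemma ip_dl_words:
  "set as \<subseteq> simple D \<Longrightarrow> ip (foldr dl as r) r' = ip r (foldr dl (rev as) r')"
  by (induction as arbitrary: r') (simp_all add: ip_dl)

lemma ip_diff_left: "ip (r1 - r2) r' = ip r1 r' - ip r2 r'"
  unfolding ip_def sum_subtractf[symmetric]
  by (intro sum.cong) (simp_all add: ev_diff algebra_simps)

lemma ip_diff_right: "ip r (r1 - r2) = ip r r1 - ip r r2"
  unfolding ip_def sum_subtractf[symmetric]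
  by (intro sum.cong) (simp_all add: ev_diff algebra_simps)

lemma ip_self_0: assumes "ip r r = 0" "u \<in> weyl D" shows "ev r u = 0"
proof -
  have "ip r r = of_real (\<Sum>u\<in>weyl D. wgt u * (cmod (ev r u))\<^sup>2)"
    unfolding ip_def of_real_sum by (intro sum.cong refl) (simp add: complex_norm_square[symmetric])
  then have "(\<Sum>u\<in>weyl D. wgt u * (cmod (ev r u))\<^sup>2) = 0" using assms(1) by (metis of_real_eq_0_iff)
  then have "wgt u * (cmod (ev r u))\<^sup>2 = 0"
    using assms(2) finite_weyl wgt_pos by (subst (asm) sum_nonneg_eq_0_iff) (auto intro!: mult_nonneg_nonneg intro: less_imp_le)
  then show ?thesis using wgt_pos[OF assms(2)] by simp
qed

lemma ip_0_left: "(\<And>u. u \<in> weyl D \<Longrightarrow> ev r u = 0) \<Longrightarrow> ip r r' = 0"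
  by (simp add: ip_def)

text \<open>\<open>Y\<close> is self-adjoint and the square of the length of
  \<open>Y (Y^n r)\<close> is the pairing of \<open>Y^(n+2) r\<close> with \<open>Y^n r\<close>.
  Vanishing therefore descends through the powers to \<open>Y r\<close>, and then to
  \<open>X r\<close>. Only values on the orbit are claimed, since the form sees nothing
  else.\<close>

lemma nilpotent_adjoint:
  assumes adj: "\<And>r r'. ip (X r) r' = ip r (X' r')" and adj': "\<And>r r'. ip (X' r) r' = ip r (X r')"
    and Y: "\<And>r. Y r = X' (X r)" and nil: "(Y ^^ Suc n) r = 0" and u: "u \<in> weyl D"
  shows "ev (X r) u = 0"
proof -
  have "\<forall>u\<in>weyl D. ev ((Y ^^ Suc n) r) u = 0" unfolding nil by (simp add: ev_def)
  then have z: "\<forall>u\<in>weyl D. ev (Y r) u = 0"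
  proof (induction n)
    case (Suc n)
    let ?F = "(Y ^^ n) r"
    have "ip (Y ?F) (Y ?F) = ip (Y (Y ?F)) ?F" by (simp add: Y adj adj')
    also have "\<dots> = 0" using Suc.prems by (intro ip_0_left) simp
    finally have "\<forall>u\<in>weyl D. ev ((Y ^^ Suc n) r) u = 0" using ip_self_0 by simp
    then show ?case by (rule Suc.IH)
  qed simp
  have "ip (X r) (X r) = ip (Y r) r" by (simp add: Y adj')
  also have "\<dots> = 0" using z by (intro ip_0_left) simp
  finally show ?thesis using u by (rule ip_self_0)
qed

end

section \<open>Independence of the reduced word\<close>

context hecke_datum
begin

lemma dl_words_eq:
  assumes as: "redw as" and bs: "redw bs" and eq: "word_prod D as = word_prod D bs"
  shows "foldr dl as r = foldr dl bs r"
proof (rule ccontr)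
  note sa = redw_simple[OF as] and sb = redw_simple[OF bs]
  define X where "X r = foldr dl as r - foldr dl bs r" for r
  define X' where "X' r = foldr dl (rev as) r - foldr dl (rev bs) r" for r
  define Y where "Y r = X' (X r)" for r
  assume "foldr dl as r \<noteq> foldr dl bs r"
  then have Xr: "X r \<noteq> 0" by (simp add: X_def)
  obtain \<omega> :: "'y \<Rightarrow> int" where \<omega>: "additive \<omega>" "\<forall>\<beta>\<in>pos. 0 < \<omega> (cr \<beta>)"
    using ex_positive_functional by blast
  have fin: "finite (cr ` pos)" and \<omega>': "\<And>b. b \<in> cr ` pos \<Longrightarrow> 0 < \<omega> b" using finite_pos \<omega>(2) by auto
  \<comment> \<open>The point depends on r: it avoids the zeros of this particular
    \<open>X r\<close>, so vanishing on its orbit is already a contradiction.\<close>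
  obtain \<chi> :: "'y \<Rightarrow> real" where \<chi>: "\<And>x y. \<chi> (x + y) = \<chi> x * \<chi> y" "\<And>x. 0 < \<chi> x"
    "\<And>b. b \<in> cr ` pos \<Longrightarrow> real q < \<chi> b" "ga_ev (of_real \<circ> \<chi>) (X r) \<noteq> 0"
    using ex_character_nonvanishing[OF \<omega>(1) fin \<omega>' Xr, where M = "real q"] by metis
  interpret hecke_point D q \<chi>
    by standard (use \<chi> in auto)
  \<comment> \<open>\<open>X\<close> lowers the filtration. For the adjoint it is enough that
    \<open>X'\<close> preserves it.\<close>
  have "fil N (X r)" if "fil (Suc N) r" for N r
    unfolding X_def using dl_words_diff_fil[OF as bs eq that] .
  moreover have "fil N (X' r)" if "fil N r" for N r
    unfolding X'_def using that sa sb by (intro fil_diff dl_words_fil) simp_all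
  ultimately have Yfil: "fil N (Y r)" if "fil (Suc N) r" for N r using that by (simp add: Y_def)
  have nil: "(Y ^^ N) r = 0" if "fil N r" for N r
    using that
  proof (induction N arbitrary: r)
    case (Suc N)
    then show ?case by (simp only: funpow_Suc_right o_apply) (use Yfil Suc in simp)
  qed (simp add: fil_0)
  have fil_mono: "fil (Suc N) r" if "fil N r" for N r
    using that unfolding fil_def by force
  have adj: "ip (X r) r' = ip r (X' r')" for r r'
    unfolding X_def X'_def ip_diff_left ip_diff_right by (simp add: ip_dl_words sa sb)
  have adj': "ip (X' r) r' = ip r (X r')" for r r'
    unfolding X_def X'_def ip_diff_left ip_diff_right by (simp add: ip_dl_words sa sb)
  \<comment> \<open>One extra power, since \<open>nilpotent_adjoint\<close> starts from a positive
    power of \<open>Y\<close>.\<close>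
  obtain N where "fil N r" using ex_fil by blast
  then have "(Y ^^ Suc N) r = 0" by (intro nil fil_mono)
  from nilpotent_adjoint[of X X' Y, OF adj adj' Y_def this weyl_id] \<chi>(4) show False
    by (simp add: ev_def)
qed

end

section \<open>Operators on the fraction field\<close>

lemma of_ga_of_nat [simp]: "of_ga (of_nat n) = of_nat n"
  by (induction n) (simp_all add: of_ga_add)

lemma of_ga_prod: "of_ga (\<Prod>i\<in>A. r i) = (\<Prod>i\<in>A. of_ga (r i))"
  by (induction A rule: infinite_finite_induct) (simp_all add: of_ga_mult)

context weyl_datum
begin

abbreviation act :: "('y \<Rightarrow> 'y) \<Rightarrow> 'y Frac_alg \<Rightarrow> 'y Frac_alg" where
  "act \<equiv> frac_push"

lemma weyl_emb: "w \<in> weyl D \<Longrightarrow> lattice_emb w"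
  by standard (auto simp: additive.add[OF weyl_additive] dest: weyl_bij bij_is_inj)

lemma refl_emb: "\<alpha> \<in> roots D \<Longrightarrow> lattice_emb (s \<alpha>)"
  by (rule weyl_emb[OF refl_weyl])

lemma act_comp: "v \<in> weyl D \<Longrightarrow> w \<in> weyl D \<Longrightarrow> act v (act w x) = act (v \<circ> w) x"
  by (rule lattice_emb.push_comp[OF weyl_emb weyl_emb])

lemma act_expo: "w \<in> weyl D \<Longrightarrow> act w (\<pi>\<^bsup>\<mu>\<^esup>) = \<pi>\<^bsup>w \<mu>\<^esup>"
  by (rule lattice_emb.push_expo[OF weyl_emb])

lemma refl_comp_cancel: "\<alpha> \<in> roots D \<Longrightarrow> s \<alpha> \<circ> (s \<alpha> \<circ> w) = w"
  by (simp add: o_assoc refl_comp_refl)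

lemma comp_refl_cancel: "\<alpha> \<in> roots D \<Longrightarrow> \<beta> \<circ> s \<alpha> \<circ> s \<alpha> = \<beta>"
  by (simp add: comp_assoc refl_comp_refl)

lemma len_le_Suc_refl: "\<alpha> \<in> simple D \<Longrightarrow> w \<in> weyl D \<Longrightarrow> len w \<le> Suc (len (s \<alpha> \<circ> w))"
  using len_refl_neg[of \<alpha> w] len_refl_pos[of \<alpha> w] by (cases "\<alpha> \<circ> w \<in> pos") simp_all

end

context hecke_datum
begin

definition cA :: "('y \<Rightarrow> int) \<Rightarrow> 'y Frac_alg" where
  "cA \<beta> = (1 - of_nat q * \<pi>\<^bsup>- cr \<beta>\<^esup>) / (1 - \<pi>\<^bsup>- cr \<beta>\<^esup>)"

definition cB :: "('y \<Rightarrow> int) \<Rightarrow> 'y Frac_alg" where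
  "cB \<beta> = (of_nat q - 1) / (1 - \<pi>\<^bsup>- cr \<beta>\<^esup>)"

definition tq :: "('y \<Rightarrow> int) \<Rightarrow> 'y Frac_alg \<Rightarrow> 'y Frac_alg" where
  "tq \<alpha> f = cA \<alpha> * act (s \<alpha>) f + cB \<alpha> * f"

lemma expo_coroot_neq_1: "\<beta> \<in> roots D \<Longrightarrow> 1 - \<pi>\<^bsup>- cr \<beta>\<^esup> \<noteq> 0" "\<beta> \<in> roots D \<Longrightarrow> 1 - \<pi>\<^bsup>cr \<beta>\<^esup> \<noteq> 0"
  using coroot_nonzero by auto

lemma cA_nonzero: "\<beta> \<in> roots D \<Longrightarrow> cA \<beta> \<noteq> 0"
  using expo_coroot_neq_1(1) of_nat_q_expo_neq_1[OF q] by (simp add: cA_def)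

lemma tq_of_ga: assumes a: "\<alpha> \<in> roots D" shows "tq \<alpha> (of_ga r) = of_ga (dl \<alpha> r)"
proof -
  have "(1 - \<pi>\<^bsup>- cr \<alpha>\<^esup>) * of_ga (dl \<alpha> r) =
      (1 - of_nat q * \<pi>\<^bsup>- cr \<alpha>\<^esup>) * act (s \<alpha>) (of_ga r) + (of_nat q - 1) * of_ga r"
    using arg_cong[OF dl_rel[OF a, of r, unfolded dl_rel_def], of of_ga]
    by (simp add: of_ga_mult of_ga_add of_ga_diff expo_of_ga lattice_emb.push_of_ga[OF refl_emb[OF a]])
  then have "of_ga (dl \<alpha> r) =
      ((1 - of_nat q * \<pi>\<^bsup>- cr \<alpha>\<^esup>) * act (s \<alpha>) (of_ga r) + (of_nat q - 1) * of_ga r) / (1 - \<pi>\<^bsup>- cr \<alpha>\<^esup>)"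
    using expo_coroot_neq_1(1)[OF a] by (metis nonzero_mult_div_cancel_left)
  then show ?thesis by (simp add: tq_def cA_def cB_def add_divide_distrib)
qed

lemma tq_words_of_ga: "set as \<subseteq> simple D \<Longrightarrow> foldr tq as (of_ga r) = of_ga (foldr dl as r)"
  by (induction as) (simp_all add: tq_of_ga simple_root)

lemma tq_add: "\<alpha> \<in> roots D \<Longrightarrow> tq \<alpha> (f + g) = tq \<alpha> f + tq \<alpha> g"
  by (simp add: tq_def lattice_emb.push_add[OF refl_emb] algebra_simps)

lemma tq_0: "\<alpha> \<in> roots D \<Longrightarrow> tq \<alpha> 0 = 0"
  by (simp add: tq_def lattice_emb.push_0[OF refl_emb])

lemma tq_sum: "\<alpha> \<in> roots D \<Longrightarrow> tq \<alpha> (\<Sum>i\<in>I. f i) = (\<Sum>i\<in>I. tq \<alpha> (f i))"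
  by (induction I rule: infinite_finite_induct) (simp_all add: tq_add tq_0)

lemma tq_words_invariant_mult:
  assumes "\<forall>\<alpha>\<in>simple D. act (s \<alpha>) g = g"
  shows "set as \<subseteq> simple D \<Longrightarrow> foldr tq as (g * f) = g * foldr tq as f"
  by (induction as)
    (simp_all add: tq_def lattice_emb.push_mult[OF refl_emb] simple_root assms algebra_simps)

text \<open>The product of all W-conjugates of a denominator is invariant and divisible by it. As
  the operators commute with invariant factors, identities on the group algebra extend to all
  fractions.\<close>

lemma invariant_denominator:
  obtains g r where "g \<noteq> 0" "\<forall>\<alpha>\<in>simple D. act (s \<alpha>) g = g" "g * f = of_ga r"
proof -
  obtain a b where f: "f = of_ga a / of_ga b" and b: "b \<noteq> 0" by (rule of_ga_cases)
  define g where "g = (\<Prod>w\<in>weyl D. act w (of_ga b))"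
  have ab: "act w (of_ga b) = of_ga (ga_push w b)" if "w \<in> weyl D" for w
    by (rule lattice_emb.push_of_ga[OF weyl_emb[OF that]])
  have nz: "act w (of_ga b) \<noteq> 0" if "w \<in> weyl D" for w
    using b by (simp add: ab that lattice_emb.push_ga_eq_0[OF weyl_emb[OF that]])
  have "act (s \<alpha>) g = g" if "\<alpha> \<in> simple D" for \<alpha>
  proof -
    note ar = simple_root[OF that]
    have "act (s \<alpha>) g = (\<Prod>w\<in>weyl D. act (s \<alpha> \<circ> w) (of_ga b))"
      unfolding g_def lattice_emb.push_prod[OF refl_emb[OF ar]]
      by (intro prod.cong refl) (simp add: act_comp refl_weyl[OF ar])
    also have "\<dots> = g" unfolding g_def
      by (rule prod.reindex_bij_witness[of _ "\<lambda>w. s \<alpha> \<circ> w" "\<lambda>w. s \<alpha> \<circ> w"])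
        (simp_all only: refl_comp_cancel[OF ar] weyl_refl[OF ar])
    finally show ?thesis .
  qed
  moreover have "g \<noteq> 0" unfolding g_def using finite_weyl nz by simp
  moreover have "g * f = of_ga (a * (\<Prod>w\<in>weyl D - {id}. ga_push w b))"
  proof -
    have "g = of_ga b * (\<Prod>w\<in>weyl D - {id}. act w (of_ga b))"
      unfolding g_def by (subst prod.remove[OF finite_weyl weyl_id]) (simp add: frac_push_id)
    also have "(\<Prod>w\<in>weyl D - {id}. act w (of_ga b)) = of_ga (\<Prod>w\<in>weyl D - {id}. ga_push w b)"
      unfolding of_ga_prod by (intro prod.cong) (simp_all add: ab)
    finally show ?thesis using b by (simp add: f of_ga_mult)
  qed
  ultimately show ?thesis using that by blast
qed

lemma tq_words_eq:
  assumes as: "redw as" and bs: "redw bs" and eq: "word_prod D as = word_prod D bs"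
  shows "foldr tq as f = foldr tq bs f"
proof -
  obtain g r where g: "g \<noteq> 0" "\<forall>\<alpha>\<in>simple D. act (s \<alpha>) g = g" "g * f = of_ga r"
    using invariant_denominator[of f] .
  have "g * foldr tq as f = g * foldr tq bs f"
    using tq_words_invariant_mult[OF g(2) redw_simple[OF as], of f] tq_words_invariant_mult[OF g(2) redw_simple[OF bs], of f]
      tq_words_of_ga[OF redw_simple[OF as], of r] tq_words_of_ga[OF redw_simple[OF bs], of r]
      dl_words_eq[OF as bs eq, of r] g(3) by metis
  then show ?thesis using g(1) by simp
qed

section \<open>Operators indexed by W and their sum\<close>

definition rw :: "('y \<Rightarrow> 'y) \<Rightarrow> ('y \<Rightarrow> int) list" where
  "rw w = (SOME as. redw as \<and> word_prod D as = w)"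

lemma rw: assumes "w \<in> weyl D" shows "redw (rw w)" "word_prod D (rw w) = w"
proof -
  obtain as where "redw as" "word_prod D as = w" using ex_redw[OF assms] by blast
  then have "redw as \<and> word_prod D as = w" ..
  from someI[of "\<lambda>as. redw as \<and> word_prod D as = w", OF this]
  show "redw (rw w)" "word_prod D (rw w) = w" unfolding rw_def by auto
qed

definition tw :: "('y \<Rightarrow> 'y) \<Rightarrow> 'y Frac_alg \<Rightarrow> 'y Frac_alg" where
  "tw w = foldr tq (rw w)"

lemma tw_word: assumes "redw as" shows "foldr tq as f = tw (word_prod D as) f"
proof -
  have w: "word_prod D as \<in> weyl D" using assms by (intro weyl_word redw_simple)
  show ?thesis unfolding tw_def by (rule tq_words_eq) (simp_all add: assms rw[OF w])
qed

lemma tw_refl: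
  assumes a: "\<alpha> \<in> simple D" and w: "w \<in> weyl D" and p: "\<alpha> \<circ> w \<in> pos"
  shows "tw (s \<alpha> \<circ> w) f = tq \<alpha> (tw w f)"
proof -
  have "redw (\<alpha> # rw w)" using a p rw[OF w] by simp
  from tw_word[OF this, of f] show ?thesis by (simp add: rw[OF w] tw_def)
qed

lemma act_refl_coroot: "\<alpha> \<in> roots D \<Longrightarrow> act (s \<alpha>) (\<pi>\<^bsup>- cr \<alpha>\<^esup>) = inverse (\<pi>\<^bsup>- cr \<alpha>\<^esup>)"
proof -
  assume a: "\<alpha> \<in> roots D"
  have "s \<alpha> (- cr \<alpha>) = cr \<alpha>" using a
    by (simp add: root_refl_def root_minus root_coroot zscale_2 zscale_minus_left)
  then show ?thesis by (simp only: act_expo[OF refl_weyl[OF a]]) (simp add: expo_minus)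
qed

text \<open>The relation (T - q)(T + 1) = 0 in the form that \<open>tq_tsum\<close> consumes. With A
  and B for \<open>cA \<alpha>\<close> and \<open>cB \<alpha>\<close>, it reduces to s(B) + B = q -
  1 and A s(A) + B B = q + (q - 1) B.\<close>

lemma tq_quadratic:
  assumes a: "\<alpha> \<in> roots D"
  shows "tq \<alpha> (f + tq \<alpha> f) = of_nat q * (f + tq \<alpha> f)"
proof -
  interpret e: lattice_emb "s \<alpha>" by (rule refl_emb[OF a])
  define y where "y = (\<pi>\<^bsup>- cr \<alpha>\<^esup> :: 'y Frac_alg)"
  define c where "c = (of_nat q :: 'y Frac_alg)"
  have y: "y \<noteq> 0" "1 - y \<noteq> 0" using expo_coroot_neq_1(1)[OF a] by (simp_all add: y_def)
  then have y': "y - 1 \<noteq> 0" by auto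
  have sy: "act (s \<alpha>) y = inverse y" unfolding y_def by (rule act_refl_coroot[OF a])
  have A: "cA \<alpha> = (1 - c * y) / (1 - y)" and B: "cB \<alpha> = (c - 1) / (1 - y)"
    by (simp_all add: cA_def cB_def y_def c_def)
  have sA: "act (s \<alpha>) (cA \<alpha>) = (y - c) / (y - 1)" and sB: "act (s \<alpha>) (cB \<alpha>) = (c - 1) * y / (y - 1)"
    using y y' unfolding A B
    by (simp_all add: e.push_divide e.push_diff e.push_mult sy c_def field_simps)
  have ss: "act (s \<alpha>) (act (s \<alpha>) f) = f"
    by (simp add: act_comp refl_weyl[OF a] refl_comp_refl[OF a] frac_push_id)
  have BB: "(c - 1) * y / (y - 1) + (c - 1) / (1 - y) = c - 1"
  proof -
    have "(c - 1) / (1 - y) = - ((c - 1) / (y - 1))" by (simp add: minus_divide_right)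
    then have "(c - 1) * y / (y - 1) + (c - 1) / (1 - y) = ((c - 1) * y - (c - 1)) / (y - 1)"
      by (simp add: diff_divide_distrib)
    also have "(c - 1) * y - (c - 1) = (c - 1) * (y - 1)" by (simp add: algebra_simps)
    finally show ?thesis using y' by simp
  qed
  have AA: "(1 - c * y) / (1 - y) * ((y - c) / (y - 1)) + (c - 1) / (1 - y) * ((c - 1) / (1 - y))
      = c + (c - 1) * ((c - 1) / (1 - y))"
  proof -
    have "(y - c) / (y - 1) = (c - y) / (1 - y)"
      using minus_divide_divide[of "c - y" "1 - y"] by simp
    then have "(1 - c * y) / (1 - y) * ((y - c) / (y - 1)) + (c - 1) / (1 - y) * ((c - 1) / (1 - y))
        = ((1 - c * y) * (c - y) + (c - 1) * (c - 1)) / ((1 - y) * (1 - y))"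
      by (simp only: times_divide_times_eq add_divide_distrib)
    also have "(1 - c * y) * (c - y) + (c - 1) * (c - 1) = (c * (1 - y) + (c - 1) * (c - 1)) * (1 - y)"
      by (simp add: algebra_simps)
    also have "\<dots> / ((1 - y) * (1 - y)) = (c * (1 - y) + (c - 1) * (c - 1)) / (1 - y)"
      by (rule nonzero_mult_divide_mult_cancel_right[OF y(2)])
    also have "\<dots> = c + (c - 1) * ((c - 1) / (1 - y))"
      using y(2) by (simp add: add_divide_distrib)
    finally show ?thesis .
  qed
  have "tq \<alpha> (tq \<alpha> f) = cA \<alpha> * (act (s \<alpha>) (cA \<alpha>) * f + act (s \<alpha>) (cB \<alpha>) * act (s \<alpha>) f)
      + cB \<alpha> * (cA \<alpha> * act (s \<alpha>) f + cB \<alpha> * f)"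
    by (simp add: tq_def e.push_add e.push_mult ss)
  also have "\<dots> = (cA \<alpha> * act (s \<alpha>) (cA \<alpha>) + cB \<alpha> * cB \<alpha>) * f
      + cA \<alpha> * (act (s \<alpha>) (cB \<alpha>) + cB \<alpha>) * act (s \<alpha>) f" by (simp add: algebra_simps)
  also have "\<dots> = (c + (c - 1) * cB \<alpha>) * f + cA \<alpha> * (c - 1) * act (s \<alpha>) f"
    unfolding sA sB by (simp only: A B AA BB)
  also have "\<dots> = c * f + (c - 1) * tq \<alpha> f" by (simp add: tq_def algebra_simps)
  finally have "tq \<alpha> (tq \<alpha> f) = c * f + (c - 1) * tq \<alpha> f" .
  then show ?thesis by (simp add: tq_add[OF a] c_def algebra_simps)
qed

definition tsum :: "'y Frac_alg \<Rightarrow> 'y Frac_alg" where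
  "tsum f = (\<Sum>w\<in>weyl D. tw w f)"

text \<open>Pairing w with \<open>s \<alpha> \<circ> w\<close> writes the sum as a sum of values of
  1 + T, on which T acts by q.\<close>

lemma tq_tsum:
  assumes a: "\<alpha> \<in> simple D" shows "tq \<alpha> (tsum f) = of_nat q * tsum f"
proof -
  note ar = simple_root[OF a]
  let ?P = "{w \<in> weyl D. \<alpha> \<circ> w \<in> pos}"
  have "tsum f = (\<Sum>w\<in>?P. tw w f) + (\<Sum>w\<in>weyl D - ?P. tw w f)"
    unfolding tsum_def using finite_weyl by (subst sum.subset_diff[of ?P]) (auto simp: add.commute)
  also have "(\<Sum>w\<in>weyl D - ?P. tw w f) = (\<Sum>w\<in>?P. tw (s \<alpha> \<circ> w) f)"
  proof (rule sum.reindex_bij_witness[of _ "\<lambda>w. s \<alpha> \<circ> w" "\<lambda>w. s \<alpha> \<circ> w"])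
    fix w assume "w \<in> weyl D - ?P"
    then have w: "w \<in> weyl D" "\<alpha> \<circ> w \<notin> pos" by auto
    then show "s \<alpha> \<circ> w \<in> ?P" using comp_refl_pos_iff[OF ar w(1)] weyl_refl[OF ar w(1)] by blast
    show "s \<alpha> \<circ> (s \<alpha> \<circ> w) = w" by (rule refl_comp_cancel[OF ar])
    show "tw (s \<alpha> \<circ> (s \<alpha> \<circ> w)) f = tw w f" by (simp only: refl_comp_cancel[OF ar])
  next
    fix w assume "w \<in> ?P"
    then have w: "w \<in> weyl D" "\<alpha> \<circ> w \<in> pos" by auto
    then show "s \<alpha> \<circ> w \<in> weyl D - ?P" using comp_refl_pos_iff[OF ar w(1)] weyl_refl[OF ar w(1)] by blast
    show "s \<alpha> \<circ> (s \<alpha> \<circ> w) = w" by (rule refl_comp_cancel[OF ar])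
  qed
  also have "\<dots> = (\<Sum>w\<in>?P. tq \<alpha> (tw w f))" by (intro sum.cong) (simp_all add: tw_refl[OF a])
  finally have e: "tsum f = (\<Sum>w\<in>?P. tw w f + tq \<alpha> (tw w f))" by (simp only: sum.distrib)
  show ?thesis unfolding e tq_sum[OF ar] tq_quadratic[OF ar] by (simp only: sum_distrib_left)
qed

text \<open>Since q - \<open>cB \<alpha>\<close> = \<open>cA \<alpha>\<close>, the operator T - q is
  \<open>cA \<alpha>\<close> times s - 1, and \<open>cA \<alpha>\<close> is invertible.\<close>

lemma act_tsum:
  assumes a: "\<alpha> \<in> simple D" shows "act (s \<alpha>) (tsum f) = tsum f"
proof -
  note ar = simple_root[OF a]
  note nz = expo_coroot_neq_1(1)[OF ar]
  have "of_nat q - cB \<alpha> = cA \<alpha>" using nz by (simp add: cA_def cB_def field_simps)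
  then have "cA \<alpha> * act (s \<alpha>) (tsum f) = cA \<alpha> * tsum f"
    using tq_tsum[OF a, of f] unfolding tq_def by (metis add_diff_cancel_right' left_diff_distrib)
  then show ?thesis using cA_nonzero[OF ar] by simp
qed

section \<open>Expansion in the Weyl group\<close>

text \<open>Coefficients in the twisted group algebra of W over the fraction field: a reflection
  moved past a coefficient acts on it.\<close>

fun cf :: "('y \<Rightarrow> int) list \<Rightarrow> ('y \<Rightarrow> 'y) \<Rightarrow> 'y Frac_alg" where
  "cf [] u = (if u = id then 1 else 0)"
| "cf (\<alpha> # as) u = cA \<alpha> * act (s \<alpha>) (cf as (s \<alpha> \<circ> u)) + cB \<alpha> * cf as u"

lemma tq_words_expansion:
  "set as \<subseteq> simple D \<Longrightarrow> foldr tq as f = (\<Sum>u\<in>weyl D. cf as u * act u f)"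
proof (induction as)
  case Nil
  have "(\<Sum>u\<in>weyl D. cf [] u * act u f) = (\<Sum>u\<in>weyl D. if u = id then act u f else 0)"
    by (intro sum.cong) simp_all
  also have "\<dots> = f" using finite_weyl weyl_id[of D] by (simp add: frac_push_id)
  finally show ?case by simp
next
  case (Cons \<alpha> as)
  then have a: "\<alpha> \<in> roots D" by (simp add: simple_root)
  interpret e: lattice_emb "s \<alpha>" by (rule refl_emb[OF a])
  define F where "F u = cA \<alpha> * act (s \<alpha>) (cf as (s \<alpha> \<circ> u)) * act u f" for u
  have "foldr tq (\<alpha> # as) f = tq \<alpha> (\<Sum>u\<in>weyl D. cf as u * act u f)" using Cons by simp
  also have "\<dots> = (\<Sum>u\<in>weyl D. tq \<alpha> (cf as u * act u f))" by (rule tq_sum[OF a])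
  also have "\<dots> = (\<Sum>u\<in>weyl D. F (s \<alpha> \<circ> u) + cB \<alpha> * cf as u * act u f)"
    by (intro sum.cong refl)
      (simp add: tq_def F_def refl_comp_cancel[OF a] e.push_mult act_comp refl_weyl[OF a] mult.assoc)
  also have "\<dots> = (\<Sum>u\<in>weyl D. F u + cB \<alpha> * cf as u * act u f)"
    by (simp only: sum.distrib sum_weyl_left[OF refl_weyl[OF a]])
  also have "\<dots> = (\<Sum>u\<in>weyl D. cf (\<alpha> # as) u * act u f)"
    by (simp add: F_def distrib_right)
  finally show ?case .
qed

text \<open>A letter changes the length of the group element by at most one, so a word cannot reach
  anything longer than itself.\<close>

lemma cf_support:
  "set as \<subseteq> simple D \<Longrightarrow> u \<in> weyl D \<Longrightarrow> length as < len u \<Longrightarrow> cf as u = 0"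
proof (induction as arbitrary: u)
  case (Cons \<alpha> as)
  then have a: "\<alpha> \<in> simple D" "\<alpha> \<in> roots D" by (simp_all add: simple_root)
  have l: "length as < len (s \<alpha> \<circ> u)" using len_le_Suc_refl[OF a(1) Cons.prems(2)] Cons.prems(3) by simp
  have "cf as (s \<alpha> \<circ> u) = 0"
    by (rule Cons.IH[OF _ weyl_refl[OF a(2) Cons.prems(2)] l]) (use Cons.prems in simp)
  moreover have "cf as u = 0" using Cons.IH[OF _ Cons.prems(2)] Cons.prems by simp
  ultimately show ?case by (simp add: lattice_emb.push_0[OF refl_emb[OF a(2)]])
qed auto

lemma act_cA: "w \<in> weyl D \<Longrightarrow> \<beta> \<in> roots D \<Longrightarrow> act w (cA (\<beta> \<circ> w)) = cA \<beta>"
proof -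
  assume w: "w \<in> weyl D" and b: "\<beta> \<in> roots D"
  interpret e: lattice_emb w by (rule weyl_emb[OF w])
  have "w (- cr (\<beta> \<circ> w)) = - cr \<beta>"
    by (simp only: additive.minus[OF weyl_additive[OF w]] coroot_comp_weyl[OF w b])
  then show ?thesis unfolding cA_def
    by (simp only: e.push_divide e.push_diff e.push_mult e.push_1 e.push_of_nat e.push_expo)
qed

lemma act_refl_cA: "\<alpha> \<in> roots D \<Longrightarrow> \<beta> \<in> roots D \<Longrightarrow> act (s \<alpha>) (cA \<beta>) = cA (\<beta> \<circ> s \<alpha>)"
  using act_cA[OF refl_weyl[of \<alpha>] root_comp_refl[of \<alpha> \<beta>]] by (simp only: comp_refl_cancel)

text \<open>Since \<open>\<beta> \<circ> w\<close> is the image of \<beta> under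
  \<open>inv w\<close>, these are the inversions of \<open>inv w\<close>.\<close>

definition invs :: "('y \<Rightarrow> 'y) \<Rightarrow> ('y \<Rightarrow> int) set" where
  "invs w = {\<beta> \<in> pos. \<beta> \<circ> w \<notin> pos}"

lemma finite_invs: "finite (invs w)"
  unfolding invs_def using finite_pos by simp

lemma invs_refl:
  assumes a: "\<alpha> \<in> simple D" and v: "v \<in> weyl D" and p: "\<alpha> \<circ> v \<in> pos"
  shows "invs (s \<alpha> \<circ> v) = insert \<alpha> ((\<lambda>\<beta>. \<beta> \<circ> s \<alpha>) ` invs v)" "\<alpha> \<notin> (\<lambda>\<beta>. \<beta> \<circ> s \<alpha>) ` invs v"
proof -
  note ar = simple_root[OF a]
  have c: "\<beta> \<circ> s \<alpha> \<circ> (s \<alpha> \<circ> v) = \<beta> \<circ> v" for \<beta> :: "'y \<Rightarrow> int"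
    by (simp only: comp_assoc refl_comp_cancel[OF ar])
  have c': "\<beta> \<circ> (s \<alpha> \<circ> v) = \<beta> \<circ> s \<alpha> \<circ> v" for \<beta> :: "'y \<Rightarrow> int" by (rule o_assoc)
  have in1: "\<gamma> \<circ> s \<alpha> \<in> pos \<and> \<gamma> \<circ> s \<alpha> \<noteq> \<alpha>" if "\<gamma> \<in> invs v" for \<gamma>
  proof -
    have g: "\<gamma> \<in> pos" "\<gamma> \<noteq> \<alpha>" using that p by (auto simp: invs_def)
    moreover have "\<gamma> \<circ> s \<alpha> \<noteq> \<alpha>"
    proof
      assume "\<gamma> \<circ> s \<alpha> = \<alpha>"
      then have "\<gamma> = \<alpha> \<circ> s \<alpha>" using comp_refl_cancel[OF ar, of \<gamma>] by simp
      then show False using g comp_refl_self[OF ar] not_pos_and_neg[OF simple_pos[OF a]] by simp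
    qed
    ultimately show ?thesis using simple_perm[OF a] by blast
  qed
  show "\<alpha> \<notin> (\<lambda>\<beta>. \<beta> \<circ> s \<alpha>) ` invs v"
  proof
    assume "\<alpha> \<in> (\<lambda>\<beta>. \<beta> \<circ> s \<alpha>) ` invs v"
    then obtain \<gamma> where "\<alpha> = \<gamma> \<circ> s \<alpha>" "\<gamma> \<in> invs v" by (rule imageE)
    then show False using in1[of \<gamma>] by metis
  qed
  show "invs (s \<alpha> \<circ> v) = insert \<alpha> ((\<lambda>\<beta>. \<beta> \<circ> s \<alpha>) ` invs v)"
  proof (intro equalityI subsetI)
    fix \<beta> assume b: "\<beta> \<in> invs (s \<alpha> \<circ> v)"
    show "\<beta> \<in> insert \<alpha> ((\<lambda>\<beta>. \<beta> \<circ> s \<alpha>) ` invs v)"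
    proof (cases "\<beta> = \<alpha>")
      case False
      have "\<beta> \<circ> s \<alpha> \<in> invs v"
        using b False simple_perm[OF a] unfolding invs_def mem_Collect_eq c' by blast
      then have "\<beta> \<circ> s \<alpha> \<circ> s \<alpha> \<in> (\<lambda>\<beta>. \<beta> \<circ> s \<alpha>) ` invs v" by (rule imageI)
      then show ?thesis by (simp only: comp_refl_cancel[OF ar] insert_iff simp_thms)
    qed simp
  next
    fix \<beta> assume "\<beta> \<in> insert \<alpha> ((\<lambda>\<beta>. \<beta> \<circ> s \<alpha>) ` invs v)"
    then consider "\<beta> = \<alpha>" | \<gamma> where "\<gamma> \<in> invs v" "\<beta> = \<gamma> \<circ> s \<alpha>" by (elim insertE imageE)
    then show "\<beta> \<in> invs (s \<alpha> \<circ> v)"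
    proof cases
      case 1
      then show ?thesis using simple_pos[OF a] comp_refl_pos_iff[OF ar v] p by (simp add: invs_def)
    next
      case 2
      then have "\<beta> \<circ> (s \<alpha> \<circ> v) \<notin> pos" unfolding 2(2) c by (simp add: invs_def)
      then show ?thesis using in1[OF 2(1)] 2(2) by (simp add: invs_def)
    qed
  qed
qed

text \<open>At full length every letter must contribute its reflection, because the
  \<open>cB\<close> term leaves too short a word. Each new reflection transports the earlier factors
  as in \<open>invs_refl\<close>.\<close>

lemma cf_leading: "redw as \<Longrightarrow> cf as (word_prod D as) = (\<Prod>\<beta>\<in>invs (word_prod D as). cA \<beta>)"
proof (induction as)
  case Nil
  have "invs id = {}" by (auto simp: invs_def)
  then show ?case by (simp only: word_prod_Nil cf.simps prod.empty if_True refl)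
next
  case (Cons \<alpha> as)
  then have a: "\<alpha> \<in> simple D" "\<alpha> \<in> roots D" and p: "\<alpha> \<circ> word_prod D as \<in> pos" and r: "redw as"
    by (simp_all add: simple_root)
  let ?v = "word_prod D as"
  have v: "?v \<in> weyl D" using r by (intro weyl_word redw_simple)
  interpret e: lattice_emb "s \<alpha>" by (rule refl_emb[OF a(2)])
  have "len (s \<alpha> \<circ> ?v) = Suc (length as)" using len_redw[OF Cons.prems] by simp
  then have 0: "cf as (s \<alpha> \<circ> ?v) = 0"
    by (intro cf_support redw_simple[OF r] weyl_refl[OF a(2) v]) simp
  have inj: "inj_on (\<lambda>\<beta>. \<beta> \<circ> s \<alpha>) (invs ?v)" by (rule inj_onI) (metis comp_refl_cancel[OF a(2)])
  have "cf (\<alpha> # as) (word_prod D (\<alpha> # as)) = cA \<alpha> * act (s \<alpha>) (\<Prod>\<beta>\<in>invs ?v. cA \<beta>)"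
    using Cons.IH[OF r] by (simp add: refl_comp_cancel[OF a(2)] 0)
  also have "act (s \<alpha>) (\<Prod>\<beta>\<in>invs ?v. cA \<beta>) = (\<Prod>\<beta>\<in>invs ?v. cA (\<beta> \<circ> s \<alpha>))"
    unfolding e.push_prod by (intro prod.cong refl act_refl_cA a) (simp add: invs_def pos_root)
  also have "\<dots> = (\<Prod>\<beta>\<in>(\<lambda>\<beta>. \<beta> \<circ> s \<alpha>) ` invs ?v. cA \<beta>)" by (simp add: prod.reindex[OF inj])
  also have "cA \<alpha> * \<dots> = (\<Prod>\<beta>\<in>invs (word_prod D (\<alpha> # as)). cA \<beta>)"
    unfolding word_prod_Cons invs_refl(1)[OF a(1) v p]
    by (rule prod.insert[symmetric]) (use finite_invs invs_refl(2)[OF a(1) v p] in auto)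
  finally show ?case .
qed

definition tc :: "('y \<Rightarrow> 'y) \<Rightarrow> 'y Frac_alg" where
  "tc u = (\<Sum>w\<in>weyl D. cf (rw w) u)"

lemma tsum_expansion: "tsum f = (\<Sum>u\<in>weyl D. tc u * act u f)"
proof -
  have "tsum f = (\<Sum>w\<in>weyl D. \<Sum>u\<in>weyl D. cf (rw w) u * act u f)"
    unfolding tsum_def tw_def by (intro sum.cong tq_words_expansion redw_simple refl rw)
  also have "\<dots> = (\<Sum>u\<in>weyl D. \<Sum>w\<in>weyl D. cf (rw w) u * act u f)" by (rule sum.swap)
  finally show ?thesis by (simp add: tc_def sum_distrib_right)
qed

text \<open>\<open>tsum\<close> has values fixed by \<open>s \<alpha>\<close>; comparing the
  expansions of both sides on exponentials determines the coefficients by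
  \<open>expo_independent\<close>.\<close>

lemma tc_refl:
  assumes a: "\<alpha> \<in> simple D" and u: "u \<in> weyl D"
  shows "tc (s \<alpha> \<circ> u) = act (s \<alpha>) (tc u)"
proof -
  note ar = simple_root[OF a]
  interpret e: lattice_emb "s \<alpha>" by (rule refl_emb[OF ar])
  \<comment> \<open>The coefficient of u in the composite of \<open>s \<alpha>\<close> after
    \<open>tsum\<close>.\<close>
  define F where "F u = act (s \<alpha>) (tc (s \<alpha> \<circ> u))" for u
  have "(\<Sum>u\<in>weyl D. (F u - tc u) * \<pi>\<^bsup>u \<mu>\<^esup>) = 0" for \<mu>
  proof -
    have "(\<Sum>u\<in>weyl D. F u * \<pi>\<^bsup>u \<mu>\<^esup>) = (\<Sum>u\<in>weyl D. F (s \<alpha> \<circ> u) * \<pi>\<^bsup>(s \<alpha> \<circ> u) \<mu>\<^esup>)"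
      by (rule sum_weyl_left[OF refl_weyl[OF ar], symmetric])
    also have "\<dots> = act (s \<alpha>) (tsum (\<pi>\<^bsup>\<mu>\<^esup>))"
      unfolding tsum_expansion e.push_sum F_def refl_comp_cancel[OF ar]
      by (intro sum.cong refl) (simp add: e.push_mult act_expo)
    also have "\<dots> = tsum (\<pi>\<^bsup>\<mu>\<^esup>)" by (rule act_tsum[OF a])
    also have "\<dots> = (\<Sum>u\<in>weyl D. tc u * \<pi>\<^bsup>u \<mu>\<^esup>)"
      unfolding tsum_expansion by (intro sum.cong refl) (simp add: act_expo)
    finally show ?thesis by (simp add: left_diff_distrib sum_subtractf)
  qed
  from expo_independent[of "weyl D" "\<lambda>u. F u - tc u" , OF finite_weyl weyl_additive this weyl_refl[OF ar u]]
  show ?thesis by (simp add: F_def refl_comp_cancel[OF ar])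
qed

lemma tc_comp:
  assumes v: "v \<in> weyl D" and u: "u \<in> weyl D"
  shows "tc (v \<circ> u) = act v (tc u)"
proof (rule weyl_induct[of v "\<lambda>v. tc (v \<circ> u) = act v (tc u)"])
  show "v \<in> weyl D" by fact
  show "tc (id \<circ> u) = act id (tc u)" by (simp add: frac_push_id)
next
  fix \<alpha> v assume a: "\<alpha> \<in> simple D" and v: "v \<in> weyl D" and IH: "tc (v \<circ> u) = act v (tc u)"
  show "tc (s \<alpha> \<circ> v \<circ> u) = act (s \<alpha> \<circ> v) (tc u)"
    unfolding comp_assoc tc_refl[OF a weyl_comp[OF v u]] IH
    by (rule act_comp[OF refl_weyl[OF simple_root[OF a]] v])
qed

text \<open>Among the chosen words only that of the longest element w0 reaches w0, with a leading
  coefficient over all positive roots. \<open>tc_comp\<close> for \<open>inv w0\<close> carries it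
  to the identity.\<close>

lemma tc_id: "tc id = (\<Prod>\<beta>\<in>pos. (1 - of_nat q * \<pi>\<^bsup>cr \<beta>\<^esup>) / (1 - \<pi>\<^bsup>cr \<beta>\<^esup>))"
proof -
  obtain w0 where w0: "w0 \<in> weyl D" and neg': "\<forall>\<beta>\<in>pos. \<beta> \<circ> w0 \<notin> pos"
    and long: "\<forall>w\<in>weyl D. w \<noteq> w0 \<longrightarrow> len w < len w0"
    by (rule longest_element) blast
  note neg = bspec[OF neg']
  note iw = weyl_inv[OF w0]
  interpret e: lattice_emb "inv w0" by (rule weyl_emb[OF iw])
  have "tc w0 = cf (rw w0) w0 + (\<Sum>w\<in>weyl D - {w0}. cf (rw w) w0)"
    unfolding tc_def by (rule sum.remove[OF finite_weyl w0])
  also have "(\<Sum>w\<in>weyl D - {w0}. cf (rw w) w0) = 0"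
  proof (intro sum.neutral ballI)
    fix w assume w: "w \<in> weyl D - {w0}"
    then have "len w < len w0" using long by blast
    moreover have "length (rw w) = len w" using len_redw[of "rw w"] rw[of w] w by simp
    ultimately have "length (rw w) < len w0" by simp
    then show "cf (rw w) w0 = 0" using w w0 by (intro cf_support redw_simple rw) simp_all
  qed
  also have "cf (rw w0) w0 = (\<Prod>\<beta>\<in>invs w0. cA \<beta>)"
    using cf_leading[OF rw(1)[OF w0]] by (simp only: rw(2)[OF w0])
  also have "invs w0 = pos" using neg by (auto simp: invs_def)
  finally have tw0: "tc w0 = (\<Prod>\<beta>\<in>pos. cA \<beta>)" by simp
  have "tc id = act (inv w0) (tc w0)"
    using tc_comp[OF iw w0] w0 by simp
  also have "\<dots> = (\<Prod>\<beta>\<in>pos. cA (\<beta> \<circ> w0))"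
    unfolding tw0 e.push_prod
  proof (intro prod.cong refl)
    fix \<beta> assume "\<beta> \<in> pos"
    then have b: "\<beta> \<circ> w0 \<in> roots D" using w0 by (intro root_comp_weyl pos_root)
    have "\<beta> \<circ> w0 \<circ> inv w0 = \<beta>" using w0 by (simp add: comp_assoc)
    then show "act (inv w0) (cA \<beta>) = cA (\<beta> \<circ> w0)" using act_cA[OF iw b] by simp
  qed
  \<comment> \<open>Sending \<beta> to the negative of \<open>\<beta> \<circ> w0\<close> permutes
    the positive roots. The sign is why coroots enter the result with positive exponents although
    \<open>cA\<close> has negative ones.\<close>
  also have "\<dots> = (\<Prod>\<beta>\<in>pos. cA (\<lambda>y. - \<beta> y))"
  proof (rule prod.reindex_bij_witness[of _ "\<lambda>\<beta> y. - \<beta> (inv w0 y)" "\<lambda>\<beta> y. - \<beta> (w0 y)"])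
    fix \<beta> assume b: "\<beta> \<in> pos"
    have bw: "\<beta> \<circ> w0 \<in> roots D" "\<beta> \<circ> inv w0 \<in> roots D"
      using root_comp_weyl[OF w0 pos_root[OF b]] root_comp_weyl[OF iw pos_root[OF b]] by auto
    show "(\<lambda>y. - \<beta> (w0 y)) \<in> pos"
      using neg[OF b] neg_pos_iff[OF bw(1)] by simp
    have "\<beta> \<circ> inv w0 \<notin> pos"
    proof
      assume "\<beta> \<circ> inv w0 \<in> pos"
      from neg[OF this] show False using b w0 by (simp add: comp_assoc)
    qed
    then show "(\<lambda>y. - \<beta> (inv w0 y)) \<in> pos" using neg_pos_iff[OF bw(2)] by simp
    show "(\<lambda>y. - (- \<beta> (w0 (inv w0 y)))) = \<beta>" "(\<lambda>y. - (- \<beta> (inv w0 (w0 y)))) = \<beta>"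
      using weyl_bij[OF w0] by (simp_all add: bij_is_inj surj_f_inv_f[OF bij_is_surj])
    show "cA (\<lambda>y. - (- \<beta> (w0 y))) = cA (\<beta> \<circ> w0)" by (simp add: comp_def)
  qed
  also have "\<dots> = (\<Prod>\<beta>\<in>pos. (1 - of_nat q * \<pi>\<^bsup>cr \<beta>\<^esup>) / (1 - \<pi>\<^bsup>cr \<beta>\<^esup>))"
    by (intro prod.cong refl) (simp add: cA_def coroot_neg pos_root)
  finally show ?thesis .
qed

theorem tsum_eq:
  "tsum f = (\<Sum>u\<in>weyl D. act u ((\<Prod>\<beta>\<in>pos. (1 - of_nat q * \<pi>\<^bsup>cr \<beta>\<^esup>) / (1 - \<pi>\<^bsup>cr \<beta>\<^esup>)) * f))"
  unfolding tsum_expansion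
proof (intro sum.cong refl)
  fix u assume u: "u \<in> weyl D"
  have "tc u = act u (tc id)" using tc_comp[OF u weyl_id] by simp
  then show "tc u * act u f = act u ((\<Prod>\<beta>\<in>pos. (1 - of_nat q * \<pi>\<^bsup>cr \<beta>\<^esup>) / (1 - \<pi>\<^bsup>cr \<beta>\<^esup>)) * f)"
    by (simp only: tc_id lattice_emb.push_mult[OF weyl_emb[OF u]])
qed

end

section \<open>Characters of the finite Hecke algebra\<close>

locale hecke_char = hecke_datum D q for D :: "'y::fin_free_ab_group root_datum" and q +
  fixes \<epsilon> :: "'y hecke \<Rightarrow> complex"
  assumes eps: "hecke_character D q \<epsilon>"
begin

section \<open>Multiplication by generators in the finite Hecke algebra\<close>

abbreviation "hmult \<equiv> hecke_T_simple_mult D q"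

abbreviation e :: "('y \<Rightarrow> int) \<Rightarrow> complex" where
  "e \<alpha> \<equiv> \<epsilon> (hecke_T (s \<alpha>))"

lemma hecke_T_carrier: "w \<in> weyl D \<Longrightarrow> hecke_T w \<in> hecke_carrier D"
  by (auto simp: hecke_carrier_def hecke_T_def)

lemma hmult_hecke_T: "w \<in> weyl D \<Longrightarrow> hmult \<alpha> (hecke_T w) = hecke_T_simple_basis D q \<alpha> w"
proof (rule ext)
  fix u assume w: "w \<in> weyl D"
  have "hmult \<alpha> (hecke_T w) u = (\<Sum>v\<in>weyl D. if v = w then hecke_T_simple_basis D q \<alpha> v u else 0)"
    unfolding hecke_T_simple_mult_def by (intro sum.cong) (simp_all add: hecke_T_def)
  then show "hmult \<alpha> (hecke_T w) u = hecke_T_simple_basis D q \<alpha> w u"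
    using finite_weyl w by simp
qed

lemma hmult_pos:
  "\<alpha> \<in> simple D \<Longrightarrow> w \<in> weyl D \<Longrightarrow> \<alpha> \<circ> w \<in> pos \<Longrightarrow> hmult \<alpha> (hecke_T w) = hecke_T (s \<alpha> \<circ> w)"
  using len_refl_less_iff[of \<alpha> w] by (simp only: hmult_hecke_T hecke_T_simple_basis_def if_True)

lemma hmult_words:
  "redw (as @ bs) \<Longrightarrow> foldr hmult as (hecke_T (word_prod D bs)) = hecke_T (word_prod D (as @ bs))"
proof (induction as)
  case (Cons \<alpha> as)
  then have r: "redw (as @ bs)" and a: "\<alpha> \<in> simple D" "\<alpha> \<circ> word_prod D (as @ bs) \<in> pos" by simp_all
  have w: "word_prod D (as @ bs) \<in> weyl D" by (rule weyl_word[OF redw_simple[OF r]])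
  have "foldr hmult (\<alpha> # as) (hecke_T (word_prod D bs)) = hmult \<alpha> (hecke_T (word_prod D (as @ bs)))"
    by (simp add: Cons.IH[OF r])
  also have "\<dots> = hecke_T (s \<alpha> \<circ> word_prod D (as @ bs))" by (rule hmult_pos[OF a(1) w a(2)])
  finally show ?case by (simp only: append_Cons word_prod_Cons)
qed simp

lemma reduced_word_SOME:
  assumes "w \<in> weyl D"
  shows "redw (SOME as. reduced_word D w as)" "word_prod D (SOME as. reduced_word D w as) = w"
  using rw[OF assms] unfolding rw_def reduced_word_iff by auto

lemma hecke_mult_hecke_T:
  assumes w: "w \<in> weyl D"
  shows "hecke_mult D q (hecke_T w) b = foldr hmult (SOME as. reduced_word D w as) b"
proof (rule ext)
  fix u
  have "hecke_mult D q (hecke_T w) b u =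
      (\<Sum>v\<in>weyl D. if v = w then foldr hmult (SOME as. reduced_word D v as) b u else 0)"
    unfolding hecke_mult_def by (intro sum.cong) (simp_all add: hecke_T_def)
  then show "hecke_mult D q (hecke_T w) b u = foldr hmult (SOME as. reduced_word D w as) b u"
    using finite_weyl w by simp
qed

text \<open>The chosen reduced word of \<open>s \<alpha>\<close> has one letter, and that letter is
  \<alpha> because distinct simple roots have distinct reflections.\<close>

lemma hecke_mult_simple:
  assumes a: "\<alpha> \<in> simple D"
  shows "hecke_mult D q (hecke_T (s \<alpha>)) b = hmult \<alpha> b"
proof -
  note ar = simple_root[OF a]
  let ?as = "SOME as. reduced_word D (s \<alpha>) as"
  have r: "redw ?as" "word_prod D ?as = s \<alpha>" using reduced_word_SOME[OF refl_weyl[OF ar]] by auto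
  have "redw [\<alpha>]" using a simple_pos by simp
  from len_redw[OF this] have "length ?as = 1" using len_redw[OF r(1)] r(2) by simp
  then obtain \<gamma> where as: "?as = [\<gamma>]" by (auto simp: length_Suc_conv)
  then have g: "\<gamma> \<in> simple D" "s \<gamma> = s \<alpha>" using r by auto
  have "\<gamma> = \<alpha>"
  proof (rule ccontr)
    assume "\<gamma> \<noteq> \<alpha>"
    from simple_perm[OF a simple_pos[OF g(1)] this] have "\<gamma> \<circ> s \<gamma> \<in> pos" by (simp only: g(2))
    then show False
      using comp_refl_self[OF simple_root[OF g(1)]] not_pos_and_neg[OF simple_pos[OF g(1)]] by simp
  qed
  then show ?thesis using hecke_mult_hecke_T[OF refl_weyl[OF ar], of b] as by simp
qed

lemma eps_add: "a \<in> hecke_carrier D \<Longrightarrow> b \<in> hecke_carrier D \<Longrightarrow> \<epsilon> (\<lambda>u. a u + b u) = \<epsilon> a + \<epsilon> b"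
  and eps_scale: "a \<in> hecke_carrier D \<Longrightarrow> \<epsilon> (\<lambda>u. c * a u) = c * \<epsilon> a"
  and eps_id: "\<epsilon> (hecke_T id) = 1"
  and eps_mult: "a \<in> hecke_carrier D \<Longrightarrow> b \<in> hecke_carrier D \<Longrightarrow> \<epsilon> (hecke_mult D q a b) = \<epsilon> a * \<epsilon> b"
  using eps unfolding hecke_character_def by blast+

lemma eps_simple_mult:
  "\<alpha> \<in> simple D \<Longrightarrow> w \<in> weyl D \<Longrightarrow> \<epsilon> (hmult \<alpha> (hecke_T w)) = e \<alpha> * \<epsilon> (hecke_T w)"
  using eps_mult[OF hecke_T_carrier hecke_T_carrier, of "s \<alpha>" w]
  by (simp add: hecke_mult_simple refl_weyl simple_root)

text \<open>The character is applied to the quadratic relation for the square of the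
  generator.\<close>

lemma e_cases: assumes a: "\<alpha> \<in> simple D" shows "e \<alpha> = -1 \<or> e \<alpha> = of_nat q"
proof -
  note ar = simple_root[OF a]
  note sW = refl_weyl[OF ar]
  let ?a = "\<lambda>u. (of_nat q - 1) * hecke_T (s \<alpha>) u" and ?b = "\<lambda>u. of_nat q * hecke_T id u :: complex"
  have c: "?a \<in> hecke_carrier D" "?b \<in> hecke_carrier D"
    using hecke_T_carrier[OF sW] hecke_T_carrier[OF weyl_id] by (simp_all add: hecke_carrier_def)
  have "\<not> len (s \<alpha>) < len (s \<alpha> \<circ> s \<alpha>)" by (simp add: refl_comp_refl[OF ar])
  then have "hmult \<alpha> (hecke_T (s \<alpha>)) = (\<lambda>u. ?a u + ?b u)"
    by (simp add: hmult_hecke_T[OF sW] hecke_T_simple_basis_def refl_comp_refl[OF ar])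
  then have "e \<alpha> * e \<alpha> = \<epsilon> (\<lambda>u. ?a u + ?b u)" using eps_simple_mult[OF a sW] by simp
  also have "\<dots> = (of_nat q - 1) * e \<alpha> + of_nat q"
    using eps_add[OF c] by (simp add: eps_scale hecke_T_carrier sW weyl_id eps_id)
  finally have "(e \<alpha> + 1) * (e \<alpha> - of_nat q) = 0" by (simp add: algebra_simps)
  then show ?thesis by (auto simp: eq_neg_iff_add_eq_0)
qed

lemma eps_hecke_T_nonzero: assumes "redw as" shows "\<epsilon> (hecke_T (word_prod D as)) \<noteq> 0"
  using assms
proof (induction as)
  case Nil
  show ?case using eps_id by (simp only: word_prod_Nil) simp
next
  case (Cons \<alpha> as)
  then have r: "redw as" and a: "\<alpha> \<in> simple D" "\<alpha> \<circ> word_prod D as \<in> pos" by simp_all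
  have w: "word_prod D as \<in> weyl D" by (rule weyl_word[OF redw_simple[OF r]])
  have "\<epsilon> (hecke_T (word_prod D (\<alpha> # as))) = e \<alpha> * \<epsilon> (hecke_T (word_prod D as))"
    using hmult_pos[OF a(1) w a(2)] eps_simple_mult[OF a(1) w] by simp
  moreover have "e \<alpha> \<noteq> 0" using e_cases[OF a(1)] q by auto
  ultimately show ?case using Cons.IH[OF r] by (simp only: mult_eq_0_iff) simp
qed

text \<open>If \<open>\<beta> = w \<alpha>\<close> for simple roots \<open>\<alpha>\<close>, \<open>\<beta>\<close>, then \<open>T\<^sub>w T\<^sub>\<alpha> = T\<^sub>\<beta> T\<^sub>w\<close>.\<close>

lemma e_conj:
  assumes a: "\<alpha> \<in> simple D" and b: "\<beta> \<in> simple D" and conj: "weyl_conj D \<alpha> \<beta>"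
  shows "e \<alpha> = e \<beta>"
proof -
  obtain w where w: "w \<in> weyl D" and bw: "\<beta> = \<alpha> \<circ> inv w" using conj by (auto simp: weyl_conj_def)
  note ar = simple_root[OF a] and br = simple_root[OF b]
  have ba: "\<beta> \<circ> w = \<alpha>" unfolding bw using w by (simp add: comp_assoc)
  have sw: "w \<circ> s \<alpha> = s \<beta> \<circ> w" using refl_comp_weyl[OF w br] by (simp only: ba)
  let ?as = "SOME as. reduced_word D w as"
  have r: "redw ?as" "word_prod D ?as = w" using reduced_word_SOME[OF w] by auto
  have wp: "word_prod D (?as @ [\<alpha>]) = w \<circ> s \<alpha>" by (simp add: word_prod_append r(2))
  have "len w < len (w \<circ> s \<alpha>)"
    using refl_less_right[OF a w] simple_pos[OF b] unfolding bw[symmetric] by simp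
  moreover have "len (w \<circ> s \<alpha>) \<le> Suc (length ?as)"
    using len_le[of "?as @ [\<alpha>]"] redw_simple[OF r(1)] a unfolding wp by simp
  ultimately have "redw (?as @ [\<alpha>])"
    using redw_simple[OF r(1)] a len_redw[OF r(1)] r(2)
    by (intro redw_if_len) (simp_all add: wp)
  from hmult_words[OF this] have "hecke_mult D q (hecke_T w) (hecke_T (s \<alpha>)) = hecke_T (w \<circ> s \<alpha>)"
    unfolding hecke_mult_hecke_T[OF w] wp by simp
  then have "\<epsilon> (hecke_T w) * e \<alpha> = \<epsilon> (hecke_T (s \<beta> \<circ> w))"
    using eps_mult[OF hecke_T_carrier[OF w] hecke_T_carrier[OF refl_weyl[OF ar]]] by (simp add: sw)
  also have "\<dots> = e \<beta> * \<epsilon> (hecke_T w)"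
    using hmult_pos[OF b w] eps_simple_mult[OF b w] simple_pos[OF a] by (simp add: ba)
  finally show ?thesis using eps_hecke_T_nonzero[OF r(1)] by (simp add: r(2))
qed

lemma weyl_conj_refl: "weyl_conj D \<alpha> \<alpha>"
  unfolding weyl_conj_def using weyl_id by (intro bexI[of _ id]) (simp_all add: inv_id)

lemma weyl_conj_common:
  assumes "weyl_conj D \<alpha> \<gamma>" "weyl_conj D \<beta> \<gamma>" shows "weyl_conj D \<alpha> \<beta>"
proof -
  obtain v w where v: "v \<in> weyl D" "\<gamma> = \<alpha> \<circ> inv v" and w: "w \<in> weyl D" "\<gamma> = \<beta> \<circ> inv w"
    using assms by (auto simp: weyl_conj_def)
  have "\<beta> = \<beta> \<circ> inv w \<circ> w" using w(1) by (simp add: comp_assoc)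
  also have "\<dots> = \<alpha> \<circ> (inv v \<circ> w)" using v w by (simp add: comp_assoc)
  also have "inv v \<circ> w = inv (inv w \<circ> v)"
    using v w by (simp add: o_inv_distrib weyl_bij weyl_inv inv_inv_eq)
  finally show ?thesis unfolding weyl_conj_def using v w weyl_comp weyl_inv by blast
qed

section \<open>The two classes of positive roots\<close>

abbreviation "Pm \<equiv> char_pos_roots D \<epsilon> (- 1)"
abbreviation "Pq \<equiv> char_pos_roots D \<epsilon> (of_nat q)"

lemma char_pos_roots_subset: "char_pos_roots D \<epsilon> c \<subseteq> pos"
  by (auto simp: char_pos_roots_def)

lemma finite_char_pos_roots: "finite (char_pos_roots D \<epsilon> c)"
  using finite_subset[OF char_pos_roots_subset finite_pos] .

text \<open>Every positive root is conjugate to a simple one, where the character takes one of two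
  values; \<open>e_conj\<close> prevents a root from receiving both.\<close>

lemma pos_partition: "pos = Pm \<union> Pq" "Pm \<inter> Pq = {}"
proof -
  show "pos = Pm \<union> Pq"
  proof (intro equalityI subsetI)
    fix \<beta> assume b: "\<beta> \<in> pos"
    obtain \<alpha> where "\<alpha> \<in> simple D" "weyl_conj D \<alpha> \<beta>" using conj_simple[OF b] .
    then show "\<beta> \<in> Pm \<union> Pq" using b e_cases[of \<alpha>] by (auto simp: char_pos_roots_def)
  qed (use char_pos_roots_subset in blast)
  have ne: "(- 1 :: complex) \<noteq> of_nat q"
    by (metis of_nat_1 of_nat_add of_nat_eq_0_iff add.right_inverse add_is_0 one_neq_zero)
  show "Pm \<inter> Pq = {}"
  proof (rule equals0I)
    fix \<beta> assume b: "\<beta> \<in> Pm \<inter> Pq"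
    from b have "\<exists>\<alpha>\<in>simple D. e \<alpha> = - 1 \<and> weyl_conj D \<alpha> \<beta>" unfolding char_pos_roots_def by simp
    then obtain \<alpha> where a: "\<alpha> \<in> simple D" "e \<alpha> = - 1" "weyl_conj D \<alpha> \<beta>" by (elim bexE conjE)
    from b have "\<exists>\<alpha>\<in>simple D. e \<alpha> = of_nat q \<and> weyl_conj D \<alpha> \<beta>" unfolding char_pos_roots_def by simp
    then obtain \<gamma> where g: "\<gamma> \<in> simple D" "e \<gamma> = of_nat q" "weyl_conj D \<gamma> \<beta>" by (elim bexE conjE)
    show False using e_conj[OF a(1) g(1) weyl_conj_common[OF a(3) g(3)]] a(2) g(2) ne by simp
  qed
qed

lemma simple_in_char_pos_roots_iff:
  assumes "\<alpha> \<in> simple D" shows "\<alpha> \<in> char_pos_roots D \<epsilon> c \<longleftrightarrow> e \<alpha> = c"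
proof
  assume "\<alpha> \<in> char_pos_roots D \<epsilon> c"
  then have "\<exists>\<gamma>\<in>simple D. e \<gamma> = c \<and> weyl_conj D \<gamma> \<alpha>" unfolding char_pos_roots_def by simp
  then obtain \<gamma> where "\<gamma> \<in> simple D" "e \<gamma> = c" "weyl_conj D \<gamma> \<alpha>" by (elim bexE conjE)
  then show "e \<alpha> = c" using e_conj[of \<gamma> \<alpha>] assms by simp
next
  assume "e \<alpha> = c"
  then show "\<alpha> \<in> char_pos_roots D \<epsilon> c" unfolding char_pos_roots_def
    by (intro CollectI conjI bexI[of _ \<alpha>] simple_pos weyl_conj_refl assms)
qed

lemma char_pos_roots_refl:
  assumes a: "\<alpha> \<in> simple D" and b: "\<beta> \<in> char_pos_roots D \<epsilon> c" "\<beta> \<noteq> \<alpha>"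
  shows "\<beta> \<circ> s \<alpha> \<in> char_pos_roots D \<epsilon> c"
proof -
  have "\<exists>\<gamma>\<in>simple D. e \<gamma> = c \<and> (\<exists>w\<in>weyl D. \<beta> = \<gamma> \<circ> inv w)" and bp: "\<beta> \<in> pos"
    using b(1) unfolding char_pos_roots_def weyl_conj_def by simp_all
  then obtain \<gamma> w where g: "\<gamma> \<in> simple D" "e \<gamma> = c" "w \<in> weyl D" "\<beta> = \<gamma> \<circ> inv w"
    by (elim bexE conjE)
  have "\<beta> \<circ> s \<alpha> = \<gamma> \<circ> inv (s \<alpha> \<circ> w)"
    using inv_refl_comp[OF g(3) simple_root[OF a]] g(4) by (simp only: comp_assoc)
  then have "weyl_conj D \<gamma> (\<beta> \<circ> s \<alpha>)"
    unfolding weyl_conj_def by (rule bexI[OF _ weyl_refl[OF simple_root[OF a] g(3)]])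
  then show ?thesis unfolding char_pos_roots_def
    by (intro CollectI conjI bexI[of _ \<gamma>] simple_perm[OF a bp b(2)] g)
qed

text \<open>Membership in the class is a W-stable condition on top of positivity, so the permutation
  of the positive roots other than \<alpha> restricts to it.\<close>

lemma bij_char_pos_roots:
  assumes a: "\<alpha> \<in> simple D"
  shows "bij_betw (\<lambda>\<beta>. \<beta> \<circ> s \<alpha>) (char_pos_roots D \<epsilon> c - {\<alpha>}) (char_pos_roots D \<epsilon> c - {\<alpha>})"
proof -
  note ar = simple_root[OF a]
  have *: "\<beta> \<circ> s \<alpha> \<in> char_pos_roots D \<epsilon> c - {\<alpha>}" if b: "\<beta> \<in> char_pos_roots D \<epsilon> c - {\<alpha>}" for \<beta>
  proof -
    have "\<beta> \<in> pos - {\<alpha>}" using b char_pos_roots_subset by blast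
    from bij_betwE[OF bij_pos_minus_simple[OF a]] this have "\<beta> \<circ> s \<alpha> \<in> pos - {\<alpha>}" by blast
    then show ?thesis using char_pos_roots_refl[OF a] b by simp
  qed
  then show ?thesis
    by (intro bij_betw_byWitness[where f' = "\<lambda>\<beta>. \<beta> \<circ> s \<alpha>"] ballI image_subsetI)
      (simp_all only: comp_refl_cancel[OF ar])
qed

section \<open>The conjugating product and the twist\<close>

definition Pfac :: "'y Frac_alg" where
  "Pfac = (\<Prod>\<beta>\<in>Pm. 1 - of_nat q * \<pi>\<^bsup>cr \<beta>\<^esup>)"

lemma Pfac_nonzero: "Pfac \<noteq> 0"
  unfolding Pfac_def using finite_char_pos_roots of_nat_q_expo_neq_1[OF q, where 'a = 'y] by simp

text \<open>Factors other than that of \<alpha> are permuted, and the factor of \<alpha> is present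
  exactly when the character takes the value -1 there.\<close>

lemma act_refl_Pfac:
  assumes a: "\<alpha> \<in> simple D"
  shows "act (s \<alpha>) Pfac = (if e \<alpha> = -1
    then Pfac * (1 - of_nat q * \<pi>\<^bsup>- cr \<alpha>\<^esup>) / (1 - of_nat q * \<pi>\<^bsup>cr \<alpha>\<^esup>) else Pfac)"
proof -
  note ar = simple_root[OF a]
  interpret em: lattice_emb "s \<alpha>" by (rule refl_emb[OF ar])
  define F where "F \<beta> = (1 - of_nat q * \<pi>\<^bsup>cr \<beta>\<^esup> :: 'y Frac_alg)" for \<beta>
  have F: "act (s \<alpha>) (F \<beta>) = F (\<beta> \<circ> s \<alpha>)" if "\<beta> \<in> roots D" for \<beta>
    by (simp only: F_def em.push_diff em.push_mult em.push_1 em.push_of_nat em.push_expo coroot_comp_refl[OF ar that])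
  have "act (s \<alpha>) (\<Prod>\<beta>\<in>Pm - {\<alpha>}. F \<beta>) = (\<Prod>\<beta>\<in>Pm - {\<alpha>}. F (\<beta> \<circ> s \<alpha>))"
    unfolding em.push_prod using char_pos_roots_subset pos_root by (intro prod.cong refl F) blast
  also have "\<dots> = (\<Prod>\<beta>\<in>Pm - {\<alpha>}. F \<beta>)"
    by (rule prod.reindex_bij_betw[OF bij_char_pos_roots[OF a]])
  finally have R: "act (s \<alpha>) (\<Prod>\<beta>\<in>Pm - {\<alpha>}. F \<beta>) = (\<Prod>\<beta>\<in>Pm - {\<alpha>}. F \<beta>)" .
  show ?thesis
  proof (cases "e \<alpha> = -1")
    case True
    then have "\<alpha> \<in> Pm" using simple_in_char_pos_roots_iff[OF a] by simp
    then have P: "Pfac = F \<alpha> * (\<Prod>\<beta>\<in>Pm - {\<alpha>}. F \<beta>)"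
      unfolding Pfac_def F_def by (rule prod.remove[OF finite_char_pos_roots])
    have "F \<alpha> \<noteq> 0" unfolding F_def by (rule of_nat_q_expo_neq_1[OF q])
    moreover have "F (\<alpha> \<circ> s \<alpha>) = 1 - of_nat q * \<pi>\<^bsup>- cr \<alpha>\<^esup>"
      by (simp only: F_def comp_refl_self[OF ar] coroot_neg[OF ar])
    moreover have "act (s \<alpha>) Pfac = F (\<alpha> \<circ> s \<alpha>) * (\<Prod>\<beta>\<in>Pm - {\<alpha>}. F \<beta>)"
      unfolding P by (simp only: em.push_mult R F[OF ar])
    ultimately show ?thesis using True unfolding P F_def[of \<alpha>, symmetric] by simp
  next
    case False
    then have "Pm - {\<alpha>} = Pm" using simple_in_char_pos_roots_iff[OF a] by blast
    then show ?thesis using R False unfolding Pfac_def F_def by simp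
  qed
qed

end

locale hecke_char_rho = hecke_char D q \<epsilon> for D :: "'y::fin_free_ab_group root_datum" and q \<epsilon> +
  fixes \<rho> :: 'y
  assumes rho: "\<rho> + \<rho> = (\<Sum>\<alpha>\<in>Pm. cr \<alpha>)"
begin

text \<open>Doubled, the reflection changes the sum only in the term of \<alpha>, from the coroot to
  its negative; halving leaves a shift by one coroot.\<close>

lemma refl_rho:
  assumes a: "\<alpha> \<in> simple D" shows "s \<alpha> \<rho> = (if e \<alpha> = -1 then \<rho> - cr \<alpha> else \<rho>)"
proof -
  note ar = simple_root[OF a]
  have root: "\<beta> \<in> roots D" if "\<beta> \<in> Pm" for \<beta> using that char_pos_roots_subset pos_root by blast
  have "s \<alpha> (\<Sum>\<beta>\<in>Pm - {\<alpha>}. cr \<beta>) = (\<Sum>\<beta>\<in>Pm - {\<alpha>}. cr (\<beta> \<circ> s \<alpha>))"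
    using root by (simp add: additive.sum[OF refl_additive[OF ar]] coroot_comp_refl[OF ar])
  also have "\<dots> = (\<Sum>\<beta>\<in>Pm - {\<alpha>}. cr \<beta>)"
    by (rule sum.reindex_bij_betw[OF bij_char_pos_roots[OF a]])
  finally have R: "s \<alpha> (\<Sum>\<beta>\<in>Pm - {\<alpha>}. cr \<beta>) = (\<Sum>\<beta>\<in>Pm - {\<alpha>}. cr \<beta>)" .
  have 2: "s \<alpha> \<rho> + s \<alpha> \<rho> = s \<alpha> (\<Sum>\<beta>\<in>Pm. cr \<beta>)"
    by (simp add: rho[symmetric] additive.add[OF refl_additive[OF ar]])
  show ?thesis
  proof (cases "e \<alpha> = -1")
    case True
    then have "\<alpha> \<in> Pm" using simple_in_char_pos_roots_iff[OF a] by simp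
    then have P: "(\<Sum>\<beta>\<in>Pm. cr \<beta>) = cr \<alpha> + (\<Sum>\<beta>\<in>Pm - {\<alpha>}. cr \<beta>)"
      by (rule sum.remove[OF finite_char_pos_roots])
    have "s \<alpha> (cr \<alpha>) = - cr \<alpha>" by (simp add: root_refl_def root_coroot[OF ar] zscale_2)
    then have "s \<alpha> \<rho> + s \<alpha> \<rho> = - cr \<alpha> + (\<rho> + \<rho> - cr \<alpha>)"
      unfolding 2 rho P by (simp add: additive.add[OF refl_additive[OF ar]] R)
    then have "s \<alpha> \<rho> + s \<alpha> \<rho> = (\<rho> - cr \<alpha>) + (\<rho> - cr \<alpha>)" by (simp add: algebra_simps)
    then have "s \<alpha> \<rho> = \<rho> - cr \<alpha>" by (simp only: double_cancel)
    then show ?thesis using True by simp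
  next
    case False
    then have "Pm - {\<alpha>} = Pm" using simple_in_char_pos_roots_iff[OF a] by blast
    then have "s \<alpha> \<rho> + s \<alpha> \<rho> = \<rho> + \<rho>" using R 2 by (simp add: rho)
    then have "s \<alpha> \<rho> = \<rho>" by (simp only: double_cancel)
    then show ?thesis using False by simp
  qed
qed

text \<open>Both sides have the same diagonal coefficient, so only the coefficients of the
  reflection are compared: the twist by \<rho> contributes an exponential on the left, and
  \<open>Pfac\<close> its quotient by its reflection on the right.\<close>

lemma T_tw_eq:
  assumes a: "\<alpha> \<in> simple D"
  shows "T_tw D q \<epsilon> \<rho> \<alpha> f = Pfac * tq \<alpha> (f / Pfac)"
proof -
  note ar = simple_root[OF a]
  interpret em: lattice_emb "s \<alpha>" by (rule refl_emb[OF ar])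
  define y where "y = (\<pi>\<^bsup>- cr \<alpha>\<^esup> :: 'y Frac_alg)"
  define c where "c = (of_nat q :: 'y Frac_alg)"
  have y: "y \<noteq> 0" "1 - y \<noteq> 0" using expo_coroot_neq_1(1)[OF ar] by (simp_all add: y_def)
  have iy: "\<pi>\<^bsup>cr \<alpha>\<^esup> = inverse y" by (simp add: y_def expo_minus)
  have cy: "1 - c * y \<noteq> 0" "1 - c * inverse y \<noteq> 0"
    using of_nat_q_expo_neq_1[OF q, of "- cr \<alpha>"] of_nat_q_expo_neq_1[OF q, of "cr \<alpha>"]
    by (simp_all add: y_def[symmetric] c_def[symmetric] iy)
  have P0: "Pfac \<noteq> 0" by (rule Pfac_nonzero)
  have E: "const_frac (e \<alpha>) = (if e \<alpha> = -1 then -1 else c)"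
    using e_cases[OF a] by (auto simp: c_def const_frac_minus)
  have rr: "\<pi>\<^bsup>\<rho>\<^esup> * \<pi>\<^bsup>- \<rho>\<^esup> = (1 :: 'y Frac_alg)" by (simp add: expo_minus)
  have "T_tw D q \<epsilon> \<rho> \<alpha> f = (const_frac (e \<alpha>) + (1 - c) / (1 - y)) * (\<pi>\<^bsup>\<rho>\<^esup> * \<pi>\<^bsup>- s \<alpha> \<rho>\<^esup>) * act (s \<alpha>) f
      + (c - 1) / (1 - y) * (\<pi>\<^bsup>\<rho>\<^esup> * \<pi>\<^bsup>- \<rho>\<^esup>) * f"
    unfolding T_tw_def T_op_def y_def[symmetric] c_def[symmetric]
    by (simp add: em.push_mult additive.minus[OF refl_additive[OF ar]] distrib_left mult_ac)
  then have T: "T_tw D q \<epsilon> \<rho> \<alpha> f = (const_frac (e \<alpha>) + (1 - c) / (1 - y)) * (\<pi>\<^bsup>\<rho>\<^esup> * \<pi>\<^bsup>- s \<alpha> \<rho>\<^esup>) * act (s \<alpha>) f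
      + (c - 1) / (1 - y) * f" by (simp add: rr)
  have Q: "Pfac * tq \<alpha> (f / Pfac) = (1 - c * y) / (1 - y) * (Pfac / act (s \<alpha>) Pfac) * act (s \<alpha>) f
      + (c - 1) / (1 - y) * f"
    unfolding tq_def cA_def cB_def y_def[symmetric] c_def[symmetric] em.push_divide
    using P0 by (simp add: distrib_left)
  show ?thesis
  proof (cases "e \<alpha> = -1")
    case True
    have "\<pi>\<^bsup>\<rho>\<^esup> * \<pi>\<^bsup>- s \<alpha> \<rho>\<^esup> = \<pi>\<^bsup>\<rho> + (- s \<alpha> \<rho>)\<^esup>" by (rule expo_add[symmetric])
    also have "\<rho> + (- s \<alpha> \<rho>) = cr \<alpha>" by (simp add: refl_rho[OF a] True)
    finally have r: "\<pi>\<^bsup>\<rho>\<^esup> * \<pi>\<^bsup>- s \<alpha> \<rho>\<^esup> = inverse y" by (simp only: iy)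
    have p: "Pfac / act (s \<alpha>) Pfac = (1 - c * inverse y) / (1 - c * y)"
      unfolding act_refl_Pfac[OF a] using True P0 cy
      by (simp add: y_def[symmetric] c_def[symmetric] iy)
    \<comment> \<open>The numerator y - c, times the factor 1/y from the twist, is 1 - c/y: the
      numerator of the quotient of \<open>Pfac\<close> by its reflection. The denominator 1 - c y of
      that quotient cancels against \<open>cA\<close>.\<close>
    have "- 1 + (1 - c) / (1 - y) = (y - c) / (1 - y)"
      using y by (simp add: field_simps)
    moreover have "(y - c) * inverse y = 1 - c * inverse y" using y by (simp add: field_simps)
    ultimately have "(- 1 + (1 - c) / (1 - y)) * inverse y = (1 - c * inverse y) / (1 - y)"
      by (simp only: times_divide_eq_left)
    also have "\<dots> = (1 - c * y) / (1 - y) * ((1 - c * inverse y) / (1 - c * y))"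
      using cy(1) by (simp only: times_divide_times_eq) (simp add: mult.commute)
    finally show ?thesis unfolding T Q E r p using True by simp
  next
    case False
    have "c + (1 - c) / (1 - y) = (1 - c * y) / (1 - y)" using y by (simp add: field_simps)
    then show ?thesis unfolding T Q E refl_rho[OF a] act_refl_Pfac[OF a] using False P0 rr by simp
  qed
qed

lemma T_tw_word_eq:
  "set as \<subseteq> simple D \<Longrightarrow> T_tw_word D q \<epsilon> \<rho> as f = Pfac * foldr tq as (f / Pfac)"
  using Pfac_nonzero by (induction as) (simp_all add: T_tw_word_def T_tw_eq)

text \<open>Dividing by \<open>Pfac\<close> inside the sum cancels the factors of \<open>Pm\<close>
  in the numerator product over all positive roots and leaves those of \<open>Pq\<close>.\<close>

lemma sum_T_tw:
  assumes red: "\<And>w. w \<in> weyl D \<Longrightarrow> reduced_word D w (red w)"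
  shows "(\<Sum>w\<in>weyl D. T_tw_word D q \<epsilon> \<rho> (red w) f) =
    Pfac * (\<Sum>u\<in>weyl D. act u ((\<Prod>\<beta>\<in>Pq. 1 - of_nat q * \<pi>\<^bsup>cr \<beta>\<^esup>) * f / (\<Prod>\<beta>\<in>pos. 1 - \<pi>\<^bsup>cr \<beta>\<^esup>)))"
proof -
  have "(\<Sum>w\<in>weyl D. T_tw_word D q \<epsilon> \<rho> (red w) f) = (\<Sum>w\<in>weyl D. Pfac * tw w (f / Pfac))"
  proof (intro sum.cong refl)
    fix w assume "w \<in> weyl D"
    then have r: "redw (red w)" "word_prod D (red w) = w" using red reduced_word_iff by blast+
    show "T_tw_word D q \<epsilon> \<rho> (red w) f = Pfac * tw w (f / Pfac)"
      using T_tw_word_eq[OF redw_simple[OF r(1)]] tw_word[OF r(1)] r(2) by simp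
  qed
  also have "\<dots> = Pfac * tsum (f / Pfac)" by (simp add: tsum_def sum_distrib_left)
  also have "(\<Prod>\<beta>\<in>pos. (1 - of_nat q * \<pi>\<^bsup>cr \<beta>\<^esup>) / (1 - \<pi>\<^bsup>cr \<beta>\<^esup>)) * (f / Pfac) =
      (\<Prod>\<beta>\<in>Pq. 1 - of_nat q * \<pi>\<^bsup>cr \<beta>\<^esup>) * f / (\<Prod>\<beta>\<in>pos. 1 - \<pi>\<^bsup>cr \<beta>\<^esup>)"
  proof -
    have "(\<Prod>\<beta>\<in>pos. 1 - of_nat q * \<pi>\<^bsup>cr \<beta>\<^esup>) = Pfac * (\<Prod>\<beta>\<in>Pq. 1 - of_nat q * \<pi>\<^bsup>cr \<beta>\<^esup> :: 'y Frac_alg)"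
      unfolding Pfac_def pos_partition(1)
      by (rule prod.union_disjoint[OF finite_char_pos_roots finite_char_pos_roots pos_partition(2)])
    then show ?thesis using Pfac_nonzero by (simp add: prod_dividef)
  qed
  then have "tsum (f / Pfac) =
      (\<Sum>u\<in>weyl D. act u ((\<Prod>\<beta>\<in>Pq. 1 - of_nat q * \<pi>\<^bsup>cr \<beta>\<^esup>) * f / (\<Prod>\<beta>\<in>pos. 1 - \<pi>\<^bsup>cr \<beta>\<^esup>)))"
    by (simp only: tsum_eq)
  finally show ?thesis .
qed

end

section \<open>The alternating sum\<close>

lemma expo_sum: "\<pi>\<^bsup>\<Sum>i\<in>I. g i\<^esup> = (\<Prod>i\<in>I. \<pi>\<^bsup>g i\<^esup>)"
  by (induction I rule: infinite_finite_induct) (simp_all add: expo_add)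

lemma half_incl_add: "half_incl (x + y) = half_incl x + half_incl y"
  by (rule twice_inject[THEN iffD1]) (simp add: half_incl_def plus_half.rep_eq half_inverse add_ac)

lemma half_incl_emb: "lattice_emb (half_incl :: 'a::fin_free_ab_group \<Rightarrow> 'a half)"
proof
  show "half_incl (x + y) = half_incl x + half_incl y" for x y :: 'a by (rule half_incl_add)
  show "inj (half_incl :: 'a \<Rightarrow> 'a half)"
  proof (rule injI)
    fix x y :: 'a assume "half_incl x = half_incl y"
    then have "x + x = y + y" unfolding half_incl_def by (simp add: half_inject)
    then show "x = y" by (simp add: double_cancel)
  qed
qed

context weyl_datum
begin

interpretation H: lattice_emb "half_incl :: 'y \<Rightarrow> 'y half"
  by (rule half_incl_emb)

abbreviation hact :: "('y \<Rightarrow> 'y) \<Rightarrow> 'y half Frac_alg \<Rightarrow> 'y half Frac_alg" where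
  "hact w \<equiv> frac_push (half_map w)"

lemma half_map_emb: assumes w: "w \<in> weyl D" shows "lattice_emb (half_map w)"
proof
  show "half_map w (x + y) = half_map w x + half_map w y" for x y
    by (rule twice_inject[THEN iffD1])
      (simp add: half_map_def plus_half.rep_eq half_inverse additive.add[OF weyl_additive[OF w]])
  show "inj (half_map w)"
    by (rule injI) (simp add: half_map_def half_inject bij_is_inj[OF weyl_bij[OF w]] inj_eq twice_inject)
qed

lemma half_map_half_incl: "w \<in> weyl D \<Longrightarrow> half_map w (half_incl \<mu>) = half_incl (w \<mu>)"
  by (simp add: half_map_def half_incl_def half_inverse additive.add[OF weyl_additive])

lemma hact_to_half: assumes w: "w \<in> weyl D" shows "hact w (to_half x) = to_half (act w x)"
proof -
  have "half_map w \<circ> half_incl = half_incl \<circ> w"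
    by (rule ext) (simp add: half_map_half_incl[OF w])
  then show ?thesis
    using H.push_comp[OF half_map_emb[OF w], of x] lattice_emb.push_comp[OF weyl_emb[OF w] half_incl_emb, of x]
    by simp
qed

lemma hact_comp: "v \<in> weyl D \<Longrightarrow> w \<in> weyl D \<Longrightarrow> hact (v \<circ> w) x = hact v (hact w x)"
proof -
  assume v: "v \<in> weyl D" and w: "w \<in> weyl D"
  have "half_map v \<circ> half_map w = half_map (v \<circ> w)"
    by (rule ext) (simp add: half_map_def half_inverse)
  then show ?thesis
    using lattice_emb.push_comp[OF half_map_emb[OF w] half_map_emb[OF v], of x] by simp
qed

text \<open>Up to the sign (-1)^|pos| the Weyl denominator in the coroots. Its inverse is the
  prefactor of \<open>Omega_op\<close>.\<close>

definition Delta :: "'y half Frac_alg" where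
  "Delta = \<pi>\<^bsup>rho_check D\<^esup> * (\<Prod>\<alpha>\<in>pos. to_half (\<pi>\<^bsup>- cr \<alpha>\<^esup>) - 1)"

text \<open>\<open>rho_check\<close> drops by the coroot of \<alpha>. With x its exponential, the
  factor 1/x - 1 becomes x - 1, and 1/x times this is the negative of the original factor; all other
  factors are permuted.\<close>

lemma hact_refl_Delta: assumes a: "\<alpha> \<in> simple D" shows "hact (s \<alpha>) Delta = - Delta"
proof -
  note ar = simple_root[OF a]
  note sW = refl_weyl[OF ar]
  interpret h: lattice_emb "half_map (s \<alpha>)" by (rule half_map_emb[OF sW])
  define F where "F \<beta> = (to_half (\<pi>\<^bsup>- cr \<beta>\<^esup>) - 1 :: 'y half Frac_alg)" for \<beta>
  have F: "hact (s \<alpha>) (F \<beta>) = F (\<beta> \<circ> s \<alpha>)" if b: "\<beta> \<in> roots D" for \<beta>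
  proof -
    have "s \<alpha> (- cr \<beta>) = - cr (\<beta> \<circ> s \<alpha>)"
      by (simp only: additive.minus[OF refl_additive[OF ar]] coroot_comp_refl[OF ar b])
    then show ?thesis by (simp only: F_def h.push_diff h.push_1 hact_to_half[OF sW] act_expo[OF sW])
  qed
  have P: "(\<Prod>\<beta>\<in>pos. F \<beta>) = F \<alpha> * (\<Prod>\<beta>\<in>pos - {\<alpha>}. F \<beta>)"
    by (rule prod.remove[OF finite_pos simple_pos[OF a]])
  have "hact (s \<alpha>) (\<Prod>\<beta>\<in>pos - {\<alpha>}. F \<beta>) = (\<Prod>\<beta>\<in>pos - {\<alpha>}. F (\<beta> \<circ> s \<alpha>))"
    unfolding h.push_prod using pos_root by (intro prod.cong refl F) blast
  also have "\<dots> = (\<Prod>\<beta>\<in>pos - {\<alpha>}. F \<beta>)"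
    by (rule prod.reindex_bij_betw[OF bij_pos_minus_simple[OF a]])
  finally have R: "hact (s \<alpha>) (\<Prod>\<beta>\<in>pos - {\<alpha>}. F \<beta>) = (\<Prod>\<beta>\<in>pos - {\<alpha>}. F \<beta>)" .
  let ?S = "\<Sum>\<beta>\<in>pos. cr \<beta>"
  have "s \<alpha> ?S = (\<Sum>\<beta>\<in>pos. cr (\<beta> \<circ> s \<alpha>))"
    by (simp add: additive.sum[OF refl_additive[OF ar]] coroot_comp_refl ar pos_root)
  also have "\<dots> = ?S - cr \<alpha> + (- cr \<alpha>)"
    using sum_pos_refl[OF a, of cr] by (simp add: coroot_neg ar)
  finally have "half_map (s \<alpha>) (rho_check D) = rho_check D + half_incl (- cr \<alpha>)"
    unfolding half_map_def rho_check_def half_incl_def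
    by (intro twice_inject[THEN iffD1]) (simp add: plus_half.rep_eq half_inverse)
  then have "hact (s \<alpha>) (\<pi>\<^bsup>rho_check D\<^esup>) = \<pi>\<^bsup>rho_check D\<^esup> * \<pi>\<^bsup>half_incl (- cr \<alpha>)\<^esup>"
    by (simp add: expo_add)
  then have "hact (s \<alpha>) Delta = \<pi>\<^bsup>rho_check D\<^esup> * (\<pi>\<^bsup>half_incl (- cr \<alpha>)\<^esup> * F (\<alpha> \<circ> s \<alpha>)) * (\<Prod>\<beta>\<in>pos - {\<alpha>}. F \<beta>)"
    unfolding Delta_def F_def[symmetric] P by (simp only: h.push_mult R F[OF ar] mult.assoc)
  also have "\<pi>\<^bsup>half_incl (- cr \<alpha>)\<^esup> * F (\<alpha> \<circ> s \<alpha>) = - F \<alpha>"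
  proof -
    have "F (\<alpha> \<circ> s \<alpha>) = \<pi>\<^bsup>half_incl (cr \<alpha>)\<^esup> - 1"
      by (simp only: F_def comp_refl_self[OF ar] coroot_neg[OF ar] H.push_expo minus_minus)
    moreover have "\<pi>\<^bsup>half_incl (- cr \<alpha>)\<^esup> * \<pi>\<^bsup>half_incl (cr \<alpha>)\<^esup> = (1 :: 'y half Frac_alg)"
      unfolding expo_add[symmetric] half_incl_add[symmetric] by (simp add: additive.zero[OF H.ad])
    ultimately show ?thesis by (simp add: F_def right_diff_distrib)
  qed
  finally show ?thesis unfolding Delta_def F_def[symmetric] P by simp
qed

lemma hact_Delta: assumes w: "w \<in> weyl D" shows "hact w Delta = (- 1) ^ len w * Delta"
proof (rule weyl_induct[of w "\<lambda>w. hact w Delta = (- 1) ^ len w * Delta"])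
  show "w \<in> weyl D" by fact
  have "half_map id = (id :: 'y half \<Rightarrow> 'y half)"
    by (rule ext) (simp add: half_map_def twice_inverse)
  then show "hact id Delta = (- 1) ^ len id * Delta" by (simp add: frac_push_id)
next
  fix \<alpha> w assume a: "\<alpha> \<in> simple D" and w: "w \<in> weyl D" and IH: "hact w Delta = (- 1) ^ len w * Delta"
  note sW = refl_weyl[OF simple_root[OF a]]
  interpret h: lattice_emb "half_map (s \<alpha>)" by (rule half_map_emb[OF sW])
  have m: "hact (s \<alpha>) ((- 1) ^ n) = (- 1) ^ n" for n
    by (induction n) (simp_all add: h.push_mult h.push_minus)
  have "hact (s \<alpha> \<circ> w) Delta = (- 1) ^ len w * (- Delta)"
    by (simp only: hact_comp[OF sW w] IH h.push_mult m hact_refl_Delta[OF a])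
  also have "\<dots> = (- 1) ^ len (s \<alpha> \<circ> w) * Delta"
    using len_refl_pos[OF a w] len_refl_neg[OF a w] by (cases "\<alpha> \<circ> w \<in> pos") simp_all
  finally show "hact (s \<alpha> \<circ> w) Delta = (- 1) ^ len (s \<alpha> \<circ> w) * Delta" .
qed

text \<open>Twice \<open>rho_check\<close> is the sum of the positive coroots, which supplies one
  exponential x to each factor 1/x - 1 and turns it into 1 - x.\<close>

lemma Delta_rho: "Delta * \<pi>\<^bsup>rho_check D\<^esup> = to_half (\<Prod>\<alpha>\<in>pos. 1 - \<pi>\<^bsup>cr \<alpha>\<^esup>)"
proof -
  have "rho_check D + rho_check D = half_incl (\<Sum>\<alpha>\<in>pos. cr \<alpha>)"
    by (rule twice_inject[THEN iffD1]) (simp add: rho_check_def half_incl_def plus_half.rep_eq half_inverse)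
  also have "\<dots> = (\<Sum>\<alpha>\<in>pos. half_incl (cr \<alpha>))" by (rule additive.sum[OF H.ad])
  finally have "\<pi>\<^bsup>rho_check D\<^esup> * \<pi>\<^bsup>rho_check D\<^esup> = \<pi>\<^bsup>\<Sum>\<alpha>\<in>pos. half_incl (cr \<alpha>)\<^esup>"
    by (simp add: expo_add[symmetric])
  also have "\<dots> = (\<Prod>\<alpha>\<in>pos. \<pi>\<^bsup>half_incl (cr \<alpha>)\<^esup>)"
    by (rule expo_sum)
  finally have r: "\<pi>\<^bsup>rho_check D\<^esup> * \<pi>\<^bsup>rho_check D\<^esup> = (\<Prod>\<alpha>\<in>pos. \<pi>\<^bsup>half_incl (cr \<alpha>)\<^esup>)" .
  have "Delta * \<pi>\<^bsup>rho_check D\<^esup> =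
      (\<pi>\<^bsup>rho_check D\<^esup> * \<pi>\<^bsup>rho_check D\<^esup>) * (\<Prod>\<alpha>\<in>pos. to_half (\<pi>\<^bsup>- cr \<alpha>\<^esup>) - 1)"
    by (simp add: Delta_def mult_ac)
  also have "\<dots> = (\<Prod>\<alpha>\<in>pos. \<pi>\<^bsup>half_incl (cr \<alpha>)\<^esup> * (to_half (\<pi>\<^bsup>- cr \<alpha>\<^esup>) - 1))"
    by (simp only: r prod.distrib)
  also have "\<dots> = (\<Prod>\<alpha>\<in>pos. to_half (1 - \<pi>\<^bsup>cr \<alpha>\<^esup>))"
    by (intro prod.cong refl) (simp add: H.push_diff H.push_inverse expo_minus right_diff_distrib)
  finally show ?thesis by (simp only: H.push_prod)
qed

text \<open>Moved to the right of w, \<open>inverse Delta\<close> absorbs the sign by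
  anti-invariance and meets the second \<open>rho_check\<close> factor, where
  \<open>Delta_rho\<close> applies. The form of the result shows that the operator preserves the
  image of \<open>to_half\<close>.\<close>

lemma Omega_op_to_half:
  "Omega_op D (to_half F) = to_half (\<Sum>w\<in>weyl D. act w (F / (\<Prod>\<alpha>\<in>pos. 1 - \<pi>\<^bsup>cr \<alpha>\<^esup>)))"
proof -
  have "Omega_op D (to_half F) = inverse Delta * (\<Sum>w\<in>weyl D. (- 1) ^ len w * hact w (\<pi>\<^bsup>- rho_check D\<^esup> * to_half F))"
    unfolding Omega_op_def Delta_def
    by (simp add: expo_minus inverse_mult_distrib prod_inversef[symmetric] comp_def)
  also have "\<dots> = (\<Sum>w\<in>weyl D. to_half (act w (F / (\<Prod>\<alpha>\<in>pos. 1 - \<pi>\<^bsup>cr \<alpha>\<^esup>))))"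
    unfolding sum_distrib_left
  proof (intro sum.cong refl)
    fix w assume w: "w \<in> weyl D"
    interpret h: lattice_emb "half_map w" by (rule half_map_emb[OF w])
    have "inverse ((- 1) ^ len w :: 'y half Frac_alg) = (- 1) ^ len w"
      by (simp add: power_inverse[symmetric])
    then have "inverse Delta * (- 1) ^ len w = inverse (hact w Delta)"
      by (simp add: hact_Delta[OF w] inverse_mult_distrib mult.commute)
    then have "inverse Delta * ((- 1) ^ len w * hact w (\<pi>\<^bsup>- rho_check D\<^esup> * to_half F)) =
        hact w (inverse Delta * (\<pi>\<^bsup>- rho_check D\<^esup> * to_half F))"
      by (simp only: h.push_mult h.push_inverse mult.assoc[symmetric])
    also have "inverse Delta * (\<pi>\<^bsup>- rho_check D\<^esup> * to_half F) = to_half F / (Delta * \<pi>\<^bsup>rho_check D\<^esup>)"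
      by (simp add: expo_minus divide_inverse inverse_mult_distrib mult_ac)
    also have "\<dots> = to_half (F / (\<Prod>\<alpha>\<in>pos. 1 - \<pi>\<^bsup>cr \<alpha>\<^esup>))"
      by (simp only: Delta_rho H.push_divide)
    also have "hact w \<dots> = to_half (act w (F / (\<Prod>\<alpha>\<in>pos. 1 - \<pi>\<^bsup>cr \<alpha>\<^esup>)))"
      by (rule hact_to_half[OF w])
    finally show "inverse Delta * ((- 1) ^ len w * hact w (\<pi>\<^bsup>- rho_check D\<^esup> * to_half F)) =
        to_half (act w (F / (\<Prod>\<alpha>\<in>pos. 1 - \<pi>\<^bsup>cr \<alpha>\<^esup>)))" .
  qed
  finally show ?thesis by (simp only: H.push_sum)
qed

end

text \<open>As a field homomorphism \<open>to_half\<close> is injective, so equality over the half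
  lattice is equality in the original fraction field; there the operators are compared on an
  arbitrary f.\<close>

theorem theorem13:
  fixes D :: "'y::fin_free_ab_group root_datum"
    and q :: nat
    and \<epsilon> :: "'y hecke \<Rightarrow> complex"
    and \<rho>\<epsilon> :: 'y
    and red :: "('y \<Rightarrow> 'y) \<Rightarrow> ('y \<Rightarrow> int) list"
    and f :: "'y Frac_alg"
  assumes "based_root_datum D"
    and "primepow q"
    and "hecke_character D q \<epsilon>"
    and "\<rho>\<epsilon> + \<rho>\<epsilon> = (\<Sum>\<alpha>\<in>char_pos_roots D \<epsilon> (- 1). coroot D \<alpha>)"
    and "\<And>w. w \<in> weyl D \<Longrightarrow> reduced_word D w (red w)"
  shows "to_half (\<Sum>w\<in>weyl D. T_tw_word D q \<epsilon> \<rho>\<epsilon> (red w) f) =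
           to_half (\<Prod>\<alpha>\<in>char_pos_roots D \<epsilon> (- 1). 1 - of_nat q * \<pi>\<^bsup>coroot D \<alpha>\<^esup>)
           * Omega_op D
               (to_half (\<Prod>\<alpha>\<in>char_pos_roots D \<epsilon> (of_nat q). 1 - of_nat q * \<pi>\<^bsup>coroot D \<alpha>\<^esup>)
                * to_half f)"
proof -
  interpret hecke_char_rho D q \<epsilon> \<rho>\<epsilon>
  proof
    show "based_root_datum D" "hecke_character D q \<epsilon>" by fact+
    show "\<exists>as. set as \<subseteq> simple D \<and> word_prod D as = w" if "w \<in> weyl D" for w
      using assms(5)[OF that] unfolding reduced_word_def by blast
    show "1 < q" using assms(2) primepow_gt_Suc_0[of q] by simp
    show "\<rho>\<epsilon> + \<rho>\<epsilon> = (\<Sum>\<alpha>\<in>char_pos_roots D \<epsilon> (- 1). coroot D \<alpha>)" by fact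
  qed
  interpret H: lattice_emb "half_incl :: 'y \<Rightarrow> 'y half" by (rule half_incl_emb)
  have "(\<Sum>w\<in>weyl D. T_tw_word D q \<epsilon> \<rho>\<epsilon> (red w) f) = Pfac *
      (\<Sum>u\<in>weyl D. act u ((\<Prod>\<beta>\<in>Pq. 1 - of_nat q * \<pi>\<^bsup>cr \<beta>\<^esup>) * f / (\<Prod>\<beta>\<in>pos. 1 - \<pi>\<^bsup>cr \<beta>\<^esup>)))"
    using assms(5) by (rule sum_T_tw)
  then show ?thesis
    unfolding H.push_mult[symmetric] Omega_op_to_half Pfac_def[symmetric] by (rule arg_cong)
qed

end
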